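(* Let $\mu$ be a positive Radon measure on $\mathbb R^d$ that is doubling, i.e. $\mu(2Q)\le c_\mu\mu(Q)$ for all cubes $Q$, and let $Q_0\subset\mathbb R^d$ be a cube. Let $1<p<\infty$ and $0<r\le\infty$. Then for every $f\in L_{p,r}(Q_0,\mu)$ and every $t\in(0,1)$, $$\int_0^{t(1-\log t)^{-p}}\big(u^{1/p}(f-f_{Q_0;\mu})^*_\mu(u)\big)^r\frac{du}{u}\lesssim\int_0^t\big(u^{1/p}(f^{\#}_{Q_0;\mu})^*_\mu(u)\big)^r\frac{du}{u}$$ (if $r=\infty$, the integrals are replaced by the suprema of $u^{1/p}(\cdot)^*_\mu(u)$ over the same ranges of $u$), with a constant independent of $f$ and $t$. This inequality is optimal in the following sense (with $\mu$ the Lebesgue measure): for $\lambda\in\mathbb R$, the inequality $$\int_0^{t(1-\log t)^{-\lambda}}\big(u^{1/p}(f-f_{Q_0})^*(u)\big)^r\frac{du}{u}\lesssim\int_0^t\big(u^{1/p}(f^{\#}_{Q_0})^*(u)\big)^r\frac{du}{u}$$ holds for all $f\in L_{p,r}(Q_0)$ and $t\in(0,1)$ (with a constant independent of $f,t$) if and only if $\lambda\ge p$. The same result holds with $f^{\#}_{Q_0;\mu}$ replaced by $M^{\#}_{s,Q_0;\mu}f$ for $0<s\le s_0$, where $s_0>0$ depends on $d$.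
   Context: Cubes have sides parallel to the axes; $2Q$ is the cube with the same center as $Q$ and twice the side length. $f^*_\mu(t)=\inf\{\lambda\ge0:\mu\{|f|>\lambda\}\le t\}$; the subscript $\mu$ is omitted for Lebesgue measure. $f_{Q;\mu}=\frac1{\mu(Q)}\int_Qf\,d\mu$ ($f_Q$ for Lebesgue measure). For $f\in L_1(Q_0,\mu)$ and $x\in Q_0$, $$f^{\#}_{Q_0;\mu}(x)=\sup_{x\in Q,\,Q\subset Q_0}\frac1{\mu(Q)}\int_Q|f-f_{Q;\mu}|\,d\mu$$ ($f^{\#}_{Q_0}$ for Lebesgue measure), and for $s\in(0,1)$, $$M^{\#}_{s,Q_0;\mu}f(x)=\sup_{x\in Q,\,Q\subset Q_0}\ \inf_{c\in\mathbb R}\ \inf\big\{\alpha\ge0:\mu\{y\in Q:|f(y)-c|>\alpha\}<s\mu(Q)\big\}.$$ $L_{p,r}(Q_0,\mu)$ is the Lorentz space with quasi-norm $\big(\int_0^1(t^{1/p}f^*_\mu(t))^r\frac{dt}t\big)^{1/r}$ (supremum if $r=\infty$). $A\lesssim B$ means $A\le CB$ with a constant $C>0$. *)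

theory Defs
  imports "HOL-Analysis.Analysis"
begin

text \<open>
  Cubes are taken open. This choice is immaterial: a doubling measure does not charge the faces of
  cubes, so replacing open by closed cubes changes the maximal functions below at most on null sets.
\<close>

definition cube :: "real ^ 'n \<Rightarrow> real \<Rightarrow> (real ^ 'n) set" where
  "cube c l = box (c - vec (l / 2)) (c + vec (l / 2))"

definition is_cube :: "(real ^ 'n) set \<Rightarrow> bool" where
  "is_cube Q \<longleftrightarrow> (\<exists>c l. 0 < l \<and> Q = cube c l)"

text \<open>
  On \<open>\<real>\<^sup>d\<close> a Borel measure that is finite on compact sets is automatically regular.
\<close>

definition radon_measure :: "(real ^ 'n) measure \<Rightarrow> bool" where
  "radon_measure \<mu> \<longleftrightarrow> sets \<mu> = sets borel \<and> (\<forall>K. compact K \<longrightarrow> emeasure \<mu> K < \<infinity>)"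

definition doubling_measure :: "(real ^ 'n) measure \<Rightarrow> bool" where
  "doubling_measure \<mu> \<longleftrightarrow>
     (\<exists>C::real. 0 < C \<and>
       (\<forall>c l. 0 < l \<longrightarrow> emeasure \<mu> (cube c (2 * l)) \<le> ennreal C * emeasure \<mu> (cube c l)))"

text \<open>
  Below, \<open>M\<close> is meant to be the completion of a Borel measure (for Lebesgue measure:
  \<^term>\<open>lebesgue\<close>), so that the functions considered are the \<open>\<mu>\<close>-measurable ones.
  The rearrangement is that of a nonnegative function on \<open>Q\<^sub>0\<close> with values in \<open>[0, \<infinity>]\<close>;
  for real-valued \<open>f\<close> it is applied to \<open>\<bar>f\<bar>\<close>.
\<close>

definition rearrangement ::
  "'a measure \<Rightarrow> 'a set \<Rightarrow> ('a \<Rightarrow> ennreal) \<Rightarrow> real \<Rightarrow> ennreal" where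
  "rearrangement M Q0 F t =
     Inf {ennreal a |a. 0 \<le> a \<and> emeasure M {x \<in> Q0. F x > ennreal a} \<le> ennreal t}"

definition average :: "'a measure \<Rightarrow> 'a set \<Rightarrow> ('a \<Rightarrow> real) \<Rightarrow> real" where
  "average M Q f = (LINT x:Q|M. f x) / measure M Q"

definition mean_osc :: "'a measure \<Rightarrow> 'a set \<Rightarrow> ('a \<Rightarrow> real) \<Rightarrow> ennreal" where
  "mean_osc M Q f = (\<integral>\<^sup>+x\<in>Q. ennreal \<bar>f x - average M Q f\<bar> \<partial>M) / emeasure M Q"

definition sharp_maximal ::
  "(real ^ 'n) measure \<Rightarrow> (real ^ 'n) set \<Rightarrow> (real ^ 'n \<Rightarrow> real) \<Rightarrow> real ^ 'n \<Rightarrow> ennreal" where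
  "sharp_maximal M Q0 f x = (SUP Q \<in> {Q. is_cube Q \<and> x \<in> Q \<and> Q \<subseteq> Q0}. mean_osc M Q f)"

definition local_osc :: "real \<Rightarrow> 'a measure \<Rightarrow> 'a set \<Rightarrow> ('a \<Rightarrow> real) \<Rightarrow> ennreal" where
  "local_osc s M Q f =
     (INF c::real. Inf {ennreal \<alpha> |\<alpha>. 0 \<le> \<alpha> \<and>
        emeasure M {y \<in> Q. \<bar>f y - c\<bar> > \<alpha>} < ennreal s * emeasure M Q})"

definition local_sharp_maximal ::
  "real \<Rightarrow> (real ^ 'n) measure \<Rightarrow> (real ^ 'n) set \<Rightarrow> (real ^ 'n \<Rightarrow> real) \<Rightarrow> real ^ 'n \<Rightarrow> ennreal" where
  "local_sharp_maximal s M Q0 f x =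
     (SUP Q \<in> {Q. is_cube Q \<and> x \<in> Q \<and> Q \<subseteq> Q0}. local_osc s M Q f)"

text \<open>The library has no real powers on \<^typ>\<open>ennreal\<close>; only exponents \<open>a > 0\<close> are used.\<close>

definition enn_powr :: "ennreal \<Rightarrow> real \<Rightarrow> ennreal" where
  "enn_powr x a = (if x = \<infinity> then \<infinity> else ennreal (enn2real x powr a))"

text \<open>
  \<open>\<integral>\<^sub>0\<^sup>T (u\<^sup>1\<^sup>/\<^sup>p h(u))\<^sup>r du/u\<close>, without an outer power \<open>1/r\<close>; the supremum over \<open>0 < u < T\<close> if \<open>r = \<infinity>\<close>.
\<close>

definition lorentz_functional :: "real \<Rightarrow> ennreal \<Rightarrow> real \<Rightarrow> (real \<Rightarrow> ennreal) \<Rightarrow> ennreal" where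
  "lorentz_functional p r T h =
     (if r = \<infinity> then (SUP u\<in>{0<..<T}. ennreal (u powr (1 / p)) * h u)
      else (\<integral>\<^sup>+u\<in>{0<..<T}.
              enn_powr (ennreal (u powr (1 / p)) * h u) (enn2real r) * ennreal (1 / u) \<partial>lborel))"

definition lorentz_quasinorm ::
  "'a measure \<Rightarrow> 'a set \<Rightarrow> real \<Rightarrow> ennreal \<Rightarrow> ('a \<Rightarrow> real) \<Rightarrow> ennreal" where
  "lorentz_quasinorm M Q0 p r f =
     (let N = lorentz_functional p r 1 (rearrangement M Q0 (\<lambda>x. ennreal \<bar>f x\<bar>))
      in if r = \<infinity> then N else enn_powr N (1 / enn2real r))"

definition lorentz_space ::
  "'a measure \<Rightarrow> 'a set \<Rightarrow> real \<Rightarrow> ennreal \<Rightarrow> ('a \<Rightarrow> real) set" where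
  "lorentz_space M Q0 p r =
     {f \<in> borel_measurable (restrict_space M Q0). lorentz_quasinorm M Q0 p r f < \<infinity>}"

text \<open>
  The inequality with logarithmic exponent \<open>\<gamma>\<close> and maximal operator \<open>S\<close>, for all \<open>f\<close> and \<open>t\<close> with a
  single constant.
\<close>

definition sharp_inequality ::
  "'a measure \<Rightarrow> 'a set \<Rightarrow> real \<Rightarrow> ennreal \<Rightarrow> real \<Rightarrow> (('a \<Rightarrow> real) \<Rightarrow> 'a \<Rightarrow> ennreal) \<Rightarrow> bool" where
  "sharp_inequality M Q0 p r \<gamma> S \<longleftrightarrow>
     (\<exists>C::real. 0 < C \<and>
       (\<forall>f \<in> lorentz_space M Q0 p r. \<forall>t\<in>{0<..<1}.
          lorentz_functional p r (t * (1 - ln t) powr (- \<gamma>))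
            (rearrangement M Q0 (\<lambda>x. ennreal \<bar>f x - average M Q0 f\<bar>))
          \<le> ennreal C * lorentz_functional p r t (rearrangement M Q0 (S f))))"

end

theory Submission
  imports Defs "HOL-Real_Asymp.Real_Asymp"
begin

text \<open>
  Let \<open>c\<close> be a median of \<open>f\<close> on \<open>Q\<^sub>0\<close>, \<open>g\<close> the rearrangement of \<open>f - c\<close> and \<open>h\<close> that of the maximal
  function. If \<open>G\<close> is the set where \<open>\<bar>f - c\<bar>\<close> exceeds \<open>g(2u)\<close>, stop at the maximal dyadic cells in
  which \<open>G\<close> has density above one half; their total measure is at most \<open>4u\<close>. A cell contained in the
  set where the maximal function exceeds \<open>h(u/2)\<close> is discarded. Any other cell has a point where
  the maximal function is at most \<open>h(u/2)\<close>, hence all cubes between the cell and its parent oscillate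
  by at most that much. Comparing medians along a chain of such cubes gives
  \<open>g(u) \<le> g(2u) + K h(u/2)\<close>, and by iteration \<open>g(u) \<le> K \<Sum>k. h(2\<^sup>k u/2)\<close>.

  The terms with \<open>2\<^sup>k u/2 < t\<close> are controlled by dilation invariance of the Lorentz integral. The
  others number \<open>O(1 - log t)\<close> and are at most \<open>h(t)\<close>, and the factor \<open>1 - log t\<close> is
  exactly compensated by integrating only up to \<open>t (1 - log t)\<^bsup>-p\<^esup>\<close>. The difference between median
  and mean only costs a weak-type bound. For optimality, the logarithm of the distance to a face
  of \<open>Q\<^sub>0\<close> has a bounded sharp function and \<open>f\<^sup>*(u) = log (1/u) + O(1)\<close>.
\<close>

subsection \<open>Dyadic cells and maximal cells\<close>

text \<open>The threshold \<open>s0\<close> must not depend on the doubling constant, yet a cell and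
  its parent may differ in measure by a factor as large as \<open>C\<^sup>2\<close>; exceptional
  sets of relative size 1/8 in both could then cover the cell. This forces the chain of intermediate
  cubes. The chain exists because the measure of a cube varies continuously with centre and side,
  and that holds because hyperplanes are null for a doubling measure. The doubling constant only
  decides the number of links, hence enters \<open>K\<close> alone. The scales 2u and u/2 form a
  budget: density one half turns 1/8 into 1/4, and 1/4 of 2u plus u/2 is u. The iteration keeps one
  constant c at all scales, and at the last scale c must fit \<open>Q0\<close>. Oscillation control
  outside an eighth of \<open>Q0\<close> locates the median, but says nothing about the mean. The
  mean is compared with the median once, by summing the final bound over dyadic levels; the ratio of
  that series is 2 to the power 1/p - 1, so p > 1 enters there. For r < 1 the triangle inequality
  fails; geometric weights take its place for every r.\<close>

lemma mem_cube: "y \<in> cube c l \<longleftrightarrow> (\<forall>i. \<bar>y $ i - c $ i\<bar> < l / 2)"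
proof -
  have "(c $ i - l / 2 < y $ i \<and> y $ i < c $ i + l / 2) \<longleftrightarrow> \<bar>y $ i - c $ i\<bar> < l / 2" for i
    unfolding abs_less_iff by linarith
  then show ?thesis
    unfolding cube_def mem_box_cart by simp
qed

lemma open_cube [simp, intro]: "open (cube c l)"
  unfolding cube_def by (rule open_box)

lemma cube_in_borel [simp, intro]: "cube c l \<in> sets borel"
  by (rule borel_open) simp

text \<open>Equality of floors makes the cells of one level the classes of an equivalence relation,
  so they tile all of space without gaps, and nesting of levels is arithmetic of floors. Open cubes
  would lose their faces; the difference is repaired by \<open>emeasure_cell_Int\<close>.\<close>

definition cell :: "real ^ 'n \<Rightarrow> real \<Rightarrow> nat \<Rightarrow> real ^ 'n \<Rightarrow> (real ^ 'n) set" where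
  "cell a l n x = {y. \<forall>i. \<lfloor>2 ^ n * (y $ i - a $ i) / l\<rfloor> = \<lfloor>2 ^ n * (x $ i - a $ i) / l\<rfloor>}"

definition cell_center :: "real ^ 'n \<Rightarrow> real \<Rightarrow> nat \<Rightarrow> real ^ 'n \<Rightarrow> real ^ 'n" where
  "cell_center a l n x =
     (\<chi> i. a $ i + (of_int \<lfloor>2 ^ n * (x $ i - a $ i) / l\<rfloor> + 1 / 2) * (l / 2 ^ n))"

lemma mem_cell_self [simp]: "x \<in> cell a l n x"
  by (simp add: cell_def)

lemma cell_eq: "y \<in> cell a l n x \<Longrightarrow> cell a l n y = cell a l n x"
  by (auto simp: cell_def)

lemma floor_double:
  fixes u v :: real
  assumes "\<lfloor>2 * u\<rfloor> = \<lfloor>2 * v\<rfloor>"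
  shows "\<lfloor>u\<rfloor> = \<lfloor>v\<rfloor>"
proof -
  have "\<lfloor>w\<rfloor> = \<lfloor>2 * w\<rfloor> div 2" for w :: real
    using floor_divide_real_eq_div[of 2 "2 * w"] by simp
  then show ?thesis using assms by metis
qed

lemma cell_Suc_subset: "cell a l (Suc n) x \<subseteq> cell a l n x"
proof
  fix y assume "y \<in> cell a l (Suc n) x"
  then have "\<lfloor>2 * (2 ^ n * (y $ i - a $ i) / l)\<rfloor> = \<lfloor>2 * (2 ^ n * (x $ i - a $ i) / l)\<rfloor>" for i
    by (simp add: cell_def mult.assoc)
  then show "y \<in> cell a l n x"
    unfolding cell_def using floor_double by blast
qed

lemma cell_antimono: "k \<le> n \<Longrightarrow> cell a l n x \<subseteq> cell a l k x"
  by (induction n rule: dec_induct) (use cell_Suc_subset in blast)+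

lemma cell_borel [simp, intro]: "cell a l n x \<in> sets borel"
proof -
  have "cell a l n x =
      (\<Inter>i. {y \<in> space borel. \<lfloor>2 ^ n * (y $ i - a $ i) / l\<rfloor> = \<lfloor>2 ^ n * (x $ i - a $ i) / l\<rfloor>})"
    by (auto simp: cell_def)
  moreover have "{y \<in> space borel. \<lfloor>2 ^ n * (y $ i - a $ i) / l\<rfloor> = (k :: int)} \<in> sets borel" for i k
    by measurable
  ultimately show ?thesis
    by (simp only:) (rule sets.countable_INT, auto)
qed

lemma countable_cells:
  fixes a :: "real ^ 'n"
  shows "countable (range (cell a l n))"
proof -
  have "range (cell a l n) \<subseteq>
      (\<lambda>k. {y. \<forall>i. \<lfloor>2 ^ n * (y $ i - a $ i) / l\<rfloor> = k $ i}) ` (UNIV :: (int ^ 'n) set)"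
    by (auto simp: cell_def image_iff intro!: exI[of _ "\<chi> i. \<lfloor>2 ^ n * (_ $ i - a $ i) / l\<rfloor>"])
  moreover have "countable (UNIV :: (int ^ 'n) set)"
  proof -
    have "countable (PiE (UNIV :: 'n set) (\<lambda>_. UNIV :: int set))"
      by (rule countable_PiE) auto
    then have "countable (UNIV :: ('n \<Rightarrow> int) set)" by (simp add: PiE_UNIV_domain)
    then have "countable (vec_lambda ` (UNIV :: ('n \<Rightarrow> int) set))" by (rule countable_image)
    moreover have "vec_lambda ` (UNIV :: ('n \<Rightarrow> int) set) = UNIV"
      by (metis surj_def vec_lambda_eta)
    ultimately show ?thesis by simp
  qed
  ultimately show ?thesis
    by (meson countable_image countable_subset)
qed

text \<open>The stopping family of a Calderon-Zygmund decomposition. Level 0 is the coarsest, so a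
  point lying in any cell with \<open>P\<close> has a first such level.\<close>

definition maximal_cells ::
  "real ^ 'n \<Rightarrow> real \<Rightarrow> ((real ^ 'n) set \<Rightarrow> bool) \<Rightarrow> (real ^ 'n) set set" where
  "maximal_cells a l P =
     {cell a l n x |n x. P (cell a l n x) \<and> (\<forall>k<n. \<not> P (cell a l k x))}"

lemma maximal_cells_P: "D \<in> maximal_cells a l P \<Longrightarrow> P D"
  by (auto simp: maximal_cells_def)

lemma countable_maximal_cells: "countable (maximal_cells a l P)"
proof -
  have "maximal_cells a l P \<subseteq> (\<Union>n. range (cell a l n))"
    by (auto simp: maximal_cells_def)
  then show ?thesis
    by (rule countable_subset) (auto intro: countable_cells)
qed

lemma maximal_cells_borel: "maximal_cells a l P \<subseteq> sets borel"
  by (auto simp: maximal_cells_def)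

lemma Union_maximal_cells: "\<Union> (maximal_cells a l P) = {x. \<exists>n. P (cell a l n x)}"
proof (intro set_eqI iffI)
  fix x assume "x \<in> \<Union> (maximal_cells a l P)"
  then show "x \<in> {x. \<exists>n. P (cell a l n x)}"
  proof
    fix D assume D: "D \<in> maximal_cells a l P" "x \<in> D"
    then obtain n y where "D = cell a l n y" by (auto simp: maximal_cells_def)
    then have "D = cell a l n x" using D(2) cell_eq by blast
    then show ?thesis using maximal_cells_P[OF D(1)] by auto
  qed
next
  fix x assume "x \<in> {x. \<exists>n. P (cell a l n x)}"
  then obtain n where n: "P (cell a l n x)" "\<forall>k<n. \<not> P (cell a l k x)"
    using exists_least_iff[of "\<lambda>n. P (cell a l n x)"] by auto
  then have "cell a l n x \<in> maximal_cells a l P" by (auto simp: maximal_cells_def)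
  then show "x \<in> \<Union> (maximal_cells a l P)" by (rule UnionI) simp
qed

lemma disjoint_maximal_cells: "disjoint (maximal_cells a l P)"
proof (rule disjointI)
  fix D E assume DE: "D \<in> maximal_cells a l P" "E \<in> maximal_cells a l P" "D \<noteq> E"
  from DE obtain n x where D: "D = cell a l n x" "P (cell a l n x)" "\<And>k. k < n \<Longrightarrow> \<not> P (cell a l k x)"
    unfolding maximal_cells_def by blast
  from DE obtain m y where E: "E = cell a l m y" "P (cell a l m y)" "\<And>k. k < m \<Longrightarrow> \<not> P (cell a l k y)"
    unfolding maximal_cells_def by blast
  show "D \<inter> E = {}"
  proof (rule ccontr)
    assume "D \<inter> E \<noteq> {}"
    then obtain z where z: "z \<in> cell a l n x" "z \<in> cell a l m y" using D E by auto
    have nx: "cell a l k z = cell a l k x" if "k \<le> n" for k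
      using cell_antimono[OF that] z(1) by (intro cell_eq) auto
    have my: "cell a l k z = cell a l k y" if "k \<le> m" for k
      using cell_antimono[OF that] z(2) by (intro cell_eq) auto
    have "n = m"
      using D(2,3) E(2,3) nx my by (metis le_refl less_imp_le linorder_neqE_nat)
    then show False using DE(3) D(1) E(1) nx my by auto
  qed
qed

text \<open>Passes a relative size estimate from single stopping cells to their union; both the
  density argument and the two halves of the good-lambda estimate end with it.\<close>

lemma emeasure_Int_disjoint_Union_le:
  assumes D: "countable D" "disjoint D" "D \<subseteq> sets M"
    and E: "E \<in> sets M" and F: "F \<in> sets M"
    and le: "\<And>d. d \<in> D \<Longrightarrow> emeasure M (E \<inter> d) \<le> \<theta> * emeasure M (F \<inter> d)"
  shows "emeasure M (E \<inter> \<Union>D) \<le> \<theta> * emeasure M (F \<inter> \<Union>D)"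
proof -
  have *: "emeasure M (A \<inter> \<Union>D) = (\<integral>\<^sup>+d. emeasure M (A \<inter> d) \<partial>count_space D)" if "A \<in> sets M" for A
  proof -
    have "A \<inter> \<Union>D = (\<Union>d\<in>D. A \<inter> d)" by auto
    then show ?thesis
      using D that
      by (simp only:) (rule emeasure_UN_countable, auto simp: disjoint_family_on_def disjoint_def)
  qed
  have "emeasure M (E \<inter> \<Union>D) \<le> (\<integral>\<^sup>+d. \<theta> * emeasure M (F \<inter> d) \<partial>count_space D)"
    unfolding *[OF E] by (rule nn_integral_mono) (auto intro: le)
  also have "\<dots> = \<theta> * emeasure M (F \<inter> \<Union>D)"
    unfolding *[OF F] by (rule nn_integral_cmult) auto
  finally show ?thesis .
qed

lemma cell_subset_ball:
  fixes x :: "real ^ 'n"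
  assumes l: "0 < l" and y: "y \<in> cell a l n x"
  shows "\<bar>y $ i - x $ i\<bar> < l / 2 ^ n"
proof -
  define u where "u = 2 ^ n * (y $ i - a $ i) / l"
  define v where "v = 2 ^ n * (x $ i - a $ i) / l"
  have "\<lfloor>u\<rfloor> = \<lfloor>v\<rfloor>" using y by (auto simp: cell_def u_def v_def)
  then have "\<bar>u - v\<bar> < 1" by linarith
  moreover have "y $ i - x $ i = (u - v) * (l / 2 ^ n)"
    using l by (simp add: u_def v_def field_simps)
  ultimately show ?thesis using l
    by (simp add: abs_mult divide_strict_right_mono)
qed

lemma small_cell_in_open:
  fixes x :: "real ^ 'n"
  assumes l: "0 < l" and U: "open U" "x \<in> U"
  shows "\<exists>n. cell a l n x \<subseteq> U"
proof -
  obtain e where e: "0 < e" "ball x e \<subseteq> U" using U open_contains_ball by blast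
  define N where "N = real CARD('n)"
  have N: "0 < N" by (simp add: N_def)
  obtain n where n: "(1 / 2) ^ n < e / (N * l)"
    using real_arch_pow_inv[of "e / (N * l)" "1 / 2"] e N l by auto
  have "cell a l n x \<subseteq> ball x e"
  proof
    fix y assume y: "y \<in> cell a l n x"
    have "norm (y - x) \<le> (\<Sum>i\<in>UNIV. \<bar>(y - x) $ i\<bar>)" by (rule norm_le_l1_cart)
    also have "\<dots> \<le> (\<Sum>i\<in>(UNIV :: 'n set). l / 2 ^ n)"
      using cell_subset_ball[OF l y] by (intro sum_mono) (auto intro: less_imp_le)
    also have "\<dots> = N * l * (1 / 2) ^ n" by (simp add: N_def power_divide)
    also have "\<dots> < e" using n N l by (simp add: field_simps)
    finally show "y \<in> ball x e" by (simp add: dist_norm norm_minus_commute)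
  qed
  then show ?thesis using e by blast
qed

text \<open>A substitute for the Lebesgue density theorem along dyadic cells.\<close>

lemma null_if_uniformly_sparse:
  fixes \<mu> :: "(real ^ 'n) measure"
  assumes sets: "sets \<mu> = sets borel" and W: "open W" "emeasure \<mu> W < \<infinity>"
    and E: "E \<in> sets borel" "E \<subseteq> W" and l: "0 < l" and \<theta>: "\<theta> < 1"
    and le: "\<And>n x. cell a l n x \<subseteq> W \<Longrightarrow>
               emeasure \<mu> (E \<inter> cell a l n x) \<le> \<theta> * emeasure \<mu> (cell a l n x)"
  shows "emeasure \<mu> E = 0"
proof -
  \<comment> \<open>Outer regularity is available for finite Borel measures, so \<mu> is first cut
    down to \<open>W\<close>.\<close>
  define \<nu> where "\<nu> = density \<mu> (indicator W)"
  have W': "W \<in> sets \<mu>" using W sets by simp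
  have \<nu>: "emeasure \<nu> A = emeasure \<mu> (W \<inter> A)" if "A \<in> sets borel" for A
    using that W' sets unfolding \<nu>_def by (subst emeasure_restricted) auto
  have open_le: "emeasure \<mu> E \<le> \<theta> * emeasure \<nu> U" if "open U" "E \<subseteq> U" for U
  proof -
    \<comment> \<open>The coarsest cells inside an open set tile it exactly, so the sparsity bound
      adds up to a bound by the measure of the whole open set.\<close>
    define D where "D = maximal_cells a l (\<lambda>C. C \<subseteq> W \<inter> U)"
    have DU: "\<Union>D = W \<inter> U"
      unfolding D_def Union_maximal_cells
    proof (intro set_eqI iffI)
      fix x assume "x \<in> {x. \<exists>n. cell a l n x \<subseteq> W \<inter> U}"
      then show "x \<in> W \<inter> U" using mem_cell_self by blast
    next
      fix x assume "x \<in> W \<inter> U"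
      then show "x \<in> {x. \<exists>n. cell a l n x \<subseteq> W \<inter> U}"
        using small_cell_in_open[OF l, of "W \<inter> U" x a] W that by auto
    qed
    have "emeasure \<mu> (E \<inter> \<Union>D) \<le> \<theta> * emeasure \<mu> (UNIV \<inter> \<Union>D)"
    proof (rule emeasure_Int_disjoint_Union_le)
      fix d assume "d \<in> D"
      then obtain n x where "d = cell a l n x" "cell a l n x \<subseteq> W \<inter> U"
        unfolding D_def maximal_cells_def by auto
      then show "emeasure \<mu> (E \<inter> d) \<le> \<theta> * emeasure \<mu> (UNIV \<inter> d)" using le[of n x] by auto
    next
      show "countable D" "disjoint D"
        unfolding D_def by (rule countable_maximal_cells disjoint_maximal_cells)+
      show "D \<subseteq> sets \<mu>"
        unfolding D_def sets by (rule maximal_cells_borel)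
      show "E \<in> sets \<mu>" "UNIV \<in> sets \<mu>"
        using E sets by auto
    qed
    also have "E \<inter> \<Union>D = E" using DU that E by auto
    also have "UNIV \<inter> \<Union>D = W \<inter> U" using DU by auto
    also have "emeasure \<mu> (W \<inter> U) = emeasure \<nu> U" using \<nu>[of U] that by auto
    finally show ?thesis .
  qed
  have \<nu>E: "emeasure \<nu> E = emeasure \<mu> E" using \<nu>[OF E(1)] E(2) by (simp add: Int_absorb1)
  have "emeasure \<nu> (space \<nu>) \<noteq> \<infinity>"
  proof -
    have "space \<nu> = UNIV" using sets_eq_imp_space_eq[OF sets] by (simp add: \<nu>_def)
    then show ?thesis using \<nu>[of UNIV] W by auto
  qed
  then have outer: "emeasure \<nu> E = (INF U \<in> {U. E \<subseteq> U \<and> open U}. emeasure \<nu> U)"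
    using E sets by (intro outer_regular) (auto simp: \<nu>_def)
  have fin: "emeasure \<mu> E < \<infinity>"
    using emeasure_mono[of E W \<mu>] E W W' by (auto intro: le_less_trans)
  show ?thesis
  proof (rule ccontr)
    assume pos: "emeasure \<mu> E \<noteq> 0"
    then obtain e where e: "emeasure \<mu> E = ennreal e" "0 < e"
      using fin by (cases "emeasure \<mu> E") (auto simp: less_le)
    have "\<theta> \<noteq> 0" using open_le[of UNIV] pos by auto
    then obtain t where t: "\<theta> = ennreal t" "0 < t" "t < 1"
      using \<theta> by (cases \<theta>) (auto simp: less_le ennreal_less_one_iff top_unique)
    \<comment> \<open>Minimising over the open sets \<open>U\<close> around \<open>E\<close> yields
      \<mu>(E) \<le> \<theta> \<mu>(E), impossible for finite positive measure and \<theta> <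
      1.\<close>
    have "emeasure \<mu> E / \<theta> \<le> emeasure \<nu> U" if "open U" "E \<subseteq> U" for U
      using open_le[OF that] \<open>\<theta> \<noteq> 0\<close>
      by (intro divide_le_posI_ennreal) (auto simp: mult.commute zero_less_iff_neq_zero)
    then have "emeasure \<mu> E / \<theta> \<le> (INF U \<in> {U. E \<subseteq> U \<and> open U}. emeasure \<nu> U)"
      by (intro INF_greatest) auto
    then have "emeasure \<mu> E / \<theta> \<le> emeasure \<mu> E"
      by (simp only: outer[symmetric] \<nu>E)
    then have "e / t \<le> e"
      using e t by (simp add: divide_ennreal)
    then have "e \<le> t * e" using t by (simp add: field_simps)
    then show False using e t by auto
  qed
qed

subsection \<open>Doubling measures\<close>

lemma mem_cell_iff:
  assumes l: "0 < l"
  shows "y \<in> cell a l n x \<longleftrightarrow>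
    (\<forall>i. - (l / 2 ^ n / 2) \<le> y $ i - cell_center a l n x $ i \<and>
         y $ i - cell_center a l n x $ i < l / 2 ^ n / 2)"
proof -
  have "\<lfloor>2 ^ n * (y $ i - a $ i) / l\<rfloor> = k \<longleftrightarrow>
      - (l / 2 ^ n / 2) \<le> y $ i - (a $ i + (of_int k + 1 / 2) * (l / 2 ^ n)) \<and>
      y $ i - (a $ i + (of_int k + 1 / 2) * (l / 2 ^ n)) < l / 2 ^ n / 2" for i k
  proof -
    define w where "w = 2 ^ n * (y $ i - a $ i) / l"
    define d where "d = l / 2 ^ n"
    have d: "0 < d" using l by (simp add: d_def)
    have "y $ i - (a $ i + (of_int k + 1 / 2) * d) = (w - of_int k) * d - d / 2"
      using l by (simp add: w_def d_def field_simps)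
    moreover have "\<lfloor>w\<rfloor> = k \<longleftrightarrow> 0 \<le> w - of_int k \<and> w - of_int k < 1"
      unfolding floor_eq_iff by linarith
    moreover have "0 \<le> w - of_int k \<longleftrightarrow> 0 \<le> (w - of_int k) * d"
      using d by (simp add: zero_le_mult_iff)
    moreover have "w - of_int k < 1 \<longleftrightarrow> (w - of_int k) * d < d"
      using d mult_less_cancel_right_pos[of d "w - of_int k" 1] by simp
    ultimately show ?thesis unfolding w_def[symmetric] d_def[symmetric] by linarith
  qed
  then show ?thesis by (simp add: cell_def cell_center_def)
qed

lemma cube_subset_cell: "0 < l \<Longrightarrow> cube (cell_center a l n x) (l / 2 ^ n) \<subseteq> cell a l n x"
proof
  fix y assume l: "0 < l" and "y \<in> cube (cell_center a l n x) (l / 2 ^ n)"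
  then have "\<bar>y $ i - cell_center a l n x $ i\<bar> < l / 2 ^ n / 2" for i by (simp add: mem_cube)
  then show "y \<in> cell a l n x"
    unfolding mem_cell_iff[OF l] abs_less_iff by (smt (verit))
qed

lemma cube_mono_center:
  assumes "\<And>i. \<bar>q $ i - p $ i\<bar> \<le> (l' - l) / 2"
  shows "cube q l \<subseteq> cube p l'"
proof
  fix y assume "y \<in> cube q l"
  then have y: "\<bar>y $ i - q $ i\<bar> < l / 2" for i by (simp add: mem_cube)
  have "\<bar>y $ i - p $ i\<bar> < l' / 2" for i
    using assms[of i] y[of i] unfolding diff_divide_distrib by linarith
  then show "y \<in> cube p l'" by (simp add: mem_cube)
qed

locale doubling_space =
  fixes \<mu> :: "(real ^ 'n) measure" and C :: real
  assumes sets_eq: "sets \<mu> = sets borel"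
    and finite_compact: "compact K \<Longrightarrow> emeasure \<mu> K < \<infinity>"
    and C_ge_1: "1 \<le> C"
    and doubling: "0 < l \<Longrightarrow> emeasure \<mu> (cube c (2 * l)) \<le> ennreal C * emeasure \<mu> (cube c l)"
begin

abbreviation M :: "(real ^ 'n) measure" where "M \<equiv> completion \<mu>"

lemma in_sets [simp]: "A \<in> sets borel \<Longrightarrow> A \<in> sets \<mu>"
  by (simp add: sets_eq)

lemma in_sets_M [simp, intro]: "A \<in> sets borel \<Longrightarrow> A \<in> sets M"
  by (simp add: sets_eq)

lemma space_eq [simp]: "space \<mu> = UNIV"
  using sets_eq_imp_space_eq[OF sets_eq] by simp

lemma emeasure_M: "A \<in> sets borel \<Longrightarrow> emeasure M A = emeasure \<mu> A"
  by (simp add: sets_eq)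

lemma emeasure_cube_finite: "emeasure \<mu> (cube c l) < \<infinity>"
proof -
  have "emeasure \<mu> (cube c l) \<le> emeasure \<mu> (cbox (c - vec (l / 2)) (c + vec (l / 2)))"
    unfolding cube_def by (intro emeasure_mono box_subset_cbox) auto
  also have "\<dots> < \<infinity>" by (intro finite_compact) simp
  finally show ?thesis .
qed

lemma cube_fmeasurable [simp, intro]: "cube c l \<in> fmeasurable M"
  using emeasure_cube_finite[of c l] by (intro fmeasurableI) (auto simp: emeasure_M)

lemma emeasure_cube_eq: "emeasure M (cube c l) = ennreal (measure M (cube c l))"
  using fmeasurableD2[OF cube_fmeasurable] by (intro emeasure_eq_ennreal_measure) auto

lemma measure_doubling:
  assumes "0 < l"
  shows "measure M (cube c (2 * l)) \<le> C * measure M (cube c l)"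
  using doubling[OF assms, of c] C_ge_1 emeasure_cube_eq[of c l] emeasure_cube_eq[of c "2 * l"]
  by (simp add: emeasure_M ennreal_mult[symmetric] sets_eq)

lemma measure_doubling2:
  assumes "0 < l"
  shows "measure M (cube c (4 * l)) \<le> C\<^sup>2 * measure M (cube c l)"
proof -
  have "measure M (cube c (4 * l)) \<le> C * measure M (cube c (2 * l))"
    using measure_doubling[of "2 * l" c] assms by simp
  also have "\<dots> \<le> C * (C * measure M (cube c l))"
    using measure_doubling[OF assms, of c] C_ge_1 by (intro mult_left_mono) auto
  finally show ?thesis by (simp add: power2_eq_square mult.assoc)
qed

text \<open>
  A hyperplane misses a subcube of half the side length of every cell, hence takes at most a fixed
  fraction, less than 1, of the measure of that cell.
\<close>

lemma hyperplane_null: "{x. x $ i = b} \<in> null_sets \<mu>"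
proof -
  define H where "H = {x :: real ^ 'n. x $ i = b}"
  have H: "H \<in> sets borel"
  proof -
    have "closed H" unfolding H_def by (intro closed_Collect_eq continuous_intros)
    then show ?thesis by simp
  qed
  have "emeasure \<mu> (H \<inter> cube 0 (real R)) = 0" for R
  proof (rule null_if_uniformly_sparse[where W = "cube 0 (real R)" and a = 0 and l = 1
        and \<theta> = "ennreal (1 - 1 / C\<^sup>2)"])
    show "emeasure \<mu> (cube 0 (real R)) < \<infinity>" by (rule emeasure_cube_finite)
    show "ennreal (1 - 1 / C\<^sup>2) < 1" using C_ge_1 by (simp add: ennreal_less_one_iff)
    fix n :: nat and x :: "real ^ 'n"
    define Q where "Q = cell 0 1 n x"
    define \<delta> :: real where "\<delta> = 1 / 2 ^ n"
    define c where "c = cell_center 0 1 n x"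
    \<comment> \<open>The sign points from the centre of the cell away from the hyperplane. The
      subcube \<open>Q'\<close> of half the side, shifted diagonally by a quarter of the side in
      that direction, stays in the cell and misses \<open>H\<close>.\<close>
    define \<sigma> :: real where "\<sigma> = (if c $ i \<le> b then - 1 else 1)"
    define z where "z = c + vec (\<sigma> * \<delta> / 4)"
    define Q' where "Q' = cube z (\<delta> / 2)"
    have \<delta>: "0 < \<delta>" by (simp add: \<delta>_def)
    have z: "z $ j = c $ j + \<sigma> * \<delta> / 4" for j by (simp add: z_def vec_def)
    have \<sigma>: "\<sigma> = 1 \<or> \<sigma> = - 1" by (simp add: \<sigma>_def)
    have Q: "y \<in> Q \<longleftrightarrow> (\<forall>i. - (\<delta> / 2) \<le> y $ i - c $ i \<and> y $ i - c $ i < \<delta> / 2)" for y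
      unfolding Q_def c_def \<delta>_def using mem_cell_iff[of 1 y 0 n x] by simp
    have Q'Q: "Q' \<subseteq> Q - H"
    proof
      fix y assume "y \<in> Q'"
      then have y: "\<bar>y $ j - (c $ j + \<sigma> * \<delta> / 4)\<bar> < \<delta> / 4" for j
        unfolding Q'_def mem_cube z by (simp add: algebra_simps)
      have "- (\<delta> / 2) \<le> y $ j - c $ j \<and> y $ j - c $ j < \<delta> / 2" for j
        using y[of j] \<sigma> \<delta> by (elim disjE) (simp_all only: abs_less_iff, linarith+)
      moreover have "y $ i \<noteq> b"
        using y[of i] \<delta> by (auto simp: \<sigma>_def split: if_splits)
      ultimately show "y \<in> Q - H" by (auto simp: Q H_def)
    qed
    \<comment> \<open>Four times the side of \<open>Q'\<close> suffices to cover \<open>Q\<close>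
      from the centre of \<open>Q'\<close>; these are two doublings, whence \<open>C\<^sup>2\<close>
      in the fraction 1 - 1/\<open>C\<^sup>2\<close>.\<close>
    have QQ': "Q \<subseteq> cube z (4 * (\<delta> / 2))"
    proof
      fix y assume "y \<in> Q"
      then have "- (\<delta> / 2) \<le> y $ j - c $ j \<and> y $ j - c $ j < \<delta> / 2" for j by (simp add: Q)
      note y = this
      have "\<bar>y $ j - z $ j\<bar> < \<delta>" for j
        using y[of j] \<sigma> \<delta> unfolding z
        by (elim disjE) (simp_all only: abs_less_iff, linarith+)
      then show "y \<in> cube z (4 * (\<delta> / 2))" by (simp add: mem_cube)
    qed
    have Qb: "Q \<in> sets borel" by (simp add: Q_def)
    have Qf: "Q \<in> fmeasurable M"
      using QQ' Qb by (intro fmeasurableI2[OF cube_fmeasurable]) auto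
    have HQ: "H \<inter> Q \<in> fmeasurable M"
      using H Qf by (intro fmeasurableI2[OF Qf]) (auto simp: Qb)
    have "measure M (H \<inter> Q) + measure M Q' = measure M ((H \<inter> Q) \<union> Q')"
      using Q'Q H Qf Qb HQ by (intro measure_Un_AE[symmetric]) (auto simp: Q'_def)
    also have "\<dots> \<le> measure M Q"
      using Q'Q H Qf Qb by (intro measure_mono_fmeasurable) (auto simp: Q'_def)
    finally have 1: "measure M (H \<inter> Q) + measure M Q' \<le> measure M Q" .
    have "measure M Q \<le> measure M (cube z (4 * (\<delta> / 2)))"
      using QQ' Qb by (intro measure_mono_fmeasurable) auto
    also have "\<dots> \<le> C\<^sup>2 * measure M Q'"
      unfolding Q'_def using \<delta> by (intro measure_doubling2) auto
    finally have "measure M Q / C\<^sup>2 \<le> measure M Q'"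
      using C_ge_1 by (simp add: field_simps)
    with 1 have 2: "measure M (H \<inter> Q) \<le> (1 - 1 / C\<^sup>2) * measure M Q"
      by (simp add: algebra_simps)
    have "emeasure M (H \<inter> Q) \<le> ennreal (1 - 1 / C\<^sup>2) * emeasure M Q"
      using 2 HQ Qf C_ge_1
      by (simp add: emeasure_eq_measure2 ennreal_mult[symmetric] ennreal_leI del: emeasure_completion)
    then have "emeasure \<mu> (H \<inter> Q) \<le> ennreal (1 - 1 / C\<^sup>2) * emeasure \<mu> Q"
      using H Qb by (simp add: emeasure_M)
    moreover assume "cell 0 1 n x \<subseteq> cube 0 (real R)"
    ultimately show "emeasure \<mu> (H \<inter> cube 0 (real R) \<inter> cell 0 1 n x)
        \<le> ennreal (1 - 1 / C\<^sup>2) * emeasure \<mu> (cell 0 1 n x)"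
      by (simp add: Q_def Int_assoc Int_absorb1)
  qed (use H sets_eq in auto)
  then have "(\<Union>R. H \<inter> cube 0 (real R)) \<in> null_sets \<mu>"
    using H by (intro null_sets_UN) auto
  moreover have "H \<subseteq> (\<Union>R. H \<inter> cube 0 (real R))"
  proof
    fix x assume x: "x \<in> H"
    obtain R :: nat where "2 * norm x < real R" using reals_Archimedean2 by blast
    then have "\<bar>x $ j\<bar> < real R / 2" for j using component_le_norm_cart[of x j] by auto
    then show "x \<in> (\<Union>R. H \<inter> cube 0 (real R))" using x by (auto simp: mem_cube)
  qed
  ultimately show ?thesis
    unfolding H_def[symmetric] using H null_sets_subset[of _ \<mu> H] by auto
qed

lemma hyperplane_null_M: "{x. x $ i = b} \<in> null_sets M"
  by (rule null_sets_completionI[OF hyperplane_null])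

text \<open>The half-open cell exceeds the open cube only by pieces of hyperplanes, which are null.
  This lets the combinatorics use cells and the oscillation hypotheses use cubes.\<close>

lemma emeasure_cell_Int:
  assumes l: "0 < l" and A: "A \<in> sets M"
  shows "emeasure M (A \<inter> cell a l n x) = emeasure M (A \<inter> cube (cell_center a l n x) (l / 2 ^ n))"
proof -
  define c where "c = cell_center a l n x"
  define N where "N = (\<Union>i. {y :: real ^ 'n. y $ i = c $ i - l / 2 ^ n / 2})"
  have N: "N \<in> null_sets M"
    unfolding N_def by (intro null_sets_UN' hyperplane_null_M) auto
  have sub: "cell a l n x - cube c (l / 2 ^ n) \<subseteq> N"
  proof
    fix y assume y: "y \<in> cell a l n x - cube c (l / 2 ^ n)"
    then have c: "- (l / 2 ^ n / 2) \<le> y $ i - c $ i \<and> y $ i - c $ i < l / 2 ^ n / 2" for i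
      using mem_cell_iff[OF l] unfolding c_def by blast
    from y obtain i where "\<not> \<bar>y $ i - c $ i\<bar> < l / 2 ^ n / 2" by (auto simp: mem_cube)
    with c[of i] have "y $ i = c $ i - l / 2 ^ n / 2" by (auto simp: abs_less_iff)
    then show "y \<in> N" by (auto simp: N_def)
  qed
  have cub: "cube c (l / 2 ^ n) \<subseteq> cell a l n x"
    unfolding c_def using cube_subset_cell[OF l] .
  have "emeasure M (A \<inter> cell a l n x) \<le> emeasure M (A \<inter> cube c (l / 2 ^ n) \<union> N)"
    using A N sub by (intro emeasure_mono) auto
  also have "\<dots> = emeasure M (A \<inter> cube c (l / 2 ^ n))"
    using A N by (intro emeasure_Un_null_set) auto
  finally have "emeasure M (A \<inter> cell a l n x) \<le> emeasure M (A \<inter> cube c (l / 2 ^ n))" .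
  moreover have "emeasure M (A \<inter> cube c (l / 2 ^ n)) \<le> emeasure M (A \<inter> cell a l n x)"
    using A cub by (intro emeasure_mono) auto
  ultimately show ?thesis unfolding c_def by (rule antisym)
qed

text \<open>Regularity concerns Borel sets; a set measurable for the completion differs from its
  main part by a null set, and the main part inherits the sparsity bound.\<close>

lemma null_if_uniformly_sparse_M:
  assumes W: "open W" "emeasure M W < \<infinity>"
    and E: "E \<in> sets M" "E \<subseteq> W" and l: "0 < l" and \<theta>: "\<theta> < 1"
    and le: "\<And>n x. cell a l n x \<subseteq> W \<Longrightarrow>
               emeasure M (E \<inter> cell a l n x) \<le> \<theta> * emeasure M (cell a l n x)"
  shows "emeasure M E = 0"
proof -
  have E': "main_part \<mu> E \<in> sets \<mu>" "main_part \<mu> E \<subseteq> E"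
    using E(1) main_part_null_part_Un[OF E(1)] by blast+
  have "emeasure \<mu> (main_part \<mu> E) = 0"
  proof (rule null_if_uniformly_sparse[OF sets_eq W(1) _ _ _ l \<theta>])
    show "emeasure \<mu> W < \<infinity>" using W by (simp add: emeasure_M)
    show "main_part \<mu> E \<in> sets borel" using E' sets_eq by auto
    show "main_part \<mu> E \<subseteq> W" using E E' by auto
    fix n x assume cW: "cell a l n x \<subseteq> W"
    have "emeasure \<mu> (main_part \<mu> E \<inter> cell a l n x) = emeasure M (main_part \<mu> E \<inter> cell a l n x)"
      using E' by (subst emeasure_M) (auto simp: sets_eq)
    also have "\<dots> \<le> emeasure M (E \<inter> cell a l n x)"
      using E E' by (intro emeasure_mono) auto
    also have "\<dots> \<le> \<theta> * emeasure M (cell a l n x)" using le[OF cW] .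
    finally show "emeasure \<mu> (main_part \<mu> E \<inter> cell a l n x) \<le> \<theta> * emeasure \<mu> (cell a l n x)"
      by (simp add: emeasure_M)
  qed
  then show ?thesis using E by simp
qed

section \<open>Continuous paths of cubes between two nested cubes\<close>

definition interpol :: "real ^ 'n \<Rightarrow> real \<Rightarrow> real ^ 'n \<Rightarrow> real \<Rightarrow> real \<Rightarrow> (real ^ 'n) set" where
  "interpol q l p l' \<tau> = cube (q + \<tau> *\<^sub>R (p - q)) (l + \<tau> * (l' - l))"

text \<open>By \<open>cube_mono_center\<close> the hypothesis puts the initial cube inside the final
  one. Along the linear path the centre then moves no faster than the half side grows, so the stages
  increase. Each stage of positive side is itself a cube, which is why oscillation bounds on cubes
  apply along the path.\<close>

lemma interpol_mono:
  assumes "\<And>i. \<bar>q $ i - p $ i\<bar> \<le> (l' - l) / 2" and "\<sigma> \<le> \<tau>"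
  shows "interpol q l p l' \<sigma> \<subseteq> interpol q l p l' \<tau>"
  unfolding interpol_def
proof (rule cube_mono_center)
  fix i
  have "(q + \<sigma> *\<^sub>R (p - q)) $ i - (q + \<tau> *\<^sub>R (p - q)) $ i = (\<tau> - \<sigma>) * (q $ i - p $ i)"
    by (simp add: algebra_simps)
  then have "\<bar>(q + \<sigma> *\<^sub>R (p - q)) $ i - (q + \<tau> *\<^sub>R (p - q)) $ i\<bar> = (\<tau> - \<sigma>) * \<bar>q $ i - p $ i\<bar>"
    using assms(2) by (simp add: abs_mult)
  also have "\<dots> \<le> (\<tau> - \<sigma>) * ((l' - l) / 2)"
    using assms by (intro mult_left_mono) auto
  also have "\<dots> = (l + \<tau> * (l' - l) - (l + \<sigma> * (l' - l))) / 2" by (simp add: field_simps)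
  finally show "\<bar>(q + \<sigma> *\<^sub>R (p - q)) $ i - (q + \<tau> *\<^sub>R (p - q)) $ i\<bar>
    \<le> (l + \<tau> * (l' - l) - (l + \<sigma> * (l' - l))) / 2" .
qed

text \<open>Off the faces of the limiting cube membership is decided by strict inequalities, so
  indicators converge there; the faces are null by \<open>hyperplane_null_M\<close>. The largest
  cube of the family dominates.\<close>

lemma interpol_measure_continuous:
  assumes "\<And>i. \<bar>q $ i - p $ i\<bar> \<le> (l' - l) / 2"
  shows "continuous_on {0..1} (\<lambda>\<tau>. measure M (interpol q l p l' \<tau>))"
  unfolding continuous_on_sequentially
proof (intro allI ballI impI, unfold comp_def)
  fix x and \<tau> :: real
  assume \<tau>: "\<tau> \<in> {0..1}" and "(\<forall>n. x n \<in> {0..1}) \<and> x \<longlonglongrightarrow> \<tau>"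
  then have x: "\<And>n. x n \<in> {0..1}" and lim: "x \<longlonglongrightarrow> \<tau>" by auto
  define c where "c = (\<lambda>\<tau>. q + \<tau> *\<^sub>R (p - q))"
  define r where "r = (\<lambda>\<tau>. (l + \<tau> * (l' - l)) / 2)"
  have mem: "y \<in> interpol q l p l' t \<longleftrightarrow> (\<forall>i. \<bar>y $ i - c t $ i\<bar> < r t)" for y t
    by (simp add: interpol_def mem_cube c_def r_def)
  define N where "N = (\<Union>i. {y. y $ i = c \<tau> $ i - r \<tau>} \<union> {y. y $ i = c \<tau> $ i + r \<tau>})"
  have N: "N \<in> null_sets M"
    unfolding N_def by (intro null_sets_UN' null_sets.Un hyperplane_null_M) auto
  have conv: "(\<lambda>n. r (x n) - \<bar>y $ i - c (x n) $ i\<bar>) \<longlonglongrightarrow> r \<tau> - \<bar>y $ i - c \<tau> $ i\<bar>" for y i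
    unfolding r_def c_def by (intro tendsto_intros lim) auto
  have "(\<lambda>n. integral\<^sup>L M (indicator (interpol q l p l' (x n)) :: _ \<Rightarrow> real))
      \<longlonglongrightarrow> integral\<^sup>L M (indicator (interpol q l p l' \<tau>))"
  proof (rule integral_dominated_convergence[where w = "indicator (interpol q l p l' 1)"])
    show "integrable M (indicator (interpol q l p l' 1) :: _ \<Rightarrow> real)"
      using cube_fmeasurable[of "q + 1 *\<^sub>R (p - q)" "l + 1 * (l' - l)"] unfolding interpol_def
      by (intro integrable_real_indicator) (auto simp: fmeasurable_def)
    show "AE y in M. norm (indicator (interpol q l p l' (x n)) y :: real)
        \<le> indicator (interpol q l p l' 1) y" for n
      using interpol_mono[OF assms, where \<sigma> = "x n" and \<tau> = 1] x[of n] by (auto simp: indicator_def)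
    show "AE y in M. (\<lambda>n. indicator (interpol q l p l' (x n)) y :: real)
        \<longlonglongrightarrow> indicator (interpol q l p l' \<tau>) y"
    proof (rule AE_I'[OF N], rule subsetI, rule ccontr)
      fix y assume y: "y \<in> {y \<in> space M. \<not> (\<lambda>n. indicator (interpol q l p l' (x n)) y :: real)
          \<longlonglongrightarrow> indicator (interpol q l p l' \<tau>) y}" and nN: "y \<notin> N"
      have "\<forall>\<^sub>F n in sequentially. (y \<in> interpol q l p l' (x n)) = (y \<in> interpol q l p l' \<tau>)"
      proof (cases "y \<in> interpol q l p l' \<tau>")
        case True
        then have "\<forall>\<^sub>F n in sequentially. \<forall>i. 0 < r (x n) - \<bar>y $ i - c (x n) $ i\<bar>"
          by (intro eventually_all_finite order_tendstoD(1)[OF conv]) (auto simp: mem)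
        then show ?thesis
          by eventually_elim (use True in \<open>auto simp: mem\<close>)
      next
        case False
        then obtain i where i: "\<not> \<bar>y $ i - c \<tau> $ i\<bar> < r \<tau>" by (auto simp: mem)
        have "y $ i \<noteq> c \<tau> $ i - r \<tau>" "y $ i \<noteq> c \<tau> $ i + r \<tau>" using nN by (auto simp: N_def)
        with i have "r \<tau> - \<bar>y $ i - c \<tau> $ i\<bar> < 0" by (auto simp: abs_if split: if_splits)
        then have "\<forall>\<^sub>F n in sequentially. r (x n) - \<bar>y $ i - c (x n) $ i\<bar> < 0"
          by (rule order_tendstoD(2)[OF conv])
        then show ?thesis
        proof eventually_elim
          case (elim n)
          then have "\<not> \<bar>y $ i - c (x n) $ i\<bar> < r (x n)" by simp
          then show ?case using False unfolding mem by blast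
        qed
      qed
      then have "(\<lambda>n. indicator (interpol q l p l' (x n)) y :: real)
          \<longlonglongrightarrow> indicator (interpol q l p l' \<tau>) y"
        by (intro tendsto_eventually) (auto elim!: eventually_mono simp: indicator_def)
      with y show False by auto
    qed
  qed (auto simp: interpol_def intro!: borel_measurable_indicator)
  then show "(\<lambda>n. measure M (interpol q l p l' (x n))) \<longlonglongrightarrow> measure M (interpol q l p l' \<tau>)"
    by simp
qed

end

text \<open>Doubling a number sends its floor k to 2k or 2k + 1. In either case the centre moves by
  a quarter of the parent's side in each coordinate, which is half the difference of the sides, as
  \<open>cube_mono_center\<close> asks.\<close>

lemma cell_center_Suc:
  assumes l: "0 < l"
  shows "\<bar>cell_center a l (Suc n) x $ i - cell_center a l n x $ i\<bar> = l / 2 ^ n / 4"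
proof -
  define w where "w = 2 ^ n * (x $ i - a $ i) / l"
  define d where "d = l / 2 ^ n"
  have d: "0 < d" using l by (simp add: d_def)
  have "\<lfloor>2 * w\<rfloor> = 2 * \<lfloor>w\<rfloor> \<or> \<lfloor>2 * w\<rfloor> = 2 * \<lfloor>w\<rfloor> + 1" by linarith
  then have "real_of_int \<lfloor>2 * w\<rfloor> = 2 * of_int \<lfloor>w\<rfloor> \<or> real_of_int \<lfloor>2 * w\<rfloor> = 2 * of_int \<lfloor>w\<rfloor> + 1"
    by auto
  moreover have "cell_center a l (Suc n) x $ i - cell_center a l n x $ i
      = (of_int \<lfloor>2 * w\<rfloor> + 1 / 2) * (d / 2) - (of_int \<lfloor>w\<rfloor> + 1 / 2) * d"
    by (simp add: cell_center_def w_def d_def mult.assoc)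
  ultimately have "cell_center a l (Suc n) x $ i - cell_center a l n x $ i = d / 4 \<or>
      cell_center a l (Suc n) x $ i - cell_center a l n x $ i = - (d / 4)"
    by (auto simp: algebra_simps)
  then show ?thesis unfolding d_def[symmetric] using d by auto
qed

lemma cell_center_0:
  assumes "x \<in> cube c l"
  shows "cell_center (c - vec (l / 2)) l 0 x = c"
proof -
  have x: "\<bar>x $ i - c $ i\<bar> < l / 2" for i using assms by (simp add: mem_cube)
  have l: "0 < l" using x[of undefined] by linarith
  have "\<lfloor>(x $ i - (c $ i - l / 2)) / l\<rfloor> = 0" for i
  proof -
    have "0 \<le> x $ i - (c $ i - l / 2)" "x $ i - (c $ i - l / 2) < l"
      using x[of i] unfolding abs_less_iff by linarith+
    then show ?thesis using l unfolding floor_eq_iff by (auto simp: field_simps)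
  qed
  then show ?thesis
    by (auto simp: cell_center_def vec_eq_iff vec_def)
qed

lemma cell_cube_nested:
  assumes l: "0 < l"
  shows "cube (cell_center a l (Suc n) x) (l / 2 ^ Suc n) \<subseteq> cube (cell_center a l n x) (l / 2 ^ n)"
proof (rule cube_mono_center)
  fix i
  have "l / 2 ^ n / 4 = (l / 2 ^ n - l / 2 ^ Suc n) / 2" by (simp add: field_simps)
  then show "\<bar>cell_center a l (Suc n) x $ i - cell_center a l n x $ i\<bar> \<le> (l / 2 ^ n - l / 2 ^ Suc n) / 2"
    using cell_center_Suc[OF l, of a n x i] by simp
qed

lemma cell_cube_subset:
  assumes x: "x \<in> cube c l" and l: "0 < l"
  shows "cube (cell_center (c - vec (l / 2)) l n x) (l / 2 ^ n) \<subseteq> cube c l"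
proof (induction n)
  case 0
  then show ?case using cell_center_0[OF x] by simp
next
  case (Suc n)
  then show ?case using cell_cube_nested[OF l] by blast
qed

section \<open>Approximate medians on cubes and the good-lambda inequality\<close>

context doubling_space
begin

declare emeasure_completion [simp del] measure_completion [simp del]

lemma level_set:
  fixes f :: "real ^ 'n \<Rightarrow> real"
  assumes f: "f \<in> borel_measurable (restrict_space M Q0)"
    and "Q0 \<in> sets borel" "R \<in> sets borel" "R \<subseteq> Q0"
  shows "{y \<in> R. \<bar>f y - c\<bar> > \<alpha>} \<in> sets M"
proof -
  have "(\<lambda>y. \<bar>f y - c\<bar>) \<in> borel_measurable (restrict_space M Q0)"
    using borel_measurable_diff[OF f, of "\<lambda>_. c"] by (intro borel_measurable_abs) simp
  then have "{y \<in> space (restrict_space M Q0). \<bar>f y - c\<bar> > \<alpha>} \<in> sets (restrict_space M Q0)"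
    unfolding borel_measurable_iff_greater by blast
  then have "{y \<in> Q0. \<bar>f y - c\<bar> > \<alpha>} \<in> sets M"
    using assms by (auto simp: space_restrict_space sets_restrict_space_iff)
  then have "{y \<in> Q0. \<bar>f y - c\<bar> > \<alpha>} \<inter> R \<in> sets M"
    using assms by auto
  also have "{y \<in> Q0. \<bar>f y - c\<bar> > \<alpha>} \<inter> R = {y \<in> R. \<bar>f y - c\<bar> > \<alpha>}"
    using assms by auto
  finally show ?thesis .
qed

text \<open>The real-valued content of \<open>local_osc (1 / 8) M R f < \<alpha>\<close>, with
  \<open>c\<close> as a witness; strictness forces \<open>R\<close> to have positive measure. The
  value 1/8 meets several demands at once: 1/8 + 2/8 < 1 for comparing cubes of measure ratio 2, 1/8
  + 1/2 < 1 for finding a point outside \<open>G\<close>, twice 1/8 is at most 1/4 for the good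
  cells, and 7/8 > 1/2 for the median.\<close>

definition near :: "(real ^ 'n \<Rightarrow> real) \<Rightarrow> (real ^ 'n) set \<Rightarrow> real \<Rightarrow> real \<Rightarrow> bool" where
  "near f R \<alpha> c \<longleftrightarrow> measure M {y \<in> R. \<bar>f y - c\<bar> > \<alpha>} < measure M R / 8"

lemma near_measure_pos: "near f R \<alpha> c \<Longrightarrow> 0 < measure M R"
  unfolding near_def using measure_nonneg[of M "{y \<in> R. \<bar>f y - c\<bar> > \<alpha>}"] by linarith

lemma near_if_local_osc:
  assumes f: "f \<in> borel_measurable (restrict_space M Q0)" and Q0: "Q0 \<in> sets borel"
    and R: "is_cube R" "R \<subseteq> Q0"
    and osc: "local_osc (1 / 8) M R f < ennreal \<alpha>"
  shows "\<exists>c. near f R \<alpha> c"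
proof -
  obtain q l where Rq: "R = cube q l" using R by (auto simp: is_cube_def)
  have Rf: "R \<in> fmeasurable M" by (simp add: Rq)
  from osc obtain c where "Inf {ennreal \<beta> |\<beta>. 0 \<le> \<beta> \<and>
        emeasure M {y \<in> R. \<bar>f y - c\<bar> > \<beta>} < ennreal (1 / 8) * emeasure M R} < ennreal \<alpha>"
    unfolding local_osc_def INF_less_iff by blast
  then obtain \<beta> where \<beta>: "ennreal \<beta> < ennreal \<alpha>" "0 \<le> \<beta>"
      "emeasure M {y \<in> R. \<bar>f y - c\<bar> > \<beta>} < ennreal (1 / 8) * emeasure M R"
    unfolding Inf_less_iff by blast
  have "\<beta> < \<alpha>" using \<beta> by (simp add: ennreal_less_iff)
  have lev: "{y \<in> R. \<bar>f y - c\<bar> > \<gamma>} \<in> fmeasurable M" for \<gamma>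
    using level_set[OF f Q0 _ R(2)] by (intro fmeasurableI2[OF Rf]) (auto simp: Rq)
  have "ennreal (measure M {y \<in> R. \<bar>f y - c\<bar> > \<beta>}) < ennreal (1 / 8) * ennreal (measure M R)"
    using \<beta>(3) emeasure_eq_measure2[OF lev[of \<beta>]] emeasure_eq_measure2[OF Rf] by argo
  then have "measure M {y \<in> R. \<bar>f y - c\<bar> > \<beta>} < measure M R / 8"
    by (simp add: ennreal_mult[symmetric] ennreal_less_iff)
  moreover have "measure M {y \<in> R. \<bar>f y - c\<bar> > \<alpha>} \<le> measure M {y \<in> R. \<bar>f y - c\<bar> > \<beta>}"
    using lev \<open>\<beta> < \<alpha>\<close> by (intro measure_mono_fmeasurable) auto
  ultimately show ?thesis unfolding near_def by (intro exI[of _ c]) linarith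
qed

text \<open>The two exceptional sets together have less than 3/8 of the measure of \<open>R\<close>,
  so some point of \<open>R\<close> avoids both, and its value of \<open>f\<close> is close to
  \<open>c\<close> and to \<open>c'\<close>.\<close>

lemma near_dist:
  assumes f: "f \<in> borel_measurable (restrict_space M Q0)" and Q0: "Q0 \<in> sets borel"
    and R: "R \<in> fmeasurable M" "R \<in> sets borel" "R' \<in> fmeasurable M" "R' \<in> sets borel"
      "R \<subseteq> R'" "R' \<subseteq> Q0"
    and n: "near f R \<alpha> c" "near f R' \<alpha>' c'" and le: "measure M R' \<le> 2 * measure M R"
  shows "\<bar>c - c'\<bar> \<le> \<alpha> + \<alpha>'"
proof (rule ccontr)
  assume neg: "\<not> \<bar>c - c'\<bar> \<le> \<alpha> + \<alpha>'"
  define A where "A = {y \<in> R. \<bar>f y - c\<bar> > \<alpha>}"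
  define A' where "A' = {y \<in> R'. \<bar>f y - c'\<bar> > \<alpha>'}"
  have A: "A \<in> fmeasurable M"
    unfolding A_def using R by (intro fmeasurableI2[OF R(1)] level_set[OF f Q0]) auto
  have A': "A' \<in> fmeasurable M"
    unfolding A'_def using R by (intro fmeasurableI2[OF R(3)] level_set[OF f Q0]) auto
  have "R \<subseteq> A \<union> A'"
  proof
    fix y assume y: "y \<in> R"
    have "\<bar>f y - c\<bar> > \<alpha> \<or> \<bar>f y - c'\<bar> > \<alpha>'" using neg by linarith
    then show "y \<in> A \<union> A'" using y R by (auto simp: A_def A'_def)
  qed
  then have "measure M R \<le> measure M (A \<union> A')"
    using R A A' by (intro measure_mono_fmeasurable) auto
  also have "\<dots> \<le> measure M A + measure M A'"
    using A A' by (intro measure_Un_le) auto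
  also have "\<dots> < measure M R / 8 + measure M R' / 8"
    using n unfolding near_def A_def A'_def by (intro add_strict_mono)
  finally show False using le near_measure_pos[OF n(1)] by linarith
qed

text \<open>
  A monotone family of cubes between two nested ones grows continuously in measure, so it can be
  traversed in steps that at most double the measure; this is why the threshold \<open>1/8\<close> need not
  depend on the doubling constant.
\<close>

lemma near_chain:
  assumes f: "f \<in> borel_measurable (restrict_space M Q0)" and Q0: "Q0 \<in> sets borel"
    and qp: "\<And>i. \<bar>q $ i - p $ i\<bar> \<le> (l' - l) / 2" and l: "0 < l" and P: "cube p l' \<subseteq> Q0"
    and all: "\<And>R. is_cube R \<Longrightarrow> cube q l \<subseteq> R \<Longrightarrow> R \<subseteq> cube p l' \<Longrightarrow> \<exists>c. near f R \<alpha> c"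
    and le: "measure M (cube p l') \<le> 2 ^ N * measure M (cube q l)"
    and n: "near f (cube q l) \<alpha> c" "near f (cube p l') \<alpha> c'"
  shows "\<bar>c - c'\<bar> \<le> 2 * (real N + 1) * \<alpha>"
proof -
  define R where "R = interpol q l p l'"
  have R0: "R 0 = cube q l" and R1: "R 1 = cube p l'" by (auto simp: R_def interpol_def)
  have mono: "R \<sigma> \<subseteq> R \<tau>" if "\<sigma> \<le> \<tau>" for \<sigma> \<tau>
    unfolding R_def using qp that by (rule interpol_mono)
  have ll': "l \<le> l'" using qp[of undefined] abs_ge_zero[of "q $ undefined - p $ undefined"]
    by argo
  have Rm: "R \<tau> \<in> fmeasurable M" "R \<tau> \<in> sets borel" for \<tau>
    by (auto simp: R_def interpol_def)
  have RQ: "R \<tau> \<subseteq> Q0" if "\<tau> \<le> 1" for \<tau> using mono[OF that] R1 P by auto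
  have near_R: "\<exists>c. near f (R \<tau>) \<alpha> c" if "\<tau> \<in> {0..1}" for \<tau>
  proof (rule all)
    have "0 \<le> \<tau> * (l' - l)" using that ll' by auto
    then have "0 < l + \<tau> * (l' - l)" using l by linarith
    then show "is_cube (R \<tau>)" unfolding is_cube_def R_def interpol_def by blast
    show "cube q l \<subseteq> R \<tau>" "R \<tau> \<subseteq> cube p l'" using mono[of 0 \<tau>] mono[of \<tau> 1] that R0 R1 by auto
  qed
  have cont: "continuous_on {0..1} (\<lambda>\<tau>. measure M (R \<tau>))"
    unfolding R_def using qp by (rule interpol_measure_continuous)
  \<comment> \<open>The index counts halvings of the measure on the way back to \<open>R 0\<close>.
    Each costs one \<open>near_dist\<close>, that is \<open>2 * \<alpha>\<close>; the summand 1 is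
    the last comparison, between stages of measure ratio at most 2.\<close>
  have "\<forall>\<tau>\<in>{0..1}. \<forall>d. near f (R \<tau>) \<alpha> d \<longrightarrow> measure M (R \<tau>) \<le> 2 ^ k * measure M (R 0) \<longrightarrow>
      \<bar>c - d\<bar> \<le> 2 * (real k + 1) * \<alpha>" for k
  proof (induction k)
    case 0
    show ?case
    proof (intro ballI allI impI)
      fix \<tau> :: real and d assume \<tau>: "\<tau> \<in> {0..1}" "near f (R \<tau>) \<alpha> d" "measure M (R \<tau>) \<le> 2 ^ 0 * measure M (R 0)"
      have "measure M (R \<tau>) \<le> 2 * measure M (R 0)"
        using \<tau>(3) measure_nonneg[of M "R 0"] unfolding power_0 by linarith
      then have "\<bar>c - d\<bar> \<le> \<alpha> + \<alpha>"
        using \<tau> RQ[of \<tau>] mono[of 0 \<tau>] n(1) Rm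
        by (intro near_dist[OF f Q0, where R = "R 0" and R' = "R \<tau>"]) (auto simp: R0[symmetric])
      then show "\<bar>c - d\<bar> \<le> 2 * (real 0 + 1) * \<alpha>" by simp
    qed
  next
    case (Suc k)
    show ?case
    proof (intro ballI allI impI)
      fix \<tau> :: real and d assume \<tau>: "\<tau> \<in> {0..1}" "near f (R \<tau>) \<alpha> d"
        "measure M (R \<tau>) \<le> 2 ^ Suc k * measure M (R 0)"
      \<comment> \<open>Comparing a stage with itself yields the sign of \<alpha>.\<close>
      have a0: "0 \<le> \<alpha> + \<alpha>"
        using near_dist[OF f Q0 Rm Rm _ RQ \<tau>(2) \<tau>(2)] \<tau>(1) measure_nonneg[of M "R \<tau>"] by auto
      show "\<bar>c - d\<bar> \<le> 2 * (real (Suc k) + 1) * \<alpha>"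
      proof (cases "measure M (R \<tau>) \<le> 2 * measure M (R 0)")
        case True
        then have "\<bar>c - d\<bar> \<le> \<alpha> + \<alpha>"
          using \<tau> RQ[of \<tau>] mono[of 0 \<tau>] n(1) Rm
          by (intro near_dist[OF f Q0, where R = "R 0" and R' = "R \<tau>"]) (auto simp: R0[symmetric])
        also have "\<dots> \<le> 2 * (real (Suc k) + 1) * \<alpha>"
          using a0 mult_nonneg_nonneg[of "real k + 1" \<alpha>] by (simp add: algebra_simps)
        finally show ?thesis .
      next
        case False
        \<comment> \<open>By continuity some earlier stage has exactly half the measure: half is
          still above the measure of \<open>R 0\<close>, and it is the largest drop that
          \<open>near_dist\<close> allows.\<close>
        have "\<exists>\<sigma>. 0 \<le> \<sigma> \<and> \<sigma> \<le> \<tau> \<and> measure M (R \<sigma>) = measure M (R \<tau>) / 2"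
        proof (rule IVT')
          show "continuous_on {0..\<tau>} (\<lambda>\<tau>. measure M (R \<tau>))"
            using \<tau>(1) by (intro continuous_on_subset[OF cont]) auto
        qed (use False \<tau>(1) measure_nonneg[of M "R \<tau>"] in \<open>auto\<close>)
        then obtain \<sigma> where \<sigma>: "0 \<le> \<sigma>" "\<sigma> \<le> \<tau>" "measure M (R \<sigma>) = measure M (R \<tau>) / 2" by blast
        obtain e where e: "near f (R \<sigma>) \<alpha> e" using near_R[of \<sigma>] \<sigma> \<tau> by auto
        have "measure M (R \<sigma>) \<le> 2 ^ k * measure M (R 0)" using \<sigma>(3) \<tau>(3) by simp
        then have 1: "\<bar>c - e\<bar> \<le> 2 * (real k + 1) * \<alpha>" using Suc \<sigma>(1,2) \<tau>(1) e by (meson atLeastAtMost_iff order_trans)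
        have 2: "\<bar>e - d\<bar> \<le> \<alpha> + \<alpha>"
          using RQ[of \<tau>] mono[of \<sigma> \<tau>] Rm \<sigma> \<tau> e
          by (intro near_dist[OF f Q0, where R = "R \<sigma>" and R' = "R \<tau>"]) auto
        have "\<bar>c - d\<bar> \<le> 2 * (real k + 1) * \<alpha> + (\<alpha> + \<alpha>)" using 1 2 by linarith
        then show ?thesis by (simp add: algebra_simps)
      qed
    qed
  qed
  from this[of N, rule_format, of 1 c'] show ?thesis using n(2) le R0 R1 by simp
qed

text \<open>\<open>V\<close> stands for the set where the maximal function is large; outside it
  every cube has an approximate median. Good stopping cells keep at most 1/4 of their share of
  \<open>G\<close>, in total u/2, and bad ones at most their share of \<open>V\<close>, again u/2.
  The assumption on \<open>4 * u\<close> ensures that \<open>Q0\<close> itself is never a stopping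
  cell, so every good cell has a parent inside \<open>Q0\<close>.\<close>

lemma good_lambda:
  assumes l0: "0 < l0" and Q0: "Q0 = cube c0 l0"
    and f: "f \<in> borel_measurable (restrict_space M Q0)"
    and N: "C\<^sup>2 \<le> 2 ^ N"
    and G: "measure M {x \<in> Q0. \<bar>f x - c\<bar> > a} \<le> 2 * u" and u: "4 * u \<le> measure M Q0"
    and V: "V \<in> sets M" "V \<subseteq> Q0" "measure M V \<le> u / 2"
    and near: "\<And>x R. x \<in> Q0 - V \<Longrightarrow> is_cube R \<Longrightarrow> x \<in> R \<Longrightarrow> R \<subseteq> Q0 \<Longrightarrow> \<exists>c. near f R \<alpha> c"
    and \<alpha>: "0 \<le> \<alpha>"
  shows "measure M {x \<in> Q0. \<bar>f x - c\<bar> > a + (2 * real N + 4) * \<alpha>} \<le> u"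
proof -
  define G where "G = {x \<in> Q0. \<bar>f x - c\<bar> > a}"
  define X where "X = {x \<in> Q0. \<bar>f x - c\<bar> > a + (2 * real N + 4) * \<alpha>}"
  have Q0b: "Q0 \<in> sets borel" and Q0f: "Q0 \<in> fmeasurable M" by (auto simp: Q0)
  have u0: "0 \<le> u" using V(3) measure_nonneg[of M V] by linarith
  have "0 \<le> (2 * real N + 4) * \<alpha>" using \<alpha> by auto
  then have XG: "X \<subseteq> G" unfolding X_def G_def by auto
  have Gs: "G \<in> sets M" and Xs: "X \<in> sets M"
    unfolding G_def X_def by (rule level_set[OF f Q0b Q0b order_refl])+
  have Gf: "G \<in> fmeasurable M" and Xf: "X \<in> fmeasurable M" and Vf: "V \<in> fmeasurable M"
    by (rule fmeasurableI2[OF Q0f _ Gs] fmeasurableI2[OF Q0f _ Xs] fmeasurableI2[OF Q0f V(2,1)],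
        force simp: G_def X_def)+ (rule fmeasurableI2[OF Q0f V(2,1)])
  have GQ: "G \<subseteq> Q0" by (auto simp: G_def)
  define p where "p = (c0 - vec (l0 / 2))"
  define Q where "Q = (\<lambda>n x. cube (cell_center p l0 n x) (l0 / 2 ^ n))"
  have QQ0: "Q n x \<subseteq> Q0" if "x \<in> Q0" for n x
    using cell_cube_subset[of x c0 l0 n] that l0 unfolding Q_def Q0 p_def by blast
  have cellQ: "emeasure M (A \<inter> cell p l0 n x) = emeasure M (A \<inter> Q n x)" if "A \<in> sets M" for A n x
    unfolding Q_def using emeasure_cell_Int[OF l0 that] .
  have cellQ': "emeasure M (cell p l0 n x) = emeasure M (Q n x)" for n x
    using cellQ[of UNIV] by auto
  \<comment> \<open>Density of \<open>G\<close> above one half, written without a quotient; the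
    strict inequality excludes cells of measure zero and makes \<open>G \<inter> d\<close>
    nonempty.\<close>
  define P where "P = (\<lambda>d. emeasure M d < 2 * emeasure M (G \<inter> d))"
  define D where "D = maximal_cells p l0 P"
  have Ds: "D \<subseteq> sets M"
    unfolding D_def using maximal_cells_borel in_sets_M by blast
  have Dc: "countable D" "disjoint D"
    unfolding D_def by (rule countable_maximal_cells disjoint_maximal_cells)+
  have UDs: "\<Union>D \<in> sets M" using Ds Dc by auto
  \<comment> \<open>A cell containing a point of the remainder lies in no stopping cell and is none
    itself, so \<open>G\<close> fills at most half of it. Thus the remainder is uniformly
    sparse.\<close>
  have null: "emeasure M (G - \<Union>D) = 0"
  proof (rule null_if_uniformly_sparse_M[where W = Q0 and a = p and l = l0 and \<theta> = "ennreal (1 / 2)"])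
    show "ennreal (1 / 2) < 1" using ennreal_less_one_iff[of "1 / 2"] by linarith
    show "emeasure M Q0 < \<infinity>" using Q0f unfolding fmeasurable_def by simp
    fix n x
    show "emeasure M ((G - \<Union>D) \<inter> cell p l0 n x) \<le> ennreal (1 / 2) * emeasure M (cell p l0 n x)"
    proof (cases "(G - \<Union>D) \<inter> cell p l0 n x = {}")
      case False
      then obtain z where z: "z \<in> G - \<Union>D" "z \<in> cell p l0 n x" by auto
      then have "\<not> P (cell p l0 n x)"
        using cell_eq[OF z(2)] unfolding D_def Union_maximal_cells by (metis DiffD2 mem_Collect_eq)
      then have "2 * emeasure M (G \<inter> cell p l0 n x) \<le> emeasure M (cell p l0 n x)"
        by (simp add: P_def not_less)
      then have h1: "ennreal (1 / 2) * (2 * emeasure M (G \<inter> cell p l0 n x))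
          \<le> ennreal (1 / 2) * emeasure M (cell p l0 n x)" by (intro mult_left_mono) auto
      have h2: "ennreal (1 / 2) * (2 * e) = e" for e
      proof -
        have "ennreal (1 / 2) * 2 = ennreal (1 / 2) * ennreal 2" by simp
        also have "\<dots> = 1" by (subst ennreal_mult[symmetric]) auto
        finally show ?thesis by (simp add: mult.assoc[symmetric])
      qed
      have "emeasure M ((G - \<Union>D) \<inter> cell p l0 n x) \<le> emeasure M (G \<inter> cell p l0 n x)"
        using Gs by (intro emeasure_mono) auto
      then show ?thesis using h1 unfolding h2 by (rule order_trans)
    qed auto
  next
    show "G - \<Union>D \<in> sets M" "G - \<Union>D \<subseteq> Q0" using Gs UDs GQ by auto
    show "open Q0" "0 < l0" using l0 by (simp_all add: Q0)
  qed
  \<comment> \<open>Bad cells are those inside \<open>V\<close> up to a null set. With plain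
    inclusion a good cell could have its points outside \<open>V\<close> only on its boundary, where
    no open cube would reach them.\<close>
  define Db where "Db = {d \<in> D. emeasure M (d - V) = 0}"
  define Dg where "Dg = {d \<in> D. emeasure M (d - V) \<noteq> 0}"
  have Dbs: "countable Db" "disjoint Db" "Db \<subseteq> sets M" and Dgs: "countable Dg" "disjoint Dg" "Dg \<subseteq> sets M"
    using Dc Ds unfolding Db_def Dg_def by (auto simp: disjoint_def)
  have bad: "emeasure M (X \<inter> \<Union>Db) \<le> 1 * emeasure M (V \<inter> \<Union>Db)"
  proof (rule emeasure_Int_disjoint_Union_le[OF Dbs Xs V(1)])
    fix d assume d: "d \<in> Db"
    then have ds: "d \<in> sets M" using Ds by (auto simp: Db_def)
    have "emeasure M (X \<inter> d) \<le> emeasure M ((V \<inter> d) \<union> (d - V))"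
      using ds V Xs by (intro emeasure_mono) auto
    also have "\<dots> \<le> emeasure M (V \<inter> d) + emeasure M (d - V)"
      using ds V by (intro emeasure_subadditive) auto
    finally show "emeasure M (X \<inter> d) \<le> 1 * emeasure M (V \<inter> d)" using d by (simp add: Db_def)
  qed
  have good: "emeasure M (X \<inter> \<Union>Dg) \<le> ennreal (1 / 4) * emeasure M (G \<inter> \<Union>Dg)"
  proof (rule emeasure_Int_disjoint_Union_le[OF Dgs Xs Gs])
    fix d assume "d \<in> Dg"
    then have dD: "d \<in> D" and dV: "emeasure M (d - V) \<noteq> 0" by (auto simp: Dg_def)
    obtain m y0 where m: "d = cell p l0 m y0" "P d" "\<And>k. k < m \<Longrightarrow> \<not> P (cell p l0 k y0)"
      using dD unfolding D_def maximal_cells_def by blast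
    \<comment> \<open>Naming the cell by a point of \<open>G\<close> instead of the arbitrary
      \<open>y0\<close> places the base point in \<open>Q0\<close>.\<close>
    have "G \<inter> d \<noteq> {}"
    proof
      assume "G \<inter> d = {}"
      then show False using m(2) unfolding P_def by (metis emeasure_empty mult_zero_right not_less_zero)
    qed
    then obtain y where y: "y \<in> G" "y \<in> d" by auto
    have dy: "d = cell p l0 m y" using cell_eq y(2) m(1) by blast
    have less: "\<not> P (cell p l0 k y)" if "k < m" for k
    proof -
      have "y \<in> cell p l0 k y0" using y(2) m(1) cell_antimono[of k m p l0 y0] that by auto
      then show ?thesis using m(3)[OF that] cell_eq by metis
    qed
    have yQ: "y \<in> Q0" using y GQ by auto
    \<comment> \<open>At level 0 the cell is \<open>Q0\<close> up to faces, and \<open>G\<close> has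
      at most half of its measure.\<close>
    have "m \<noteq> 0"
    proof
      assume "m = 0"
      then have "Q m y = Q0" using cell_center_0[of y c0 l0] yQ by (simp add: Q_def p_def Q0)
      then have "emeasure M Q0 < 2 * emeasure M (G \<inter> Q0)"
        using m(2) unfolding P_def dy cellQ[OF Gs] cellQ' by simp
      also have "G \<inter> Q0 = G" using GQ by auto
      finally have "ennreal (measure M Q0) < ennreal (2 * measure M G)"
        using Gf Q0f by (simp add: emeasure_eq_measure2 ennreal_mult)
      then have "measure M Q0 < 2 * measure M G"
        by (simp add: ennreal_less_iff)
      then show False using G u by (simp add: G_def)
    qed
    then obtain n where n: "m = Suc n" by (cases m) auto
    define q where "q = cell_center p l0 m y"
    define q' where "q' = cell_center p l0 n y"
    define r where "r = l0 / 2 ^ m"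
    have r: "0 < r" using l0 by (simp add: r_def)
    have r': "l0 / 2 ^ n = 2 * r" by (simp add: r_def n)
    have Qm: "Q m y = cube q r" and Qn: "Q n y = cube q' (2 * r)"
      by (auto simp: Q_def q_def q'_def r_def n)
    have qq: "\<bar>q $ i - q' $ i\<bar> = r / 2" for i
      using cell_center_Suc[OF l0, of p n y i] r' by (simp add: q_def q'_def n)
    have sub: "cube q r \<subseteq> cube q' (2 * r)"
      using qq by (intro cube_mono_center) auto
    have subQ: "cube q' (2 * r) \<subseteq> Q0" using QQ0[OF yQ, of n] Qn by simp
    have qq4: "\<bar>q' $ i - q $ i\<bar> \<le> (4 * r - 2 * r) / 2" for i
      using qq[of i] r unfolding abs_minus_commute[of "q' $ i"] by argo
    have "measure M (cube q' (2 * r)) \<le> measure M (cube q (4 * r))"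
      using qq4 by (intro measure_mono_fmeasurable cube_mono_center) auto
    also have "\<dots> \<le> C\<^sup>2 * measure M (cube q r)" by (rule measure_doubling2[OF r])
    also have "\<dots> \<le> 2 ^ N * measure M (cube q r)" using N by (intro mult_right_mono) auto
    finally have growth: "measure M (cube q' (2 * r)) \<le> 2 ^ N * measure M (cube q r)" .
    \<comment> \<open>Positive measure outside \<open>V\<close> survives the passage from the cell
      to the open cube, so the cube contains a point \<open>x\<close> outside \<open>V\<close>. All
      cubes between child and parent contain this one point.\<close>
    have "- V \<in> sets M"
      using sets.compl_sets[OF V(1)] by (simp add: Compl_eq_Diff_UNIV)
    then have "emeasure M (cube q r - V) \<noteq> 0"
      using dV cellQ[of "- V" m y] dy
      by (simp add: Qm Diff_eq Int_commute)
    then obtain x where x: "x \<in> cube q r" "x \<notin> V" by (metis Diff_eq_empty_iff emeasure_empty subsetI)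
    have nearR: "\<exists>c. near f R \<alpha> c" if "is_cube R" "cube q r \<subseteq> R" "R \<subseteq> cube q' (2 * r)" for R
      using near[of x R] x sub subQ that by blast
    obtain cq where cq: "near f (cube q r) \<alpha> cq"
      using nearR[of "cube q r"] sub r unfolding is_cube_def by blast
    obtain cp where cp: "near f (cube q' (2 * r)) \<alpha> cp"
      using nearR[of "cube q' (2 * r)"] sub r unfolding is_cube_def
      by (metis order_refl zero_less_mult_iff zero_less_numeral)
    have 1: "\<bar>cq - cp\<bar> \<le> 2 * (real N + 1) * \<alpha>"
      using qq by (intro near_chain[OF f Q0b _ r subQ nearR growth cq cp]) auto
    \<comment> \<open>The parent was not selected, so \<open>G\<close> fills at most half of it,
      while the values far from \<open>cp\<close> fill less than an eighth. The two sets cannot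
      cover the parent, so \<open>cp\<close> is within \<alpha> of a value of \<open>f\<close> taken
      outside \<open>G\<close>.\<close>
    have "\<exists>z. z \<in> Q0 \<and> z \<notin> G \<and> \<bar>f z - cp\<bar> \<le> \<alpha>"
    proof (rule ccontr)
      assume neg: "\<not> (\<exists>z. z \<in> Q0 \<and> z \<notin> G \<and> \<bar>f z - cp\<bar> \<le> \<alpha>)"
      define A where "A = {z \<in> cube q' (2 * r). \<bar>f z - cp\<bar> > \<alpha>}"
      define B where "B = G \<inter> cube q' (2 * r)"
      have A: "A \<in> fmeasurable M"
        unfolding A_def using subQ level_set[OF f Q0b]
        by (intro fmeasurableI2[OF cube_fmeasurable[of q' "2 * r"]]) auto
      have B: "B \<in> fmeasurable M"
        unfolding B_def using Gs by (intro fmeasurableI2[OF Gf]) auto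
      have "cube q' (2 * r) \<subseteq> A \<union> B" 
      proof
        fix z assume z: "z \<in> cube q' (2 * r)"
        then have "z \<in> G \<or> \<not> \<bar>f z - cp\<bar> \<le> \<alpha>" using neg subQ by blast
        then show "z \<in> A \<union> B" using z by (auto simp: A_def B_def)
      qed
      then have "measure M (cube q' (2 * r)) \<le> measure M (A \<union> B)"
        using A B by (intro measure_mono_fmeasurable) auto
      also have "\<dots> \<le> measure M A + measure M B" using A B by (intro measure_Un_le) auto
      finally have 1: "measure M (cube q' (2 * r)) \<le> measure M A + measure M B" .
      have "2 * emeasure M B \<le> emeasure M (cube q' (2 * r))"
        using less[of n] n Qn unfolding P_def cellQ[OF Gs] cellQ' B_def by (simp add: not_less)
      then have "ennreal (2 * measure M B) \<le> ennreal (measure M (cube q' (2 * r)))"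
        using B by (simp add: emeasure_eq_measure2 ennreal_mult)
      then have "2 * measure M B \<le> measure M (cube q' (2 * r))" by simp
      then show False using 1 cp near_measure_pos[OF cp] unfolding near_def A_def[symmetric] by linarith
    qed
    then obtain z where z: "\<bar>f z - c\<bar> \<le> a" "\<bar>f z - cp\<bar> \<le> \<alpha>" by (auto simp: G_def not_less)
    define A where "A = {z \<in> cube q r. \<bar>f z - cq\<bar> > \<alpha>}"
    have A: "A \<in> fmeasurable M"
      unfolding A_def using sub subQ level_set[OF f Q0b]
      by (intro fmeasurableI2[OF cube_fmeasurable[of q r]]) auto
    \<comment> \<open>The constant \<open>2 * real N + 4\<close> is the length of the path from
      \<open>f w\<close> to \<open>c\<close> beyond \<open>a\<close>: \<alpha> to reach
      \<open>cq\<close>, \<open>2 * (real N + 1) * \<alpha>\<close> along the chain to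
      \<open>cp\<close>, and \<alpha> to reach \<open>f z\<close>.\<close>
    have "X \<inter> cube q r \<subseteq> A"
    proof
      fix w assume w: "w \<in> X \<inter> cube q r"
      then have "\<bar>f w - c\<bar> > a + (2 * real N + 4) * \<alpha>" by (auto simp: X_def)
      moreover have "(2 * real N + 4) * \<alpha> = 2 * (real N + 1) * \<alpha> + \<alpha> + \<alpha>" by (simp add: algebra_simps)
      ultimately have "\<bar>f w - cq\<bar> > \<alpha>" using z 1 by linarith
      then show "w \<in> A" using w by (simp add: A_def)
    qed
    then have "emeasure M (X \<inter> cube q r) \<le> emeasure M A"
      using A by (intro emeasure_mono) auto
    also have "\<dots> = ennreal (measure M A)" using A by (rule emeasure_eq_measure2)
    also have "\<dots> \<le> ennreal (1 / 8 * measure M (cube q r))"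
      using cq unfolding near_def A_def by (intro ennreal_leI) linarith
    also have "\<dots> = ennreal (1 / 8) * emeasure M (cube q r)"
      unfolding emeasure_cube_eq by (rule ennreal_mult) auto
    also have "emeasure M (cube q r) = emeasure M d" unfolding dy cellQ' Qm ..
    also have "ennreal (1 / 8) * emeasure M d \<le> ennreal (1 / 8) * (ennreal 2 * emeasure M (G \<inter> d))"
      using m(2) unfolding P_def by (intro mult_left_mono) auto
    also have "\<dots> = ennreal (1 / 4) * emeasure M (G \<inter> d)"
      unfolding mult.assoc[symmetric] by (subst ennreal_mult[symmetric]) auto
    also have "emeasure M (X \<inter> cube q r) = emeasure M (X \<inter> d)"
      unfolding dy cellQ[OF Xs] Qm ..
    finally show "emeasure M (X \<inter> d) \<le> ennreal (1 / 4) * emeasure M (G \<inter> d)" .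
  qed
  have UDgs: "\<Union>Dg \<in> sets M" "\<Union>Db \<in> sets M" using Dgs Dbs by auto
  have "emeasure M X \<le> emeasure M ((G - \<Union>D) \<union> ((X \<inter> \<Union>Dg) \<union> (X \<inter> \<Union>Db)))"
    using XG Gs Xs UDs UDgs by (intro emeasure_mono) (auto simp: Dg_def Db_def)
  also have "\<dots> \<le> emeasure M (G - \<Union>D) + emeasure M ((X \<inter> \<Union>Dg) \<union> (X \<inter> \<Union>Db))"
    using Gs Xs UDs UDgs by (intro emeasure_subadditive) auto
  also have "\<dots> \<le> 0 + (emeasure M (X \<inter> \<Union>Dg) + emeasure M (X \<inter> \<Union>Db))"
    unfolding null using Gs Xs UDs UDgs by (intro add_mono emeasure_subadditive) auto
  also have "\<dots> \<le> 0 + (ennreal (1 / 4) * emeasure M G + 1 * emeasure M V)"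
    using Gs V by (intro add_mono order_trans[OF good] order_trans[OF bad] mult_left_mono emeasure_mono) auto
  also have "\<dots> = ennreal (1 / 4 * measure M G + measure M V)"
    using Gf Vf
    by (simp add: emeasure_eq_measure2 ennreal_plus ennreal_mult[symmetric] del: ennreal_plus[symmetric])
  also have "\<dots> \<le> ennreal u"
    using G V unfolding G_def by (intro ennreal_leI) linarith
  finally show ?thesis
    unfolding X_def[symmetric] using Xf u0 by (simp add: emeasure_eq_measure2)
qed

end

subsection \<open>Rearrangements\<close>

lemma rearrangement_le:
  "0 \<le> a \<Longrightarrow> emeasure M {x \<in> Q0. F x > ennreal a} \<le> ennreal u \<Longrightarrow> rearrangement M Q0 F u \<le> ennreal a"
  unfolding rearrangement_def by (rule Inf_lower) blast

lemma rearrangement_antimono: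
  "u \<le> v \<Longrightarrow> rearrangement M Q0 F v \<le> rearrangement M Q0 F u"
  unfolding rearrangement_def
  by (rule Inf_superset_mono) (blast intro: order_trans[OF _ ennreal_leI])

lemma rearrangement_zero:
  assumes "Q0 \<in> sets M" "emeasure M Q0 \<le> ennreal u"
  shows "rearrangement M Q0 F u = 0"
proof -
  have "emeasure M {x \<in> Q0. F x > ennreal 0} \<le> emeasure M Q0"
    using assms(1) by (intro emeasure_mono) auto
  then have "rearrangement M Q0 F u \<le> ennreal 0"
    using assms(2) by (intro rearrangement_le) auto
  then show ?thesis by simp
qed

lemma emeasure_level_le:
  assumes meas: "\<And>a. 0 \<le> a \<Longrightarrow> {x \<in> Q0. F x > ennreal a} \<in> sets M"
    and less: "rearrangement M Q0 F u < ennreal a"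
  shows "emeasure M {x \<in> Q0. F x > ennreal a} \<le> ennreal u"
proof -
  obtain b where b: "ennreal b < ennreal a" "0 \<le> b" "emeasure M {x \<in> Q0. F x > ennreal b} \<le> ennreal u"
    using less unfolding rearrangement_def Inf_less_iff by blast
  have "emeasure M {x \<in> Q0. F x > ennreal a} \<le> emeasure M {x \<in> Q0. F x > ennreal b}"
    using meas[OF b(2)] b(1) by (intro emeasure_mono) auto
  then show ?thesis using b(3) by (rule order_trans)
qed

text \<open>The infimum defining the rearrangement is attained: the level set at a finite infimum is
  the increasing union of the level sets slightly above it, and measure is continuous from
  below.\<close>

lemma emeasure_rearrangement_level:
  assumes meas: "\<And>a. 0 \<le> a \<Longrightarrow> {x \<in> Q0. F x > ennreal a} \<in> sets M"
  shows "{x \<in> Q0. F x > rearrangement M Q0 F u} \<in> sets M"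
    and "emeasure M {x \<in> Q0. F x > rearrangement M Q0 F u} \<le> ennreal u"
proof -
  define r where "r = rearrangement M Q0 F u"
  have "{x \<in> Q0. F x > r} \<in> sets M \<and> emeasure M {x \<in> Q0. F x > r} \<le> ennreal u"
  proof (cases r)
    case (real a)
    define A where "A = (\<lambda>n. {x \<in> Q0. F x > ennreal (a + 1 / real (Suc n))})"
    have A: "A n \<in> sets M" for n unfolding A_def using real by (intro meas) auto
    have inc: "incseq A"
    proof (rule incseq_SucI)
      fix n show "A n \<le> A (Suc n)"
      proof -
        have "ennreal (a + 1 / real (Suc (Suc n))) \<le> ennreal (a + 1 / real (Suc n))"
          by (intro ennreal_leI add_left_mono divide_left_mono) auto
        then show ?thesis unfolding A_def by (blast intro: le_less_trans)
      qed
    qed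
    have U: "{x \<in> Q0. F x > r} = (\<Union>n. A n)"
    proof (intro set_eqI iffI)
      fix x assume x: "x \<in> {x \<in> Q0. F x > r}"
      then have "ennreal a < F x" using real by simp
      then obtain b where b: "ennreal a < ennreal b" "ennreal b < F x" "0 \<le> b"
        by (metis dense ennreal_cases less_top_ennreal order_less_trans top.not_eq_extremum)
      then have "0 < b - a" using real by (simp add: ennreal_less_iff)
      then obtain n where "1 / real (Suc n) < b - a" using nat_approx_posE by blast
      then have "ennreal (a + 1 / real (Suc n)) < F x"
        using b(2) by (intro le_less_trans[OF ennreal_leI b(2)]) auto
      then show "x \<in> (\<Union>n. A n)" using x by (auto simp: A_def)
    next
      fix x assume "x \<in> (\<Union>n. A n)"
      then obtain n where x: "x \<in> Q0" "ennreal (a + 1 / real (Suc n)) < F x" by (auto simp: A_def)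
      have "ennreal a \<le> ennreal (a + 1 / real (Suc n))" by (intro ennreal_leI) auto
      then have "ennreal a < F x" using x(2) by (rule le_less_trans)
      then show "x \<in> {x \<in> Q0. F x > r}" using x real by simp
    qed
    have "emeasure M (A n) \<le> ennreal u" for n
      unfolding A_def
    proof (rule emeasure_level_le[OF meas])
      show "rearrangement M Q0 F u < ennreal (a + 1 / real (Suc n))"
        using real by (simp add: r_def[symmetric] ennreal_less_iff)
    qed
    then have "(SUP n. emeasure M (A n)) \<le> ennreal u" by (intro SUP_least)
    then show ?thesis
      unfolding U using A inc SUP_emeasure_incseq[of A M] by (auto simp: image_subset_iff)
  next
    case top
    then show ?thesis by simp
  qed
  then show "{x \<in> Q0. F x > rearrangement M Q0 F u} \<in> sets M"
    and "emeasure M {x \<in> Q0. F x > rearrangement M Q0 F u} \<le> ennreal u"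
    by (auto simp: r_def)
qed

text \<open>A dyadic upper sum for the integral of the rearrangement. A point where F is positive
  lies, almost surely, in a last level set \<open>L j\<close>; there F is at most the next level,
  and \<open>L j\<close> has measure at most m/2^j.\<close>

lemma nn_integral_le_rearrangement_sum:
  assumes Q0: "Q0 \<in> sets M" "emeasure M Q0 = ennreal m" "0 < m"
    and meas: "\<And>a. 0 \<le> a \<Longrightarrow> {x \<in> Q0. F x > ennreal a} \<in> sets M"
  shows "(\<integral>\<^sup>+x\<in>Q0. F x \<partial>M) \<le> (\<Sum>k. ennreal (m / 2 ^ k) * rearrangement M Q0 F (m / 2 ^ Suc k))"
proof -
  define r where "r = (\<lambda>k. rearrangement M Q0 F (m / 2 ^ k))"
  define L where "L = (\<lambda>k. {x \<in> Q0. F x > r k})"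
  have L: "L k \<in> sets M" "emeasure M (L k) \<le> ennreal (m / 2 ^ k)" for k
    unfolding L_def r_def using emeasure_rearrangement_level[OF meas] by auto
  \<comment> \<open>The level at u = m vanishes, so the first index capturing a positive value of F
    is a successor.\<close>
  have r0: "r 0 = 0" unfolding r_def using Q0 by (intro rearrangement_zero) auto
  have "(\<Inter>k. L k) \<in> null_sets M"
  proof (rule null_setsI)
    show "(\<Inter>k. L k) \<in> sets M" using L by auto
    have "emeasure M (\<Inter>k. L k) \<le> ennreal (m / 2 ^ k)" for k
      using L by (intro order_trans[OF emeasure_mono L(2)[of k]]) auto
    moreover have "(\<lambda>k. ennreal (m / 2 ^ k)) \<longlonglongrightarrow> ennreal 0"
      by (intro tendsto_ennrealI) (auto intro!: LIMSEQ_divide_realpow_zero)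
    ultimately have "emeasure M (\<Inter>k. L k) \<le> ennreal 0"
      by (intro LIMSEQ_le_const) auto
    then show "emeasure M (\<Inter>k. L k) = 0" by simp
  qed
  then have "AE x in M. x \<notin> (\<Inter>k. L k)" by (rule AE_not_in)
  then have "AE x in M. F x * indicator Q0 x \<le> (\<Sum>k. r (Suc k) * indicator (L k) x)"
  proof eventually_elim
    fix x assume x: "x \<notin> (\<Inter>k. L k)"
    show "F x * indicator Q0 x \<le> (\<Sum>k. r (Suc k) * indicator (L k) x)"
    proof (cases "x \<in> Q0 \<and> F x > 0")
      case True
      then obtain k where "F x \<le> r k" using x by (auto simp: L_def not_less)
      then obtain k where k: "F x \<le> r k" "\<And>j. j < k \<Longrightarrow> \<not> F x \<le> r j"
        using exists_least_iff[of "\<lambda>k. F x \<le> r k"] by auto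
      have "k \<noteq> 0" using k(1) r0 True by (metis leD)
      then obtain j where j: "k = Suc j" by (cases k) auto
      have "F x * indicator Q0 x \<le> r (Suc j) * indicator (L j) x"
        using k(1) k(2)[of j] True unfolding j L_def by (auto simp: not_le)
      also have "\<dots> \<le> (\<Sum>k. r (Suc k) * indicator (L k) x)"
        using sum_le_suminf[OF summableI, of "{j}" "\<lambda>k. r (Suc k) * indicator (L k) x"]
        by (simp del: sum_mult_indicator)
      finally show ?thesis .
    next
      case False
      then have "F x * indicator Q0 x = 0" by (auto simp: indicator_def zero_less_iff_neq_zero)
      then show ?thesis by (simp only: zero_le)
    qed
  qed
  then have "(\<integral>\<^sup>+x\<in>Q0. F x \<partial>M) \<le> (\<integral>\<^sup>+x. (\<Sum>k. r (Suc k) * indicator (L k) x) \<partial>M)"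
    by (rule nn_integral_mono_AE)
  also have "\<dots> = (\<Sum>k. r (Suc k) * emeasure M (L k))"
    using L by (simp add: nn_integral_suminf nn_integral_cmult_indicator)
  also have "\<dots> \<le> (\<Sum>k. ennreal (m / 2 ^ k) * rearrangement M Q0 F (m / 2 ^ Suc k))"
    using L(2) unfolding r_def by (intro suminf_le) (auto simp: mult.commute intro!: mult_right_mono)
  finally show ?thesis .
qed

section \<open>Medians and averages\<close>

lemma (in finite_measure) exists_median:
  fixes f :: "'a \<Rightarrow> real"
  assumes f [measurable]: "f \<in> borel_measurable M" and pos: "0 < measure M (space M)"
  shows "\<exists>c. measure M {x \<in> space M. f x > c} \<le> measure M (space M) / 2 \<and>
             measure M {x \<in> space M. f x < c} \<le> measure M (space M) / 2"
proof -
  define m where "m = measure M (space M)"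
  define \<phi> where "\<phi> = (\<lambda>a. measure M {x \<in> space M. f x > a})"
  define A where "A = {a. \<phi> a \<le> m / 2}"
  have anti: "\<phi> b \<le> \<phi> a" if "a \<le> b" for a b
    unfolding \<phi>_def using that by (intro finite_measure_mono) auto
  have "(\<lambda>n. \<phi> (real n)) \<longlonglongrightarrow> measure M (\<Inter>n. {x \<in> space M. f x > real n})"
    unfolding \<phi>_def by (intro finite_Lim_measure_decseq) (auto simp: decseq_def)
  also have "(\<Inter>n. {x \<in> space M. f x > real n}) = {}"
  proof -
    have "\<exists>n. \<not> f x > real n" for x
      using reals_Archimedean2[of "f x"] by (meson less_imp_not_less)
    then show ?thesis by blast
  qed
  finally have "\<forall>\<^sub>F n in sequentially. \<phi> (real n) < m / 2"
    using pos by (intro order_tendstoD(2)) (auto simp: m_def)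
  then obtain n0 :: nat where n0: "\<phi> (real n0) < m / 2" by (auto simp: eventually_sequentially)
  then have "real n0 \<in> A" by (simp add: A_def)
  have "(\<lambda>n. \<phi> (- real n)) \<longlonglongrightarrow> measure M (\<Union>n. {x \<in> space M. f x > - real n})"
    unfolding \<phi>_def by (intro finite_Lim_measure_incseq) (auto simp: incseq_def)
  also have "(\<Union>n. {x \<in> space M. f x > - real n}) = space M"
  proof -
    have "\<exists>n. f x > - real n" for x
      using reals_Archimedean2[of "- f x"] by (auto simp: minus_less_iff)
    then show ?thesis by auto
  qed
  finally have "\<forall>\<^sub>F n in sequentially. \<phi> (- real n) > m / 2"
    using pos by (intro order_tendstoD(1)) (auto simp: m_def)
  then obtain n1 :: nat where n1: "\<phi> (- real n1) > m / 2" by (auto simp: eventually_sequentially)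
  have lb: "- real n1 \<le> a" if "a \<in> A" for a
    using that n1 anti[of a "- real n1"] unfolding A_def by force
  have bdd: "bdd_below A" using lb by (rule bdd_belowI)
  \<comment> \<open>Tails above +n tend to 0 and tails above -n to the full measure, so
    \<open>A\<close> is nonempty and bounded below. Both median inequalities are known just beside
    \<open>c\<close> and pass to \<open>c\<close> by continuity from below.\<close>
  define c where "c = Inf A"
  have inA: "a \<in> A" if "c < a" for a
  proof -
    have "A \<noteq> {}" using \<open>real n0 \<in> A\<close> by auto
    then have "\<exists>b\<in>A. b < a" using that[unfolded c_def] by (rule cInf_lessD)
    then obtain b where "b \<in> A" "b < a" ..
    then show ?thesis using anti[of b a] by (auto simp: A_def)
  qed
  have notA: "a \<notin> A" if "a < c" for a
    using cInf_lower[OF _ bdd, of a] that by (auto simp: c_def)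
  have half: "measure M (\<Union>n. X n) \<le> m / 2"
    if X: "\<And>n. X n \<in> sets M" "\<And>n. X n \<subseteq> X (Suc n)" "\<And>n. measure M (X n) \<le> m / 2" for X :: "nat \<Rightarrow> 'a set"
  proof (rule LIMSEQ_le_const2[OF finite_Lim_measure_incseq])
    show "range X \<subseteq> sets M" "incseq X" using X by (auto intro: incseq_SucI)
    show "\<exists>N. \<forall>n\<ge>N. measure M (X n) \<le> m / 2" using X by auto
  qed
  have dec: "1 / real (Suc (Suc n)) \<le> 1 / real (Suc n)" "0 < 1 / real (Suc n)" for n by (simp_all add: field_simps)
  have "measure M (\<Union>n. {x \<in> space M. f x > c + 1 / real (Suc n)}) \<le> m / 2"
  proof (rule half)
    show "measure M {x \<in> space M. f x > c + 1 / real (Suc n)} \<le> m / 2" for n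
      using inA[of "c + 1 / real (Suc n)"] by (simp add: A_def \<phi>_def)
    show "{x \<in> space M. f x > c + 1 / real (Suc n)} \<subseteq> {x \<in> space M. f x > c + 1 / real (Suc (Suc n))}" for n
      using dec(1)[of n] by auto
  qed measurable
  moreover
  have "{x \<in> space M. f x > c} \<subseteq> (\<Union>n. {x \<in> space M. f x > c + 1 / real (Suc n)})"
  proof
    fix x assume x: "x \<in> {x \<in> space M. f x > c}"
    then obtain n where "1 / real (Suc n) < f x - c" using nat_approx_posE[of "f x - c"] by auto
    then show "x \<in> (\<Union>n. {x \<in> space M. f x > c + 1 / real (Suc n)})" using x by (auto simp: algebra_simps)
  qed
  then have "measure M {x \<in> space M. f x > c} \<le> measure M (\<Union>n. {x \<in> space M. f x > c + 1 / real (Suc n)})"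
    by (rule finite_measure_mono) measurable
  ultimately have upper: "measure M {x \<in> space M. f x > c} \<le> m / 2" by linarith
  have le: "measure M {x \<in> space M. f x \<le> a} \<le> m / 2" if "a < c" for a
  proof -
    have "{x \<in> space M. f x \<le> a} = space M - {x \<in> space M. f x > a}" by auto
    then have "measure M {x \<in> space M. f x \<le> a} = m - \<phi> a"
      unfolding \<phi>_def m_def by (simp add: finite_measure_compl)
    then show ?thesis using notA[OF that] by (simp add: A_def)
  qed
  have "measure M (\<Union>n. {x \<in> space M. f x \<le> c - 1 / real (Suc n)}) \<le> m / 2"
  proof (rule half)
    show "measure M {x \<in> space M. f x \<le> c - 1 / real (Suc n)} \<le> m / 2" for n by (rule le) simp
    show "{x \<in> space M. f x \<le> c - 1 / real (Suc n)} \<subseteq> {x \<in> space M. f x \<le> c - 1 / real (Suc (Suc n))}" for n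
      using dec(1)[of n] by auto
  qed measurable
  moreover
  have "{x \<in> space M. f x < c} \<subseteq> (\<Union>n. {x \<in> space M. f x \<le> c - 1 / real (Suc n)})"
  proof
    fix x assume x: "x \<in> {x \<in> space M. f x < c}"
    then obtain n where "1 / real (Suc n) < c - f x" using nat_approx_posE[of "c - f x"] by auto
    then have "f x \<le> c - 1 / real (Suc n)" by linarith
    then show "x \<in> (\<Union>n. {x \<in> space M. f x \<le> c - 1 / real (Suc n)})" using x by blast
  qed
  then have "measure M {x \<in> space M. f x < c} \<le> measure M (\<Union>n. {x \<in> space M. f x \<le> c - 1 / real (Suc n)})"
    by (rule finite_measure_mono) measurable
  ultimately have "measure M {x \<in> space M. f x < c} \<le> m / 2" by linarith
  with upper show ?thesis unfolding m_def by blast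
qed

lemma average_diff_le:
  fixes f :: "'a \<Rightarrow> real"
  assumes Q: "Q \<in> sets M" "emeasure M Q = ennreal m" "0 < m"
    and f: "f \<in> borel_measurable (restrict_space M Q)"
    and le: "(\<integral>\<^sup>+x\<in>Q. ennreal \<bar>f x - c\<bar> \<partial>M) \<le> ennreal (m * b)" and b: "0 \<le> b"
  shows "\<bar>average M Q f - c\<bar> \<le> b"
proof -
  define g where "g = (\<lambda>x. indicator Q x *\<^sub>R (f x - c))"
  have fin: "emeasure M Q < \<infinity>" using Q by simp
  have mQ: "measure M Q = m" using Q by (simp add: measure_def)
  have "(\<lambda>x. f x - c) \<in> borel_measurable (restrict_space M Q)" using f by simp
  then have gm: "g \<in> borel_measurable M"
    unfolding g_def using Q by (subst (asm) borel_measurable_restrict_space_iff) auto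
  have norm_g: "ennreal (norm (g x)) = ennreal \<bar>f x - c\<bar> * indicator Q x" for x
    by (simp add: g_def indicator_def)
  have gle: "(\<integral>\<^sup>+x. ennreal (norm (g x)) \<partial>M) \<le> ennreal (m * b)"
    using le by (simp only: norm_g)
  \<comment> \<open>The assumed bound makes \<open>f\<close> integrable on \<open>Q\<close>, so
    \<open>average\<close> is a genuine integral and not the default value 0.\<close>
  have gi: "integrable M g"
    by (intro integrableI_bounded gm le_less_trans[OF gle]) simp
  have ci: "integrable M (\<lambda>x. indicator Q x *\<^sub>R c)"
    using Q fin by (intro integrable_scaleR_left integrable_real_indicator) auto
  have fe: "(\<lambda>x. indicator Q x *\<^sub>R f x) = (\<lambda>x. g x + indicator Q x *\<^sub>R c)"
    by (auto simp: g_def indicator_def)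
  have "(LINT x:Q|M. f x) = integral\<^sup>L M g + m * c"
    unfolding set_lebesgue_integral_def fe using gi ci Q fin by (simp add: mQ)
  then have "average M Q f - c = integral\<^sup>L M g / m"
    using Q by (simp add: average_def mQ field_simps)
  moreover have "\<bar>integral\<^sup>L M g\<bar> \<le> m * b"
  proof -
    have "ennreal (norm (integral\<^sup>L M g)) \<le> ennreal (m * b)"
      using integral_norm_bound_ennreal[OF gi] gle by (rule order_trans)
    then show ?thesis using Q b by (subst (asm) ennreal_le_iff) auto
  qed
  ultimately show ?thesis using Q by (simp add: pos_divide_le_eq mult.commute)
qed

text \<open>\<open>S\<close> stands for either maximal function of the fixed \<open>f\<close>; all
  that is used of it is measurability of its level sets and the domination \<open>osc_le\<close>.
  \<open>B\<close> is 8 for the sharp maximal function and 1 for the local one, and \<open>N\<close>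
  bounds the number of halvings between a parent cube and its child.\<close>

locale sharp_setup = doubling_space \<mu> C for \<mu> :: "(real ^ 'n) measure" and C +
  fixes Q0 :: "(real ^ 'n) set" and c0 :: "real ^ 'n" and l0 :: real
    and f :: "real ^ 'n \<Rightarrow> real" and S :: "real ^ 'n \<Rightarrow> ennreal" and B :: real and N :: nat
  assumes l0: "0 < l0" and Q0: "Q0 = cube c0 l0" and Q0_pos: "0 < measure M Q0"
    and f: "f \<in> borel_measurable (restrict_space M Q0)"
    and N: "C\<^sup>2 \<le> 2 ^ N"
    and S_level: "0 \<le> a \<Longrightarrow> {x \<in> Q0. S x > ennreal a} \<in> sets M"
    and B: "1 \<le> B"
    and osc_le: "x \<in> Q0 \<Longrightarrow> is_cube R \<Longrightarrow> x \<in> R \<Longrightarrow> R \<subseteq> Q0 \<Longrightarrow> local_osc (1 / 8) M R f \<le> ennreal B * S x"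
begin

abbreviation m :: real where "m \<equiv> measure M Q0"

definition h :: "real \<Rightarrow> ennreal" where "h = rearrangement M Q0 S"

definition g :: "real \<Rightarrow> real \<Rightarrow> ennreal" where
  "g c = rearrangement M Q0 (\<lambda>x. ennreal \<bar>f x - c\<bar>)"

lemma Q0_borel: "Q0 \<in> sets borel" and Q0_fm: "Q0 \<in> fmeasurable M"
  by (auto simp: Q0)

lemma Q0_M: "Q0 \<in> sets M" "emeasure M Q0 = ennreal m"
  using Q0_borel Q0_fm by (auto simp: emeasure_eq_measure2)

lemma near_if_S_le:
  assumes "x \<in> Q0" "S x \<le> ennreal \<beta>" "0 \<le> \<beta>" "B * \<beta> < \<alpha>" "is_cube R" "x \<in> R" "R \<subseteq> Q0"
  shows "\<exists>c. near f R \<alpha> c"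
proof (rule near_if_local_osc[OF f Q0_borel assms(5,7)])
  have "local_osc (1 / 8) M R f \<le> ennreal B * ennreal \<beta>"
    using assms by (intro order_trans[OF osc_le] mult_left_mono) auto
  also have "\<dots> = ennreal (B * \<beta>)" using B assms by (intro ennreal_mult[symmetric]) auto
  also have "\<dots> < ennreal \<alpha>" using B assms by (intro ennreal_lessI) (auto intro: le_less_trans[rotated])
  finally show "local_osc (1 / 8) M R f < ennreal \<alpha>" .
qed

lemma f_level: "{x \<in> Q0. \<bar>f x - c\<bar> > a} \<in> fmeasurable M"
  by (rule fmeasurableI2[OF Q0_fm _ level_set[OF f Q0_borel Q0_borel order_refl]]) auto

lemma f_level_ennreal: "0 \<le> a \<Longrightarrow> {x \<in> Q0. ennreal \<bar>f x - c\<bar> > ennreal a} = {x \<in> Q0. \<bar>f x - c\<bar> > a}"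
  by (auto simp: ennreal_less_iff)

lemma f_level_sets: "0 \<le> a \<Longrightarrow> {x \<in> Q0. ennreal \<bar>f x - c\<bar> > ennreal a} \<in> sets M"
  unfolding f_level_ennreal using f_level by auto

lemma S_level_le:
  assumes "h u < ennreal \<beta>" "0 \<le> \<beta>" "0 \<le> u"
  shows "measure M {x \<in> Q0. S x > ennreal \<beta>} \<le> u"
proof -
  have "{x \<in> Q0. S x > ennreal \<beta>} \<in> fmeasurable M"
    by (rule fmeasurableI2[OF Q0_fm _ S_level[OF assms(2)]]) auto
  moreover have "emeasure M {x \<in> Q0. S x > ennreal \<beta>} \<le> ennreal u"
    by (rule emeasure_level_le[OF S_level]) (use assms in \<open>auto simp: h_def\<close>)
  ultimately show ?thesis using assms by (simp add: emeasure_eq_measure2)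
qed

lemma g_le_if_level:
  assumes "0 \<le> a" "measure M {x \<in> Q0. \<bar>f x - c\<bar> > a} \<le> u"
  shows "g c u \<le> ennreal a"
  unfolding g_def
proof (rule rearrangement_le[OF assms(1)])
  show "emeasure M {x \<in> Q0. ennreal a < ennreal \<bar>f x - c\<bar>} \<le> ennreal u"
    unfolding f_level_ennreal[OF assms(1)] using f_level assms(2)
    by (simp add: emeasure_eq_measure2 ennreal_leI)
qed

text \<open>Every quantity is given strict room, so that it is an honest real number and
  \<open>near\<close> holds with strict inequality; \<open>g_step\<close> then lets the room shrink
  to zero.\<close>

lemma g_step_real:
  assumes u: "0 < u" "4 * u \<le> m" and h: "h (u / 2) < ennreal \<beta>" "0 \<le> \<beta>" "B * \<beta> < \<alpha>"
    and a: "g c (2 * u) < ennreal a" "0 \<le> a"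
  shows "g c u \<le> ennreal (a + (2 * real N + 4) * \<alpha>)"
proof (rule g_le_if_level)
  have \<alpha>: "0 \<le> \<alpha>" using h B by (auto intro: order_trans[OF mult_nonneg_nonneg less_imp_le[OF h(3)]])
  then show "0 \<le> a + (2 * real N + 4) * \<alpha>" using a by auto
  show "measure M {x \<in> Q0. \<bar>f x - c\<bar> > a + (2 * real N + 4) * \<alpha>} \<le> u"
  proof (rule good_lambda[OF l0 Q0 f N _ u(2) S_level[OF h(2)] _ S_level_le[OF h(1,2)]])
    have "emeasure M {x \<in> Q0. \<bar>f x - c\<bar> > a} \<le> ennreal (2 * u)"
      using emeasure_level_le[OF f_level_sets a(1)[unfolded g_def]] f_level_ennreal[OF a(2)] by simp
    then show "measure M {x \<in> Q0. \<bar>f x - c\<bar> > a} \<le> 2 * u"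
      using f_level u by (simp add: emeasure_eq_measure2)
  next
    fix x R assume "x \<in> Q0 - {x \<in> Q0. ennreal \<beta> < S x}" "is_cube R" "x \<in> R" "R \<subseteq> Q0"
    then show "\<exists>c. near f R \<alpha> c"
      using h by (intro near_if_S_le[where \<beta> = \<beta> and x = x]) auto
  qed (use u \<alpha> in auto)
qed

definition K :: real where "K = (2 * real N + 4) * B"

lemma K_pos: "0 < K"
  using B by (auto simp: K_def intro!: mult_pos_pos)

lemma ennreal_le_sumI:
  fixes x y z :: ennreal
  assumes K: "0 < K" and le: "\<And>e a b. 0 < e \<Longrightarrow> 0 \<le> a \<Longrightarrow> 0 \<le> b \<Longrightarrow> y = ennreal a \<Longrightarrow> z = ennreal b \<Longrightarrow>
      x \<le> ennreal (a + K * b + e)"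
  shows "x \<le> y + ennreal K * z"
proof (cases y)
  case a: (real a)
  show ?thesis
  proof (cases z)
    case b: (real b)
    have eq: "y + ennreal K * z = ennreal (a + K * b)"
      using a b K by (simp add: ennreal_mult[symmetric] ennreal_plus[symmetric] del: ennreal_plus)
    show ?thesis
    proof (rule ennreal_le_epsilon)
      fix e :: real assume "0 < e"
      then have "x \<le> ennreal (a + K * b + e)" by (rule le[OF _ a(1) b(1) a(2) b(2)])
      also have "\<dots> = ennreal (a + K * b) + ennreal e"
        using a(1) b(1) K \<open>0 < e\<close> by (intro ennreal_plus) auto
      finally show "x \<le> y + ennreal K * z + ennreal e" by (simp only: eq)
    qed
  next
    case top
    then show ?thesis using K by (simp add: ennreal_mult_top)
  qed
qed simp

lemma g_step:
  assumes u: "0 < u" "4 * u \<le> m"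
  shows "g c u \<le> g c (2 * u) + ennreal K * h (u / 2)"
proof (rule ennreal_le_sumI[OF K_pos])
  fix e a b :: real
  assume e: "0 < e" "0 \<le> a" "0 \<le> b" and a: "g c (2 * u) = ennreal a" and b: "h (u / 2) = ennreal b"
  define L where "L = 2 * real N + 4"
  \<comment> \<open>The slack d enters once through \<open>a\<close>, \<open>B\<close> times
    \<open>L\<close> through the bound for \<open>S\<close>, and \<open>L\<close> times through
    \<alpha>; this choice makes the total equal to e.\<close>
  define d where "d = e / (1 + L * (B + 1))"
  have L: "0 < L" by (simp add: L_def)
  have den: "0 < 1 + L * (B + 1)" using L B by (auto intro!: add_pos_nonneg mult_nonneg_nonneg)
  have d: "0 < d" using e den by (simp add: d_def)
  have "g c u \<le> ennreal ((a + d) + (2 * real N + 4) * (B * (b + d) + d))"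
  proof (rule g_step_real[OF u, where \<beta> = "b + d"])
  qed (use a b d e in \<open>auto simp: ennreal_less_iff simp del: ennreal_plus\<close>)
  also have "(a + d) + (2 * real N + 4) * (B * (b + d) + d) = a + K * b + d * (1 + L * (B + 1))"
    unfolding L_def[symmetric] K_def by (simp add: algebra_simps)
  also have "d * (1 + L * (B + 1)) = e" using den by (simp add: d_def)
  finally show "g c u \<le> ennreal (a + K * b + e)" .
qed

definition median :: real where
  "median = (SOME c. measure M {x \<in> Q0. f x > c} \<le> m / 2 \<and> measure M {x \<in> Q0. f x < c} \<le> m / 2)"

lemma median:
  "measure M {x \<in> Q0. f x > median} \<le> m / 2" "measure M {x \<in> Q0. f x < median} \<le> m / 2"
proof -
  define R where "R = restrict_space M Q0"
  have "space R = Q0" by (simp add: R_def space_restrict_space)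
  have mR: "measure R A = measure M A" if "A \<subseteq> Q0" for A
    unfolding R_def using that Q0_M by (intro measure_restrict_space) auto
  interpret R: finite_measure R
    using Q0_M by (intro finite_measureI) (simp add: R_def emeasure_restrict_space space_restrict_space)
  have "\<exists>c. measure R {x \<in> space R. f x > c} \<le> measure R (space R) / 2 \<and>
             measure R {x \<in> space R. f x < c} \<le> measure R (space R) / 2"
    using f Q0_pos mR[of Q0] by (intro R.exists_median) (auto simp: \<open>space R = Q0\<close> R_def[symmetric])
  then have "\<exists>c. measure M {x \<in> Q0. f x > c} \<le> m / 2 \<and> measure M {x \<in> Q0. f x < c} \<le> m / 2"
    unfolding \<open>space R = Q0\<close> by (subst (asm) (1 2 3 4) mR) auto
  then have "measure M {x \<in> Q0. f x > median} \<le> m / 2 \<and> measure M {x \<in> Q0. f x < median} \<le> m / 2"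
    unfolding median_def by (rule someI_ex)
  then show "measure M {x \<in> Q0. f x > median} \<le> m / 2" "measure M {x \<in> Q0. f x < median} \<le> m / 2"
    by blast+
qed

text \<open>Were the distance larger than \<alpha>, the set of values close to \<open>c\<close>, of
  measure at least 7/8 of m, would lie strictly on one side of the median, where at most m/2 is
  available.\<close>

lemma near_median:
  assumes n: "near f Q0 \<alpha> c"
  shows "\<bar>c - median\<bar> \<le> \<alpha>"
proof -
  have half: "measure M Q0 \<le> m / 8 + measure M A"
    if A: "A \<in> sets M" "A \<subseteq> Q0" "\<And>x. x \<in> Q0 \<Longrightarrow> \<bar>f x - c\<bar> \<le> \<alpha> \<Longrightarrow> x \<in> A" for A
  proof -
    have Af: "A \<in> fmeasurable M" by (rule fmeasurableI2[OF Q0_fm A(2,1)])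
    have "Q0 \<subseteq> {x \<in> Q0. \<bar>f x - c\<bar> > \<alpha>} \<union> A"
      using A(3) linorder_not_less by blast
    then have "measure M Q0 \<le> measure M ({x \<in> Q0. \<bar>f x - c\<bar> > \<alpha>} \<union> A)"
      using f_level Af Q0_M by (intro measure_mono_fmeasurable) auto
    also have "\<dots> \<le> measure M {x \<in> Q0. \<bar>f x - c\<bar> > \<alpha>} + measure M A"
      using f_level Af by (intro measure_Un_le) auto
    also have "\<dots> \<le> m / 8 + measure M A" using n unfolding near_def by linarith
    finally show ?thesis .
  qed
  have fm: "{x \<in> Q0. f x > d} \<in> sets M" "{x \<in> Q0. f x < d} \<in> sets M" for d
  proof -
    have "{x \<in> space (restrict_space M Q0). f x > d} \<in> sets (restrict_space M Q0)"
      "{x \<in> space (restrict_space M Q0). f x < d} \<in> sets (restrict_space M Q0)"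
      using f borel_measurable_iff_greater[of f] borel_measurable_iff_less[of f] by blast+
    then show "{x \<in> Q0. f x > d} \<in> sets M" "{x \<in> Q0. f x < d} \<in> sets M"
      using Q0_M by (auto simp: space_restrict_space sets_restrict_space_iff)
  qed
  have "\<not> c - median > \<alpha>"
  proof
    assume "c - median > \<alpha>"
    then have "m \<le> m / 8 + measure M {x \<in> Q0. f x > median}"
      by (intro half fm) (auto simp: abs_le_iff)
    then show False using median Q0_pos by linarith
  qed
  moreover have "\<not> median - c > \<alpha>"
  proof
    assume "median - c > \<alpha>"
    then have "m \<le> m / 8 + measure M {x \<in> Q0. f x < median}"
      by (intro half fm) (auto simp: abs_le_iff)
    then show False using median Q0_pos by linarith
  qed
  ultimately show ?thesis by linarith
qed

lemma g_zero: "m \<le> u \<Longrightarrow> g c u = 0"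
  unfolding g_def using Q0_M by (intro rearrangement_zero) (auto intro: ennreal_leI)

lemma h_zero: "m \<le> u \<Longrightarrow> h u = 0"
  unfolding h_def using Q0_M by (intro rearrangement_zero) (auto intro: ennreal_leI)

lemma h_antimono: "u \<le> v \<Longrightarrow> h v \<le> h u"
  unfolding h_def by (rule rearrangement_antimono)

text \<open>Where the iteration ends. \<open>Q0\<close> itself has a point with small maximal
  function, so an approximate median of \<open>Q0\<close> exists and is within \<alpha> of the true
  one. The exceptional set has measure at most m/8, which is at most u; hence the bound
  \<open>8 * u\<close>.\<close>

lemma g_base:
  assumes u: "0 < u" "m \<le> 8 * u"
  shows "g median u \<le> ennreal K * h (u / 2)"
proof (cases "m \<le> u")
  case True
  then show ?thesis by (simp add: g_zero)
next
  case False
  have "g median u \<le> 0 + ennreal K * h (u / 2)"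
  proof (rule ennreal_le_sumI[OF K_pos])
    fix e a b :: real
    assume e: "0 < e" "0 \<le> a" "0 \<le> b" and b: "h (u / 2) = ennreal b"
    define d where "d = e / (2 * (B + 1))"
    have d: "0 < d" using e B by (simp add: d_def)
    define V where "V = {x \<in> Q0. S x > ennreal (b + d)}"
    have "measure M V \<le> u / 2"
      unfolding V_def using b d e u
      by (intro S_level_le) (auto simp: ennreal_less_iff simp del: ennreal_plus)
    then have "V \<noteq> Q0" using False u by auto
    then obtain x where x: "x \<in> Q0" "S x \<le> ennreal (b + d)"
      unfolding V_def using linorder_not_less by blast
    define \<alpha> where "\<alpha> = B * (b + d) + d"
    have "0 \<le> B * (b + d)" using B e d by auto
    then have \<alpha>: "0 \<le> \<alpha>" using d by (simp add: \<alpha>_def)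
    obtain c where c: "near f Q0 \<alpha> c"
      using near_if_S_le[OF x, of \<alpha> Q0] x e d l0 by (auto simp: \<alpha>_def Q0 is_cube_def)
    note near_median[OF c]
    then have "measure M {x \<in> Q0. \<bar>f x - median\<bar> > 2 * \<alpha>} \<le> measure M {x \<in> Q0. \<bar>f x - c\<bar> > \<alpha>}"
      using f_level by (intro measure_mono_fmeasurable) (auto simp: fmeasurableD)
    also have "\<dots> \<le> m / 8" using c by (simp add: near_def)
    finally have "measure M {x \<in> Q0. \<bar>f x - median\<bar> > 2 * \<alpha>} \<le> u" using u by linarith
    then have "g median u \<le> ennreal (2 * \<alpha>)" using \<alpha> by (intro g_le_if_level) auto
    also have "2 * \<alpha> = 2 * B * b + d * (2 * (B + 1))" by (simp add: \<alpha>_def algebra_simps)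
    also have "d * (2 * (B + 1)) = e" using B by (simp add: d_def)
    also have "ennreal (2 * B * b + e) \<le> ennreal (a + K * b + e)"
    proof (rule ennreal_leI)
      have "2 * B \<le> K" using B by (simp add: K_def mult_right_mono)
      then have "2 * B * b \<le> K * b" using e by (intro mult_right_mono) auto
      then show "2 * B * b + e \<le> a + K * b + e" using e by linarith
    qed
    finally show "g median u \<le> ennreal (a + K * b + e)" .
  qed
  then show ?thesis by simp
qed

text \<open>\<open>g_step\<close> holds for any constant, but only the median also satisfies
  \<open>g_base\<close>, and the same constant must serve at every scale. Finitely many steps
  suffice to pass m/8; the remaining terms of the series only enlarge the bound.\<close>

lemma g_le_suminf:
  assumes u: "0 < u"
  shows "g median u \<le> ennreal K * (\<Sum>k. h (2 ^ k * u / 2))"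
proof -
  have *: "g median u \<le> ennreal K * (\<Sum>k\<le>n. h (2 ^ k * u / 2))" if "0 < u" "m \<le> 8 * 2 ^ n * u" for n u
    using that
  proof (induction n arbitrary: u)
    case 0
    then show ?case using g_base[of u] by simp
  next
    case (Suc n)
    have split: "(\<Sum>k\<le>Suc n. h (2 ^ k * u / 2)) = h (u / 2) + (\<Sum>k\<le>n. h (2 ^ k * (2 * u) / 2))"
      by (subst sum.atMost_Suc_shift) (simp add: mult_ac)
    show ?case
    proof (cases "m \<le> 8 * u")
      case True
      have "g median u \<le> ennreal K * h (u / 2)" by (rule g_base[OF Suc.prems(1) True])
      also have "\<dots> \<le> ennreal K * (\<Sum>k\<le>Suc n. h (2 ^ k * u / 2))"
        unfolding split by (intro mult_left_mono) auto
      finally show ?thesis .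
    next
      case False
      have "g median u \<le> g median (2 * u) + ennreal K * h (u / 2)"
        using False Suc.prems by (intro g_step) auto
      also have "\<dots> \<le> ennreal K * (\<Sum>k\<le>n. h (2 ^ k * (2 * u) / 2)) + ennreal K * h (u / 2)"
        using Suc.prems by (intro add_mono Suc.IH) (auto simp: mult_ac)
      also have "\<dots> = ennreal K * (\<Sum>k\<le>Suc n. h (2 ^ k * u / 2))"
        unfolding split by (simp add: distrib_left add.commute)
      finally show ?thesis .
    qed
  qed
  obtain n where "m / (8 * u) < 2 ^ n" using real_arch_pow[of 2 "m / (8 * u)"] by auto
  then have "m \<le> 8 * 2 ^ n * u" using u by (simp add: field_simps)
  then have "g median u \<le> ennreal K * (\<Sum>k\<le>n. h (2 ^ k * u / 2))" by (rule *[OF u])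
  also have "\<dots> \<le> ennreal K * (\<Sum>k. h (2 ^ k * u / 2))"
    by (intro mult_left_mono sum_le_suminf) auto
  finally show ?thesis .
qed

text \<open>At this argument the terms with j at least k + 2 vanish, because \<open>h\<close> is
  zero from m on, and the others are at most the first. The linear factor k + 2 is harmless against
  geometric decay.\<close>

lemma g_dyadic_le: "g median (m / 2 ^ Suc k) \<le> ennreal (K * real (k + 2)) * h (m / 2 ^ (k + 2))"
proof -
  have z: "h (2 ^ j * (m / 2 ^ Suc k) / 2) = 0" if "j \<notin> {..<k + 2}" for j
  proof (rule h_zero)
    have "(2 :: real) ^ (k + 2) \<le> 2 ^ j" using that by (intro power_increasing) auto
    then have "m * 2 ^ (k + 2) \<le> m * 2 ^ j" using Q0_pos by (intro mult_left_mono) auto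
    then show "m \<le> 2 ^ j * (m / 2 ^ Suc k) / 2" by (simp add: field_simps)
  qed
  have "(\<Sum>j. h (2 ^ j * (m / 2 ^ Suc k) / 2)) = (\<Sum>j<k + 2. h (2 ^ j * (m / 2 ^ Suc k) / 2))"
    by (rule suminf_finite) (simp, rule z)
  also have "\<dots> \<le> (\<Sum>j<k + 2. h (m / 2 ^ (k + 2)))"
  proof (intro sum_mono h_antimono)
    fix j
    have "m / 2 ^ (k + 2) * 1 \<le> m / 2 ^ (k + 2) * 2 ^ j" using Q0_pos by (intro mult_left_mono) auto
    then show "m / 2 ^ (k + 2) \<le> 2 ^ j * (m / 2 ^ Suc k) / 2" by (simp add: field_simps)
  qed
  also have "\<dots> = ennreal (real (k + 2)) * h (m / 2 ^ (k + 2))"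
    by (simp add: ennreal_of_nat_eq_real_of_nat)
  finally have "(\<Sum>j. h (2 ^ j * (m / 2 ^ Suc k) / 2)) \<le> ennreal (real (k + 2)) * h (m / 2 ^ (k + 2))" .
  then have "ennreal K * (\<Sum>j. h (2 ^ j * (m / 2 ^ Suc k) / 2)) \<le> ennreal K * (ennreal (real (k + 2)) * h (m / 2 ^ (k + 2)))"
    by (rule mult_left_mono) simp
  then have "g median (m / 2 ^ Suc k) \<le> ennreal K * (ennreal (real (k + 2)) * h (m / 2 ^ (k + 2)))"
    using g_le_suminf[of "m / 2 ^ Suc k"] Q0_pos by (auto intro: order_trans)
  also have "\<dots> = ennreal (K * real (k + 2)) * h (m / 2 ^ (k + 2))"
    using K_pos by (simp add: ennreal_mult mult.assoc)
  finally show ?thesis .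
qed

text \<open>The square comes from the sum of (k + 1) q^k, which is 1/(1 - q)^2, with q = 2^(1/p -
  1); q < 1 exactly when p > 1. The factor 8 is 2 from k + 2 \<le> 2(k + 1) times 4 from 2^(2/p)
  \<le> 4.\<close>

definition avg_const :: "real \<Rightarrow> real" where
  "avg_const p = 8 * K * (1 + m powr (- 1 / p)) / (1 - 2 powr (1 / p - 1))\<^sup>2"

text \<open>Only a weak-type bound up to t is assumed; beyond t monotonicity gives the value at t.
  Since t \<le> 1, the factor \<open>t powr (- 1 / p)\<close> is at least 1 and can be extracted
  from both terms of \<open>h_all\<close>, leaving a constant independent of t.\<close>

lemma average_median:
  assumes p: "1 < p" and t: "0 < t" "t \<le> 1" and A: "0 \<le> A"
    and h_le: "\<And>v. 0 < v \<Longrightarrow> v \<le> t \<Longrightarrow> h v \<le> ennreal (A * v powr (- 1 / p))"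
  shows "\<bar>average M Q0 f - median\<bar> \<le> avg_const p * A * t powr (- 1 / p)"
proof -
  define q where "q = (2 :: real) powr (1 / p - 1)"
  define D where "D = K * A * (1 + m powr (- 1 / p)) * t powr (- 1 / p)"
  have q: "0 < q" "q < 1" using p by (auto simp: q_def powr_less_one)
  have D: "0 \<le> D" using K_pos A by (simp add: D_def)
  have t1: "1 \<le> t powr (- 1 / p)"
    using t p powr_mono2'[of "- 1 / p" t 1] by simp
  have h_all: "h v \<le> ennreal (A * (t powr (- 1 / p) + v powr (- 1 / p)))" if v: "0 < v" for v
  proof (cases "v \<le> t")
    case True
    have "h v \<le> ennreal (A * v powr (- 1 / p))" by (rule h_le[OF v True])
    also have "\<dots> \<le> ennreal (A * (t powr (- 1 / p) + v powr (- 1 / p)))"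
      using A by (intro ennreal_leI mult_left_mono) auto
    finally show ?thesis .
  next
    case False
    have "h v \<le> h t" using False by (intro h_antimono) auto
    also have "\<dots> \<le> ennreal (A * t powr (- 1 / p))" using t by (intro h_le) auto
    also have "\<dots> \<le> ennreal (A * (t powr (- 1 / p) + v powr (- 1 / p)))"
      using A by (intro ennreal_leI mult_left_mono) auto
    finally show ?thesis .
  qed
  have tm: "ennreal (m / 2 ^ k) * g median (m / 2 ^ Suc k) \<le> ennreal (8 * m * D * (real (Suc k) * q ^ k))" for k
  proof -
    define v where "v = m / 2 ^ (k + 2)"
    have v: "0 < v" using Q0_pos by (simp add: v_def)
    define w where "w = (2 :: real) powr (real (k + 2) / p)"
    have w1: "1 \<le> w" using p by (simp add: w_def ge_one_powr_ge_zero)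
    have "v = m * 2 powr (- real (k + 2))"
      by (simp only: v_def powr_minus powr_realpow divide_inverse zero_less_numeral)
    then have "v powr (- 1 / p) = m powr (- 1 / p) * (2 powr (- real (k + 2))) powr (- 1 / p)"
      using Q0_pos by (simp only: powr_mult)
    moreover have "- real (k + 2) * (- 1 / p) = real (k + 2) / p"
      using p by (simp add: field_simps)
    ultimately have vp: "v powr (- 1 / p) = m powr (- 1 / p) * w"
      by (simp only: powr_powr w_def)
    have "t powr (- 1 / p) + v powr (- 1 / p) \<le> t powr (- 1 / p) * w + t powr (- 1 / p) * (m powr (- 1 / p) * w)"
      unfolding vp
    proof (rule add_mono)
      show "t powr (- 1 / p) \<le> t powr (- 1 / p) * w"
        using mult_left_mono[OF w1, of "t powr (- 1 / p)"] by simp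
      have "0 \<le> m powr (- 1 / p) * w" using w1 by simp
      from mult_right_mono[OF t1 this]
      show "m powr (- 1 / p) * w \<le> t powr (- 1 / p) * (m powr (- 1 / p) * w)" by simp
    qed
    also have "\<dots> = (1 + m powr (- 1 / p)) * t powr (- 1 / p) * w" by (simp add: algebra_simps)
    finally have sum_le: "t powr (- 1 / p) + v powr (- 1 / p) \<le> (1 + m powr (- 1 / p)) * t powr (- 1 / p) * w" .
    \<comment> \<open>The growth 2^(k/p) of the weak-type bound at scale m/2^(k+2) is beaten by the
      measure 2^(-k), which leaves q^k; the shift by 2 costs 2^(2/p).\<close>
    have wq: "w / 2 ^ k \<le> 4 * q ^ k"
    proof -
      have "w = 2 powr (2 / p) * 2 powr (real k / p)"
        by (simp add: w_def powr_add[symmetric] add_divide_distrib add.commute)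
      moreover have "q ^ k = 2 powr (real k / p) / 2 ^ k"
        using q by (simp add: powr_realpow[symmetric] q_def powr_powr powr_diff[symmetric] algebra_simps)
      moreover have "(2 :: real) powr (2 / p) \<le> 2 powr 2" using p by (intro powr_mono) (auto simp: divide_le_eq)
      ultimately show ?thesis by (simp add: mult_right_mono divide_right_mono)
    qed
    have "ennreal (m / 2 ^ k) * g median (m / 2 ^ Suc k)
        \<le> ennreal (m / 2 ^ k) * (ennreal (K * real (k + 2)) * ennreal (A * ((1 + m powr (- 1 / p)) * t powr (- 1 / p) * w)))"
    proof (rule mult_left_mono)
      have "h v \<le> ennreal (A * ((1 + m powr (- 1 / p)) * t powr (- 1 / p) * w))"
        by (rule order_trans[OF h_all[OF v] ennreal_leI[OF mult_left_mono[OF sum_le A]]])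
      then have "ennreal (K * real (k + 2)) * h v
          \<le> ennreal (K * real (k + 2)) * ennreal (A * ((1 + m powr (- 1 / p)) * t powr (- 1 / p) * w))"
        by (rule mult_left_mono) simp
      with g_dyadic_le[of k] show "g median (m / 2 ^ Suc k)
          \<le> ennreal (K * real (k + 2)) * ennreal (A * ((1 + m powr (- 1 / p)) * t powr (- 1 / p) * w))"
        unfolding v_def by (rule order_trans)
    qed simp
    also have "\<dots> = ennreal (m / 2 ^ k * (K * real (k + 2) * (A * ((1 + m powr (- 1 / p)) * t powr (- 1 / p) * w))))"
    proof -
      have nn: "0 \<le> m / 2 ^ k" "0 \<le> K * real (k + 2)" using K_pos by auto
      show ?thesis by (simp only: ennreal_mult'[OF nn(1)] ennreal_mult'[OF nn(2)])
    qed
    also have "m / 2 ^ k * (K * real (k + 2) * (A * ((1 + m powr (- 1 / p)) * t powr (- 1 / p) * w)))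
        = m * D * (real (k + 2) * (w / 2 ^ k))"
      by (simp add: D_def field_simps)
    also have "ennreal \<dots> \<le> ennreal (m * D * ((2 * real (Suc k)) * (4 * q ^ k)))"
      using D q wq w1 by (intro ennreal_leI mult_left_mono mult_mono) auto
    also have "m * D * ((2 * real (Suc k)) * (4 * q ^ k)) = 8 * m * D * (real (Suc k) * q ^ k)"
      by simp
    finally show ?thesis .
  qed
  have sums: "(\<lambda>k. 8 * m * D * (real (Suc k) * q ^ k)) sums (8 * m * D * (1 / (1 - q)\<^sup>2))"
    using geometric_deriv_sums[of q] q by (intro sums_mult) (simp del: of_nat_Suc)
  have "(\<integral>\<^sup>+x\<in>Q0. ennreal \<bar>f x - median\<bar> \<partial>M)
      \<le> (\<Sum>k. ennreal (m / 2 ^ k) * rearrangement M Q0 (\<lambda>x. ennreal \<bar>f x - median\<bar>) (m / 2 ^ Suc k))"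
    by (rule nn_integral_le_rearrangement_sum[OF Q0_M Q0_pos f_level_sets])
  also have "\<dots> \<le> (\<Sum>k. ennreal (8 * m * D * (real (Suc k) * q ^ k)))"
    using tm by (intro suminf_le) (auto simp: g_def)
  also have "\<dots> = ennreal (8 * m * D * (1 / (1 - q)\<^sup>2))"
    using sums D q by (intro suminf_ennreal_eq) auto
  also have "8 * m * D * (1 / (1 - q)\<^sup>2) = m * (avg_const p * A * t powr (- 1 / p))"
    by (simp add: D_def avg_const_def q_def field_simps)
  finally show ?thesis
    using K_pos A by (intro average_diff_le[OF Q0_M Q0_pos f]) (auto simp: avg_const_def)
qed

lemma rearrangement_average_le:
  assumes "0 \<le> b" "\<bar>average M Q0 f - median\<bar> \<le> b"
  shows "rearrangement M Q0 (\<lambda>x. ennreal \<bar>f x - average M Q0 f\<bar>) u \<le> g median u + ennreal b"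
proof (cases "g median u")
  case (real a)
  have "{x \<in> Q0. ennreal \<bar>f x - median\<bar> > ennreal a} \<in> sets M"
    by (rule f_level_sets) (use real in auto)
  then have "emeasure M {x \<in> Q0. ennreal \<bar>f x - average M Q0 f\<bar> > ennreal (a + b)}
      \<le> emeasure M {x \<in> Q0. ennreal \<bar>f x - median\<bar> > ennreal a}"
  proof (rule emeasure_mono[rotated])
    show "{x \<in> Q0. ennreal \<bar>f x - average M Q0 f\<bar> > ennreal (a + b)}
        \<subseteq> {x \<in> Q0. ennreal \<bar>f x - median\<bar> > ennreal a}"
      unfolding f_level_ennreal[OF real(1)] f_level_ennreal[OF add_nonneg_nonneg[OF real(1) assms(1)]]
      using assms(2) by (intro Collect_mono) linarith
  qed
  also have "\<dots> \<le> ennreal u"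
    using emeasure_rearrangement_level(2)[OF f_level_sets[where c = median], of u] real(2)
    unfolding g_def by simp
  finally have "rearrangement M Q0 (\<lambda>x. ennreal \<bar>f x - average M Q0 f\<bar>) u \<le> ennreal (a + b)"
    using assms real by (intro rearrangement_le) auto
  then show ?thesis using real assms by simp
qed simp

end

subsection \<open>Lorentz functionals\<close>

lemma enn_powr_0 [simp]: "enn_powr 0 a = 0"
  by (simp add: enn_powr_def)

lemma enn_powr_top [simp]: "enn_powr top a = top"
  by (simp add: enn_powr_def)

lemma enn_powr_ennreal: "0 \<le> x \<Longrightarrow> enn_powr (ennreal x) a = ennreal (x powr a)"
  by (simp add: enn_powr_def)

lemma enn_powr_mono: "0 < a \<Longrightarrow> x \<le> y \<Longrightarrow> enn_powr x a \<le> enn_powr y a"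
  by (cases x; cases y) (auto simp: enn_powr_ennreal top_unique intro!: ennreal_leI powr_mono2)

lemma enn_powr_mult: "0 < a \<Longrightarrow> enn_powr (x * y) a = enn_powr x a * enn_powr y a"
proof (cases x; cases y)
  fix b assume a: "0 < a" and "x = top" "0 \<le> b" "y = ennreal b"
  then show ?thesis
    by (cases "b = 0") (auto simp: ennreal_top_mult enn_powr_ennreal)
next
  fix b assume a: "0 < a" and "y = top" "0 \<le> b" "x = ennreal b"
  then show ?thesis
    by (cases "b = 0") (auto simp: ennreal_mult_top enn_powr_ennreal)
qed (auto simp: enn_powr_ennreal ennreal_mult[symmetric] powr_mult ennreal_top_mult)

lemma enn_powr_inverse: "0 < a \<Longrightarrow> enn_powr (enn_powr x a) (1 / a) = x"
  by (cases x) (auto simp: enn_powr_ennreal powr_powr)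

lemma enn_powr_inverse': "0 < a \<Longrightarrow> enn_powr (enn_powr x (1 / a)) a = x"
  by (cases x) (auto simp: enn_powr_ennreal powr_powr)

text \<open>Bounding the sum by twice the maximum works for convex and concave powers alike, so r <
  1 needs no separate treatment.\<close>

lemma enn_powr_add_le:
  assumes a: "0 < a"
  shows "enn_powr (x + y) a \<le> ennreal (2 powr a) * (enn_powr x a + enn_powr y a)"
proof -
  have "enn_powr (x + y) a \<le> enn_powr (2 * max x y) a"
    using a by (intro enn_powr_mono) (auto simp: mult_2 intro: add_mono)
  also have "\<dots> = ennreal (2 powr a) * enn_powr (max x y) a"
    using enn_powr_ennreal[of 2 a] a by (simp add: enn_powr_mult)
  also have "enn_powr (max x y) a \<le> enn_powr x a + enn_powr y a"
    by (auto simp: max_def)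
  finally show ?thesis by (simp add: mult_left_mono)
qed

lemma enn_powr_measurable [measurable]:
  assumes [measurable]: "f \<in> borel_measurable M"
  shows "(\<lambda>x. enn_powr (f x) a) \<in> borel_measurable M"
proof -
  have "{x \<in> space M. f x = \<infinity>} = f -` {\<infinity>} \<inter> space M" by auto
  also have "\<dots> \<in> sets M" by (rule measurable_sets[OF assms]) simp
  finally have "{x \<in> space M. f x = \<infinity>} \<in> sets M" .
  then show ?thesis unfolding enn_powr_def by (intro measurable_If) (auto intro!: measurable_compose[OF assms])
qed

text \<open>Stands in for Minkowski's inequality and holds for every a > 0: each \<open>b k\<close>
  is at most the l^a quasi-norm of the sequence, and the geometric weights are summable.\<close>

lemma enn_powr_geometric_sum_le:
  assumes a: "0 < a" and q: "0 < q" "q < 1"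
  shows "enn_powr (\<Sum>k. ennreal (q ^ k) * b k) a \<le> ennreal ((1 / (1 - q)) powr a) * (\<Sum>k. enn_powr (b k) a)"
proof -
  define \<sigma> where "\<sigma> = (\<Sum>k. enn_powr (b k) a)"
  have b: "b k \<le> enn_powr \<sigma> (1 / a)" for k
  proof -
    have "enn_powr (b k) a \<le> \<sigma>"
      using sum_le_suminf[OF summableI, of "{k}" "\<lambda>k. enn_powr (b k) a"] by (simp add: \<sigma>_def)
    then have "enn_powr (enn_powr (b k) a) (1 / a) \<le> enn_powr \<sigma> (1 / a)"
      using a by (intro enn_powr_mono) auto
    then show ?thesis using a by (simp add: enn_powr_inverse)
  qed
  have "(\<Sum>k. ennreal (q ^ k) * b k) \<le> (\<Sum>k. ennreal (q ^ k) * enn_powr \<sigma> (1 / a))"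
    using b by (intro suminf_le mult_left_mono) auto
  also have "\<dots> = ennreal (1 / (1 - q)) * enn_powr \<sigma> (1 / a)"
  proof -
    have "(\<lambda>k. q ^ k) sums (1 / (1 - q))" using q by (intro geometric_sums) auto
    then have "(\<Sum>k. ennreal (q ^ k)) = ennreal (1 / (1 - q))"
      using q by (intro suminf_ennreal_eq) auto
    then show ?thesis by (simp only: ennreal_suminf_multc)
  qed
  finally have "enn_powr (\<Sum>k. ennreal (q ^ k) * b k) a \<le> enn_powr (ennreal (1 / (1 - q)) * enn_powr \<sigma> (1 / a)) a"
    using a by (intro enn_powr_mono) auto
  also have "\<dots> = ennreal ((1 / (1 - q)) powr a) * \<sigma>"
    using a q by (simp add: enn_powr_mult enn_powr_inverse' enn_powr_ennreal)
  finally show ?thesis by (simp add: \<sigma>_def)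
qed

text \<open>Superlevel sets of an antitone function are downward closed, hence empty, a ray, or the
  whole line.\<close>

lemma antimono_ennreal_measurable:
  fixes h :: "real \<Rightarrow> ennreal"
  assumes "antimono h"
  shows "h \<in> borel_measurable borel"
proof (rule borel_measurableI_greater)
  fix y
  define D where "D = {u. y < h u}"
  have down: "u \<in> D" if "v \<in> D" "u \<le> v" for u v
    using that antimonoD[OF assms] unfolding D_def by (blast intro: less_le_trans)
  have "D \<in> sets borel"
  proof (cases "D = {} \<or> \<not> bdd_above D")
    case True
    then have "D = {} \<or> D = UNIV"
      using down unfolding bdd_above_def by (metis UNIV_eq_I linear)
    then show ?thesis by auto
  next
    case False
    have 1: "u \<in> D" if "u < Sup D" for u
      using less_cSupD[of D u] that False down less_imp_le by blast
    have 2: "u \<le> Sup D" if "u \<in> D" for u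
      using False cSup_upper[OF that] by blast
    have "D = {..<Sup D} \<or> D = {..Sup D}"
    proof (cases "Sup D \<in> D")
      case True
      then have "D = {..Sup D}" using down 2 by auto
      then show ?thesis ..
    next
      case False
      then have "D = {..<Sup D}" using 1 2 by (auto simp: less_le)
      then show ?thesis ..
    qed
    then show ?thesis by (metis atMost_borel lessThan_borel)
  qed
  then show "{x \<in> space borel. y < h x} \<in> sets borel" by (simp add: D_def)
qed

text \<open>\<open>lorentz_functional\<close> carries no outer root, so it is homogeneous of degree
  r for finite r and of degree 1 for the supremum. \<open>rpow\<close>, \<open>rpow_const\<close>
  and \<open>rroot\<close> express this degree and its inverse uniformly in r.\<close>

definition rpow :: "ennreal \<Rightarrow> ennreal \<Rightarrow> ennreal" where
  "rpow r x = (if r = \<infinity> then x else enn_powr x (enn2real r))"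

definition rpow_const :: "ennreal \<Rightarrow> real \<Rightarrow> real" where
  "rpow_const r x = (if r = \<infinity> then x else x powr enn2real r)"

definition rroot :: "ennreal \<Rightarrow> ennreal \<Rightarrow> ennreal" where
  "rroot r x = (if r = \<infinity> then x else enn_powr x (1 / enn2real r))"

lemma enn2real_pos: "0 < r \<Longrightarrow> r \<noteq> \<infinity> \<Longrightarrow> 0 < enn2real r"
  by (simp add: enn2real_positive_iff top.not_eq_extremum)

lemma rpow_mono: "0 < r \<Longrightarrow> x \<le> y \<Longrightarrow> rpow r x \<le> rpow r y"
  using enn2real_pos[of r] by (auto simp: rpow_def intro: enn_powr_mono)

lemma rpow_mult: "0 < r \<Longrightarrow> rpow r (x * y) = rpow r x * rpow r y"
  using enn2real_pos[of r] by (auto simp: rpow_def enn_powr_mult)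

lemma rpow_ennreal: "0 \<le> x \<Longrightarrow> rpow r (ennreal x) = ennreal (rpow_const r x)"
  by (auto simp: rpow_def rpow_const_def enn_powr_ennreal)

lemma rpow_const_pos: "0 < x \<Longrightarrow> 0 < rpow_const r x"
  by (auto simp: rpow_const_def)

lemma rpow_rroot: "0 < r \<Longrightarrow> rpow r (rroot r x) = x"
  using enn2real_pos[of r] by (auto simp: rpow_def rroot_def enn_powr_inverse')

lemma rroot_rpow: "0 < r \<Longrightarrow> rroot r (rpow r x) = x"
  using enn2real_pos[of r] by (auto simp: rpow_def rroot_def enn_powr_inverse)

lemma rroot_mono: "0 < r \<Longrightarrow> x \<le> y \<Longrightarrow> rroot r x \<le> rroot r y"
  using enn2real_pos[of r] by (auto simp: rroot_def intro: enn_powr_mono)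

lemma rroot_finite: "x < \<infinity> \<Longrightarrow> rroot r x < \<infinity>"
  by (cases x) (auto simp: rroot_def enn_powr_ennreal)

lemma lorentz_mono:
  assumes r: "0 < r" and T: "T \<le> T'" and le: "\<And>u. 0 < u \<Longrightarrow> u < T \<Longrightarrow> h1 u \<le> h2 u"
  shows "lorentz_functional p r T h1 \<le> lorentz_functional p r T' h2"
proof (cases "r = \<infinity>")
  case True
  then show ?thesis
    unfolding lorentz_functional_def using T le
    by (auto intro!: SUP_subset_mono mult_left_mono)
next
  case False
  have "enn_powr (ennreal (u powr (1 / p)) * h1 u) (enn2real r) * ennreal (1 / u) * indicator {0<..<T} u
      \<le> enn_powr (ennreal (u powr (1 / p)) * h2 u) (enn2real r) * ennreal (1 / u) * indicator {0<..<T'} u" for u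
  proof (cases "u \<in> {0<..<T}")
    case True
    then show ?thesis
      using T le[of u] enn2real_pos[OF r False]
      by (auto intro!: mult_right_mono enn_powr_mono mult_left_mono)
  qed simp
  then show ?thesis
    using False unfolding lorentz_functional_def by (auto intro!: nn_integral_mono)
qed

lemma lorentz_add:
  assumes r: "0 < r" and [measurable]: "h1 \<in> borel_measurable borel" "h2 \<in> borel_measurable borel"
  shows "lorentz_functional p r T (\<lambda>u. h1 u + h2 u)
    \<le> ennreal (rpow_const r 2) * (lorentz_functional p r T h1 + lorentz_functional p r T h2)"
proof (cases "r = \<infinity>")
  case True
  define N where "N = (\<lambda>h. SUP u\<in>{0<..<T}. ennreal (u powr (1 / p)) * (h u :: ennreal))"
  have "ennreal (u powr (1 / p)) * (h1 u + h2 u) \<le> N h1 + N h2" if "u \<in> {0<..<T}" for u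
    unfolding N_def distrib_left using that by (intro add_mono SUP_upper)
  then have "N (\<lambda>u. h1 u + h2 u) \<le> 1 * (N h1 + N h2)"
    unfolding N_def[THEN fun_cong, of "\<lambda>u. h1 u + h2 u"] mult_1 by (rule SUP_least)
  also have "\<dots> \<le> ennreal 2 * (N h1 + N h2)" by (rule mult_right_mono) auto
  finally show ?thesis
    unfolding lorentz_functional_def rpow_const_def if_P[OF True] N_def .
next
  case False
  define s where "s = enn2real r"
  have s: "0 < s" unfolding s_def by (rule enn2real_pos[OF r False])
  define F where "F = (\<lambda>h u. enn_powr (ennreal (u powr (1 / p)) * h u) s * ennreal (1 / u) * indicator {0<..<T} u)"
  have m: "F h1 \<in> borel_measurable lborel" "F h2 \<in> borel_measurable lborel"
    unfolding F_def by measurable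
  have le: "F (\<lambda>u. h1 u + h2 u) u \<le> ennreal (2 powr s) * (F h1 u + F h2 u)" for u
  proof -
    have "enn_powr (ennreal (u powr (1 / p)) * (h1 u + h2 u)) s * (ennreal (1 / u) * indicator {0<..<T} u)
      \<le> (ennreal (2 powr s) * (enn_powr (ennreal (u powr (1 / p)) * h1 u) s + enn_powr (ennreal (u powr (1 / p)) * h2 u) s))
        * (ennreal (1 / u) * indicator {0<..<T} u)"
      unfolding distrib_left[of "ennreal (u powr (1 / p))"] by (rule mult_right_mono[OF enn_powr_add_le[OF s]]) simp
    then show ?thesis by (simp add: F_def algebra_simps)
  qed
  have "(\<integral>\<^sup>+u. F (\<lambda>u. h1 u + h2 u) u \<partial>lborel) \<le> (\<integral>\<^sup>+u. ennreal (2 powr s) * (F h1 u + F h2 u) \<partial>lborel)"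
    using le by (intro nn_integral_mono)
  also have "\<dots> = ennreal (2 powr s) * ((\<integral>\<^sup>+u. F h1 u \<partial>lborel) + (\<integral>\<^sup>+u. F h2 u \<partial>lborel))"
    using m by (simp add: nn_integral_cmult nn_integral_add)
  finally show ?thesis
    using False by (simp add: lorentz_functional_def rpow_const_def F_def s_def)
qed

lemma lorentz_cmult:
  assumes r: "0 < r" and K: "0 \<le> K" and [measurable]: "h \<in> borel_measurable borel"
  shows "lorentz_functional p r T (\<lambda>u. ennreal K * h u) \<le> ennreal (rpow_const r K) * lorentz_functional p r T h"
proof (cases "r = \<infinity>")
  case True
  have "(SUP u\<in>{0<..<T}. ennreal (u powr (1 / p)) * (ennreal K * h u))
      \<le> ennreal K * (SUP u\<in>{0<..<T}. ennreal (u powr (1 / p)) * h u)"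
  proof (rule SUP_least)
    fix u assume u: "u \<in> {0<..<T}"
    have "ennreal K * (ennreal (u powr (1 / p)) * h u) \<le> ennreal K * (SUP u\<in>{0<..<T}. ennreal (u powr (1 / p)) * h u)"
      using u by (intro mult_left_mono SUP_upper) auto
    then show "ennreal (u powr (1 / p)) * (ennreal K * h u) \<le> ennreal K * (SUP u\<in>{0<..<T}. ennreal (u powr (1 / p)) * h u)"
      by (simp add: mult_ac)
  qed
  then show ?thesis using True by (simp add: lorentz_functional_def rpow_const_def)
next
  case False
  define s where "s = enn2real r"
  have s: "0 < s" unfolding s_def by (rule enn2real_pos[OF r False])
  define F where "F = (\<lambda>h u. enn_powr (ennreal (u powr (1 / p)) * h u) s * ennreal (1 / u) * indicator {0<..<T} u)"
  have m: "F h \<in> borel_measurable lborel" unfolding F_def by measurable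
  have "F (\<lambda>u. ennreal K * h u) u = ennreal (K powr s) * F h u" for u
    using s K by (simp add: F_def enn_powr_mult enn_powr_ennreal mult_ac)
  then have "(\<integral>\<^sup>+u. F (\<lambda>u. ennreal K * h u) u \<partial>lborel) = ennreal (K powr s) * (\<integral>\<^sup>+u. F h u \<partial>lborel)"
    using m by (simp add: nn_integral_cmult)
  then show ?thesis
    using False by (simp add: lorentz_functional_def rpow_const_def F_def s_def)
qed

lemma nn_integral_powr_le:
  assumes a: "0 < a" and T: "0 \<le> T"
  shows "(\<integral>\<^sup>+u. ennreal (u powr (a - 1)) * indicator {0<..<T} u \<partial>lborel) \<le> ennreal (T powr a / a)"
proof -
  have "((\<lambda>u. u powr (a - 1)) has_integral (T powr (a - 1 + 1) / (a - 1 + 1))) {0..T}"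
    using a T by (intro has_integral_powr_from_0) auto
  then have "(\<integral>\<^sup>+u. ennreal (u powr (a - 1)) * indicator {0..T} u \<partial>lborel) = ennreal (T powr a / a)"
    using nn_integral_has_integral_lebesgue[of "{0..T}" "\<lambda>u. u powr (a - 1)"] a
    by (simp add: ennreal_mult' ennreal_indicator mult.commute)
  moreover have "(\<integral>\<^sup>+u. ennreal (u powr (a - 1)) * indicator {0<..<T} u \<partial>lborel)
      \<le> (\<integral>\<^sup>+u. ennreal (u powr (a - 1)) * indicator {0..T} u \<partial>lborel)"
    by (intro nn_integral_mono) (auto simp: indicator_def)
  ultimately show ?thesis by simp
qed

text \<open>The integral of u^(r/p - 1) over (0, T) is p/r times T^(r/p); \<open>lconst\<close> is
  this factor, or 1 for the supremum.\<close>

definition lconst :: "real \<Rightarrow> ennreal \<Rightarrow> real" where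
  "lconst p r = (if r = \<infinity> then 1 else p / enn2real r)"

text \<open>A power u^(-e) merely changes the weight exponent 1/p to 1/p - e, so it behaves like a
  constant for another p. The case e = 0 serves constants; a positive e serves the membership of the
  logarithm in the Lorentz space.\<close>

lemma lorentz_powr_le:
  assumes p: "0 < p" and r: "0 < r" and b: "0 \<le> b" and T: "0 \<le> T"
    and e: "e < 1 / p"
  shows "lorentz_functional p r T (\<lambda>u. ennreal (b * u powr (- e)))
    \<le> ennreal (lconst (1 / (1 / p - e)) r * rpow_const r (b * T powr (1 / p - e)))"
proof (cases "r = \<infinity>")
  case True
  have "(SUP u\<in>{0<..<T}. ennreal (u powr (1 / p)) * ennreal (b * u powr (- e))) \<le> ennreal (b * T powr (1 / p - e))"
  proof (rule SUP_least)
    fix u assume u: "u \<in> {0<..<T}"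
    have "u powr (1 / p) * (b * u powr (- e)) = b * u powr (1 / p - e)"
      using u by (simp add: powr_add[symmetric])
    also have "\<dots> \<le> b * T powr (1 / p - e)"
      using u e b by (intro mult_left_mono powr_mono2) auto
    finally show "ennreal (u powr (1 / p)) * ennreal (b * u powr (- e)) \<le> ennreal (b * T powr (1 / p - e))"
      using b by (simp add: ennreal_mult[symmetric] ennreal_leI)
  qed
  then show ?thesis using True by (simp add: lorentz_functional_def rpow_const_def lconst_def)
next
  case False
  define s where "s = enn2real r"
  have s: "0 < s" unfolding s_def by (rule enn2real_pos[OF r False])
  define d where "d = 1 / p - e"
  have d: "0 < d" using e by (simp add: d_def)
  have eq: "enn_powr (ennreal (u powr (1 / p)) * ennreal (b * u powr (- e))) s * ennreal (1 / u) * indicator {0<..<T} u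
      = ennreal (b powr s) * (ennreal (u powr (d * s - 1)) * indicator {0<..<T} u)" for u
  proof (cases "u \<in> {0<..<T}")
    case True
    then have u: "0 < u" by simp
    have "u powr (1 / p) * (b * u powr (- e)) = b * u powr d"
      using u by (simp add: powr_add[symmetric] d_def)
    then have "ennreal (u powr (1 / p)) * ennreal (b * u powr (- e)) = ennreal (b * u powr d)"
      using b by (metis ennreal_mult mult_nonneg_nonneg powr_ge_zero)
    then have "enn_powr (ennreal (u powr (1 / p)) * ennreal (b * u powr (- e))) s = ennreal (b powr s * u powr (d * s))"
      using b by (simp only: enn_powr_ennreal powr_mult powr_powr mult_nonneg_nonneg powr_ge_zero)
    moreover have "u powr (d * s) * (1 / u) = u powr (d * s - 1)"
      using u by (simp add: powr_diff)
    ultimately show ?thesis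
      using True by (simp add: ennreal_mult[symmetric] times_divide_eq_right[symmetric] del: times_divide_eq_right)
  qed simp
  have "(\<integral>\<^sup>+u. ennreal (b powr s) * (ennreal (u powr (d * s - 1)) * indicator {0<..<T} u) \<partial>lborel)
      = ennreal (b powr s) * (\<integral>\<^sup>+u. ennreal (u powr (d * s - 1)) * indicator {0<..<T} u \<partial>lborel)"
    by (intro nn_integral_cmult) measurable
  also have "\<dots> \<le> ennreal (b powr s) * ennreal (T powr (d * s) / (d * s))"
    using d s T by (intro mult_left_mono nn_integral_powr_le) auto
  also have "\<dots> = ennreal (1 / d / s * (b * T powr d) powr s)"
    using b d s by (simp add: ennreal_mult[symmetric] powr_mult powr_powr)
  finally show ?thesis
    using False unfolding lorentz_functional_def
    by (simp add: eq s_def[symmetric] d_def[symmetric] lconst_def rpow_const_def)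
qed

text \<open>The embedding into weak L_p. On (v/2, v) the antitone \<open>h\<close> is at least
  \<open>h v\<close> and 1/u is at least 1/v; the interval has length v/2, which loses the factor
  2.\<close>

lemma rpow_le_lorentz:
  assumes p: "0 < p" and r: "0 < r" and h: "antimono h" and v: "0 < v" "v \<le> t"
  shows "rpow r (ennreal ((v / 2) powr (1 / p)) * h v) \<le> 2 * lorentz_functional p r t h"
proof (cases "r = \<infinity>")
  case True
  \<comment> \<open>The value v = t is allowed but lies outside the open range of the supremum, so
    the supremum is tested at v/2.\<close>
  have "ennreal ((v / 2) powr (1 / p)) * h v \<le> ennreal ((v / 2) powr (1 / p)) * h (v / 2)"
    using antimonoD[OF h, of "v / 2" v] v by (intro mult_left_mono) auto
  also have "\<dots> \<le> (SUP u\<in>{0<..<t}. ennreal (u powr (1 / p)) * h u)"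
    using v by (intro SUP_upper) auto
  also have "\<dots> \<le> 2 * \<dots>" by (simp add: mult_2)
  finally show ?thesis using True by (simp add: rpow_def lorentz_functional_def)
next
  case False
  define s where "s = enn2real r"
  have s: "0 < s" unfolding s_def by (rule enn2real_pos[OF r False])
  define x where "x = enn_powr (ennreal ((v / 2) powr (1 / p)) * h v) s"
  have "x * ennreal (1 / 2) = x * ennreal (1 / v) * ennreal (v / 2)"
    using v by (simp add: mult.assoc ennreal_mult[symmetric])
  also have "\<dots> = (\<integral>\<^sup>+u. x * ennreal (1 / v) * indicator {v / 2<..<v} u \<partial>lborel)"
    using v by (subst nn_integral_cmult_indicator) auto
  also have "\<dots> \<le> (\<integral>\<^sup>+u. enn_powr (ennreal (u powr (1 / p)) * h u) s * ennreal (1 / u) * indicator {0<..<t} u \<partial>lborel)"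
  proof (rule nn_integral_mono)
    fix u
    show "x * ennreal (1 / v) * indicator {v / 2<..<v} u
      \<le> enn_powr (ennreal (u powr (1 / p)) * h u) s * ennreal (1 / u) * indicator {0<..<t} u"
    proof (cases "u \<in> {v / 2<..<v}")
      case True
      then have "x * ennreal (1 / v) \<le> enn_powr (ennreal (u powr (1 / p)) * h u) s * ennreal (1 / u)"
        unfolding x_def using v p s antimonoD[OF h, of u v]
        by (intro mult_mono enn_powr_mono ennreal_leI powr_mono2) (auto intro: divide_left_mono)
      then show ?thesis using True v by auto
    qed simp
  qed
  also have "\<dots> = lorentz_functional p r t h"
    using False by (simp add: lorentz_functional_def s_def)
  finally have "x * ennreal (1 / 2) \<le> lorentz_functional p r t h" .
  then have "2 * (x * ennreal (1 / 2)) \<le> 2 * lorentz_functional p r t h" by (rule mult_left_mono) simp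
  moreover have "2 * (x * ennreal (1 / 2)) = x"
  proof -
    have "2 * (x * ennreal (1 / 2)) = x * (ennreal 2 * ennreal (1 / 2))" by (simp add: mult_ac)
    also have "ennreal 2 * ennreal (1 / 2) = 1" by (subst ennreal_mult[symmetric]) auto
    finally show ?thesis by simp
  qed
  ultimately show ?thesis using False by (simp add: rpow_def x_def s_def)
qed

text \<open>The measure du/u is invariant under dilation. The weight is left at the dilated
  argument, so that the power of 2 gained at each scale can be accounted for separately.\<close>

lemma lorentz_dilation:
  assumes r: "0 < r" "r \<noteq> \<infinity>" and c: "0 < c" and h [measurable]: "h \<in> borel_measurable borel"
  shows "(\<integral>\<^sup>+u. enn_powr (ennreal ((c * u) powr (1 / p)) * h (c * u)) (enn2real r) * ennreal (1 / u)
            * indicator {0<..<t} (c * u) \<partial>lborel) = lorentz_functional p r t h"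
proof -
  define G where "G = (\<lambda>v. enn_powr (ennreal (v powr (1 / p)) * h v) (enn2real r) * ennreal (1 / v) * indicator {0<..<t} v)"
  have [measurable]: "G \<in> borel_measurable borel" unfolding G_def by measurable
  have "lorentz_functional p r t h = (\<integral>\<^sup>+v. G v \<partial>lborel)"
    using r by (simp add: lorentz_functional_def G_def)
  also have "\<dots> = ennreal \<bar>c\<bar> * (\<integral>\<^sup>+u. G (0 + c * u) \<partial>lborel)"
    using c by (intro nn_integral_real_affine) auto
  also have "\<dots> = (\<integral>\<^sup>+u. ennreal c * G (c * u) \<partial>lborel)"
    using c by (subst nn_integral_cmult) auto
  also have "\<dots> = (\<integral>\<^sup>+u. enn_powr (ennreal ((c * u) powr (1 / p)) * h (c * u)) (enn2real r) * ennreal (1 / u)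
            * indicator {0<..<t} (c * u) \<partial>lborel)"
  proof (rule nn_integral_cong)
    fix u
    have "ennreal c * ennreal (1 / (c * u)) = ennreal (1 / u)" if "0 < c * u"
      using c that by (simp add: ennreal_mult[symmetric] zero_less_mult_iff)
    then show "ennreal c * G (c * u) = enn_powr (ennreal ((c * u) powr (1 / p)) * h (c * u)) (enn2real r) * ennreal (1 / u)
            * indicator {0<..<t} (c * u)"
    proof (cases "c * u \<in> {0<..<t}")
      case True
      define Z where "Z = enn_powr (ennreal ((c * u) powr (1 / p)) * h (c * u)) (enn2real r)"
      have "ennreal c * (Z * ennreal (1 / (c * u))) = Z * (ennreal c * ennreal (1 / (c * u)))"
        by (simp only: mult_ac)
      also have "\<dots> = Z * ennreal (1 / u)"
        using True \<open>0 < c * u \<Longrightarrow> ennreal c * ennreal (1 / (c * u)) = ennreal (1 / u)\<close> by auto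
      finally show ?thesis using True by (simp add: G_def Z_def)
    qed (simp add: G_def)
  qed
  finally show ?thesis by simp
qed

section \<open>A discrete Hardy inequality for the scales below t\<close>

definition dyadic_sum :: "real \<Rightarrow> (real \<Rightarrow> ennreal) \<Rightarrow> real \<Rightarrow> ennreal" where
  "dyadic_sum t h u = (\<Sum>k. h (2 ^ k * u / 2) * indicator {0<..<t} (2 ^ k * u / 2))"

lemma dyadic_sum_measurable [measurable]:
  assumes [measurable]: "h \<in> borel_measurable borel"
  shows "dyadic_sum t h \<in> borel_measurable borel"
  unfolding dyadic_sum_def[abs_def] by measurable

text \<open>Moving the weight from u to 2^k u/2 yields 2^(1/p) times 2^(-k/p), which is q^(2k). One
  factor q^k pays for summing inside the power, giving 1/(1 - q); the other sums the scales outside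
  it, giving 1/(1 - q^r).\<close>

definition hardy_const :: "real \<Rightarrow> ennreal \<Rightarrow> real" where
  "hardy_const p r = (let q = 2 powr (- 1 / (2 * p)) in
     rpow_const r (2 powr (1 / p)) * rpow_const r (1 / (1 - q)) * (1 / (1 - rpow_const r q)))"

text \<open>Every scale contributes the same functional by dilation invariance, and the gain in the
  weight makes the scales summable. Truncation at t inside the sum keeps the right-hand side an
  expression over (0, t), whatever T is.\<close>

lemma lorentz_dyadic_sum:
  assumes p: "0 < p" and r: "0 < r" and h [measurable]: "h \<in> borel_measurable borel"
  shows "lorentz_functional p r T (dyadic_sum t h) \<le> ennreal (hardy_const p r) * lorentz_functional p r t h"
    and "0 < hardy_const p r"
proof -
  define q where "q = (2 :: real) powr (- 1 / (2 * p))"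
  have q: "0 < q" "q < 1" using p by (auto simp: q_def powr_less_one)
  have hc: "hardy_const p r = rpow_const r (2 powr (1 / p)) * rpow_const r (1 / (1 - q)) * (1 / (1 - rpow_const r q))"
    by (simp only: hardy_const_def Let_def q_def)
  have rq: "0 < rpow_const r q" "rpow_const r q < 1"
  proof -
    show "0 < rpow_const r q" using q(1) by (rule rpow_const_pos)
    show "rpow_const r q < 1"
      using q enn2real_pos[OF r] powr_less_mono2[of "enn2real r" q 1] by (auto simp: rpow_const_def)
  qed
  show "0 < hardy_const p r"
    using q rq unfolding hc
    by (intro mult_pos_pos divide_pos_pos rpow_const_pos) auto
  define a where "a = (\<lambda>k u. ennreal ((2 ^ k / 2 * u) powr (1 / p)) * h (2 ^ k / 2 * u) * indicator {0<..<t} (2 ^ k / 2 * u))"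
  define b where "b = (\<lambda>k u. ennreal (q ^ k) * a k u)"
  have weight: "ennreal (u powr (1 / p)) * dyadic_sum t h u
      = ennreal (2 powr (1 / p)) * (\<Sum>k. ennreal (q ^ k) * b k u)" if u: "0 < u" for u
  proof -
    have W: "u powr (1 / p) = 2 powr (1 / p) * (q ^ k * q ^ k) * (2 ^ k / 2 * u) powr (1 / p)" for k
    proof -
      have "q ^ k * q ^ k = 2 powr (- real k / p)"
        using q by (simp add: q_def powr_realpow[symmetric] powr_powr powr_add[symmetric] field_simps)
      moreover have "(2 ^ k / 2 * u) powr (1 / p) = 2 powr (real k / p) * u powr (1 / p) / 2 powr (1 / p)"
        using u by (simp add: powr_mult powr_divide powr_realpow[symmetric] powr_powr)
      ultimately show ?thesis by (simp add: powr_minus field_simps)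
    qed
    have "ennreal (u powr (1 / p)) * (h (2 ^ k * u / 2) * indicator {0<..<t} (2 ^ k * u / 2))
        = ennreal (2 powr (1 / p)) * (ennreal (q ^ k) * b k u)" for k
    proof -
      have "ennreal (u powr (1 / p)) = ennreal (2 powr (1 / p)) * (ennreal (q ^ k) * (ennreal (q ^ k) *
          ennreal ((2 ^ k / 2 * u) powr (1 / p))))"
        unfolding W[of k] using q by (simp add: ennreal_mult mult.assoc)
      moreover have "2 ^ k / 2 * u = 2 ^ k * u / 2" by simp
      ultimately show ?thesis by (simp only: a_def b_def mult.assoc)
    qed
    then show ?thesis
      unfolding dyadic_sum_def by (simp only: ennreal_suminf_cmult[symmetric])
  qed
  show "lorentz_functional p r T (dyadic_sum t h) \<le> ennreal (hardy_const p r) * lorentz_functional p r t h"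
  proof (cases "r = \<infinity>")
    case True
    define L where "L = lorentz_functional p r t h"
    have aL: "a k u \<le> L" for k u
    proof (cases "2 ^ k / 2 * u \<in> {0<..<t}")
      case mem: True
      have "ennreal ((2 ^ k / 2 * u) powr (1 / p)) * h (2 ^ k / 2 * u) \<le> (SUP u\<in>{0<..<t}. ennreal (u powr (1 / p)) * h u)"
        using mem by (rule SUP_upper)
      then show ?thesis using True mem by (simp add: a_def L_def lorentz_functional_def)
    qed (simp add: a_def)
    have qq1: "q * q < 1" using mult_strict_mono[of q 1 q 1] q by simp
    then have "(\<lambda>k. q ^ k * q ^ k) sums (1 / (1 - q * q))"
      using geometric_sums[of "q * q"] q by (simp add: power_mult_distrib)
    then have geo: "(\<Sum>k. ennreal (q ^ k * q ^ k)) = ennreal (1 / (1 - q * q))"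
      using q by (intro suminf_ennreal_eq) auto
    \<comment> \<open>For the supremum the factors q^(2k) are summed at once; the result 1/(1 - q^2)
      is enlarged to the product shape of the constant used for finite r.\<close>
    have const: "ennreal (2 powr (1 / p)) * (ennreal (1 / (1 - q * q)) * L) \<le> ennreal (hardy_const p r) * L"
    proof -
      have "q * q \<le> q" using q by (simp add: mult_left_le)
      have "1 / (1 - q * q) \<le> 1 / (1 - q)"
      proof (rule divide_left_mono)
        show "1 - q \<le> 1 - q * q" using \<open>q * q \<le> q\<close> by linarith
        show "0 < (1 - q * q) * (1 - q)" using \<open>q * q < 1\<close> q(2) by (intro mult_pos_pos) linarith+
      qed simp
      also have "\<dots> \<le> 1 / (1 - q) * (1 / (1 - q))"
      proof -
        have "1 \<le> 1 / (1 - q)" using q by simp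
        then show ?thesis using q mult_left_mono[of 1 "1 / (1 - q)" "1 / (1 - q)"] by simp
      qed
      finally have "2 powr (1 / p) * (1 / (1 - q * q)) \<le> 2 powr (1 / p) * (1 / (1 - q) * (1 / (1 - q)))"
        by (rule mult_left_mono) simp
      then have "2 powr (1 / p) * (1 / (1 - q * q)) \<le> hardy_const p r"
        unfolding hc rpow_const_def if_P[OF True] mult.assoc .
      then have "ennreal (2 powr (1 / p) * (1 / (1 - q * q))) * L \<le> ennreal (hardy_const p r) * L"
        by (intro mult_right_mono ennreal_leI) auto
      then show ?thesis by (simp only: ennreal_mult'[OF powr_ge_zero] mult.assoc)
    qed
    show ?thesis
      unfolding L_def[symmetric]
      unfolding lorentz_functional_def if_P[OF True]
    proof (rule SUP_least)
      fix u assume "u \<in> {0<..<T}"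
      then have u: "0 < u" by simp
      have "(\<Sum>k. ennreal (q ^ k) * b k u) = (\<Sum>k. ennreal (q ^ k * q ^ k) * a k u)"
        using q by (simp add: b_def ennreal_mult mult.assoc)
      also have "\<dots> \<le> (\<Sum>k. ennreal (q ^ k * q ^ k) * L)"
        by (intro suminf_le mult_left_mono aL) auto
      also have "\<dots> = ennreal (1 / (1 - q * q)) * L" by (simp only: ennreal_suminf_multc geo)
      finally show "ennreal (u powr (1 / p)) * dyadic_sum t h u \<le> ennreal (hardy_const p r) * L"
        unfolding weight[OF u] using const by (meson mult_left_mono order_trans zero_le)
    qed
  next
    case False
    define s where "s = enn2real r"
    have s: "0 < s" unfolding s_def by (rule enn2real_pos[OF r False])
    define D where "D = (2 powr (1 / p)) powr s * (1 / (1 - q)) powr s"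
    define J where "J = (\<lambda>k u. enn_powr (ennreal ((2 ^ k / 2 * u) powr (1 / p)) * h (2 ^ k / 2 * u)) s * ennreal (1 / u)
            * indicator {0<..<t} (2 ^ k / 2 * u))"
    have [measurable]: "J k \<in> borel_measurable lborel" for k unfolding J_def by measurable
    have J: "(\<integral>\<^sup>+u. J k u \<partial>lborel) = lorentz_functional p r t h" for k
      unfolding J_def s_def by (rule lorentz_dilation[OF r False _ h]) auto
    have bound: "enn_powr (ennreal (u powr (1 / p)) * dyadic_sum t h u) s * ennreal (1 / u) * indicator {0<..<T} u
        \<le> (\<Sum>k. ennreal (D * (q powr s) ^ k) * J k u)" for u
    proof (cases "u \<in> {0<..<T}")
      case True
      then have u: "0 < u" by simp
      have "enn_powr (ennreal (u powr (1 / p)) * dyadic_sum t h u) s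
          = ennreal ((2 powr (1 / p)) powr s) * enn_powr (\<Sum>k. ennreal (q ^ k) * b k u) s"
        unfolding weight[OF u] using s by (simp add: enn_powr_mult enn_powr_ennreal)
      also have "\<dots> \<le> ennreal ((2 powr (1 / p)) powr s) * (ennreal ((1 / (1 - q)) powr s) * (\<Sum>k. enn_powr (b k u) s))"
        using s q by (intro mult_left_mono enn_powr_geometric_sum_le) auto
      also have "\<dots> = ennreal D * (\<Sum>k. enn_powr (b k u) s)"
        by (simp add: D_def ennreal_mult mult.assoc)
      finally have "enn_powr (ennreal (u powr (1 / p)) * dyadic_sum t h u) s * ennreal (1 / u)
          \<le> ennreal D * (\<Sum>k. enn_powr (b k u) s) * ennreal (1 / u)" by (rule mult_right_mono) simp
      also have "\<dots> = (\<Sum>k. ennreal D * enn_powr (b k u) s * ennreal (1 / u))"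
        by (simp only: ennreal_suminf_cmult ennreal_suminf_multc)
      also have "\<dots> = (\<Sum>k. ennreal (D * (q powr s) ^ k) * J k u)"
      proof -
        have "enn_powr (b k u) s * ennreal (1 / u) = ennreal ((q powr s) ^ k) * J k u" for k
        proof -
          have "(q ^ k) powr s = (q powr s) ^ k"
            using q by (simp add: powr_realpow[symmetric] powr_powr mult.commute)
          moreover have "enn_powr 1 s = 1" by (simp add: enn_powr_def)
          ultimately show ?thesis
            using q s by (auto simp: b_def a_def J_def enn_powr_mult enn_powr_ennreal mult.assoc indicator_def)
        qed
        then show ?thesis
          unfolding mult.assoc by (simp add: D_def ennreal_mult mult.assoc)
      qed
      finally show ?thesis using True by simp
    qed simp
    have "lorentz_functional p r T (dyadic_sum t h)
        = (\<integral>\<^sup>+u. enn_powr (ennreal (u powr (1 / p)) * dyadic_sum t h u) s * ennreal (1 / u) * indicator {0<..<T} u \<partial>lborel)"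
      using False by (simp add: lorentz_functional_def s_def)
    also have "\<dots> \<le> (\<integral>\<^sup>+u. (\<Sum>k. ennreal (D * (q powr s) ^ k) * J k u) \<partial>lborel)"
      by (rule nn_integral_mono) (rule bound)
    also have "\<dots> = (\<Sum>k. ennreal (D * (q powr s) ^ k) * lorentz_functional p r t h)"
      by (simp add: nn_integral_suminf nn_integral_cmult J)
    also have "\<dots> = ennreal (D * (1 / (1 - q powr s))) * lorentz_functional p r t h"
    proof -
      have "(\<lambda>k. D * (q powr s) ^ k) sums (D * (1 / (1 - q powr s)))"
        using rq False by (intro sums_mult geometric_sums) (auto simp: rpow_const_def s_def)
      then have "(\<Sum>k. ennreal (D * (q powr s) ^ k)) = ennreal (D * (1 / (1 - q powr s)))"
        by (intro suminf_ennreal_eq) (auto simp: D_def)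
      then show ?thesis by (simp only: ennreal_suminf_multc)
    qed
    finally show ?thesis
      using False by (simp add: hc rpow_const_def s_def D_def)
  qed
qed

section \<open>The scales between t and m, and the logarithmic factor\<close>

definition tail_const :: "real \<Rightarrow> real" where
  "tail_const m = (\<bar>ln m\<bar> + 1) / ln 2 + 1"

lemma tail_const_pos: "0 < tail_const m"
  by (auto simp: tail_const_def intro!: add_nonneg_pos divide_nonneg_pos)

text \<open>Arguments of \<open>h\<close> below t go into \<open>dyadic_sum\<close>. From the first
  argument at or above t on, each doubling moves closer to m, where \<open>h\<close> vanishes, so
  about log2(m/t) terms remain, each at most \<open>h t\<close>.\<close>

lemma suminf_le_dyadic_sum:
  fixes h :: "real \<Rightarrow> ennreal"
  assumes h: "antimono h" and hz: "\<And>v. m \<le> v \<Longrightarrow> h v = 0" and m: "0 < m"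
    and t: "0 < t" "t < 1" and u: "0 < u"
  shows "(\<Sum>k. h (2 ^ k * u / 2)) \<le> dyadic_sum t h u + ennreal (tail_const m * (1 - ln t)) * h t"
proof -
  define P where "P = (\<lambda>k. t \<le> 2 ^ k * u / 2)"
  have Pmono: "P j" if "P k" "k \<le> j" for k j :: nat
  proof -
    have "(2 :: real) ^ k * u \<le> 2 ^ j * u" using that u by (intro mult_right_mono power_increasing) auto
    then show ?thesis using that by (simp add: P_def)
  qed
  obtain n where "2 * t / u < 2 ^ n" using real_arch_pow[of 2 "2 * t / u"] by auto
  then have "P n" using u by (simp add: P_def field_simps)
  then obtain k0 where k0: "P k0" "\<And>k. k < k0 \<Longrightarrow> \<not> P k"
    using exists_least_iff[of P] by blast
  \<comment> \<open>The maximum with 1 treats m \<le> t, where no term remains and \<open>J\<close>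
    is 0. Otherwise \<open>J\<close> is log2(m/t) rounded up; as ln t \<le> 0, this is at most a
    constant multiple of 1 - ln t, and \<open>tail_const\<close> is that multiple.\<close>
  define x where "x = log 2 (max 1 (m / t))"
  define J where "J = nat \<lceil>x\<rceil>"
  have x0: "0 \<le> x" by (simp add: x_def)
  have J: "x \<le> real J" "real J \<le> x + 1"
  proof -
    have "real J = of_int \<lceil>x\<rceil>" using x0 by (simp add: J_def)
    then show "x \<le> real J" "real J \<le> x + 1" by linarith+
  qed
  have "max 1 (m / t) = 2 powr x" by (simp add: x_def)
  also have "\<dots> \<le> 2 powr real J" using J by (intro powr_mono) auto
  also have "\<dots> = 2 ^ J" by (simp add: powr_realpow)
  finally have "m / t \<le> 2 ^ J" by simp
  then have mJ: "m \<le> 2 ^ J * t" using t by (simp add: field_simps)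
  have "x \<le> (\<bar>ln m\<bar> - ln t) / ln 2"
  proof -
    have "ln (max 1 (m / t)) \<le> \<bar>ln m\<bar> - ln t"
      using t m by (auto simp: max_def ln_div ln_le_zero_iff intro: order_trans[of _ 0])
    then show ?thesis by (simp add: x_def log_def divide_right_mono)
  qed
  also have "\<bar>ln m\<bar> - ln t \<le> (\<bar>ln m\<bar> + 1) * (1 - ln t)"
  proof -
    have "ln t \<le> 0" using t by simp
    then have "0 \<le> \<bar>ln m\<bar> * (- ln t)" by (intro mult_nonneg_nonneg) auto
    then show ?thesis by (simp add: algebra_simps)
  qed
  then have "(\<bar>ln m\<bar> - ln t) / ln 2 \<le> (\<bar>ln m\<bar> + 1) / ln 2 * (1 - ln t)"
    by (simp add: divide_right_mono)
  finally have "real J \<le> (\<bar>ln m\<bar> + 1) / ln 2 * (1 - ln t) + 1" using J by linarith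
  also have "\<dots> \<le> tail_const m * (1 - ln t)" using t by (simp add: tail_const_def algebra_simps)
  finally have J_le: "real J \<le> tail_const m * (1 - ln t)" .
  define g where "g = (\<lambda>k. h (2 ^ k * u / 2) * indicator {t..} (2 ^ k * u / 2))"
  have g0: "g k = 0" if "k \<notin> {k0..<k0 + J}" for k
  proof (cases "k < k0")
    case True
    then show ?thesis using k0(2)[OF True] by (simp add: g_def P_def indicator_def)
  next
    case False
    with that have k: "k0 + J \<le> k" by auto
    have "m \<le> 2 ^ J * (2 ^ k0 * u / 2)" using mJ k0(1) unfolding P_def
      by (meson mult_left_mono order_trans zero_le_numeral zero_le_power)
    also have "\<dots> = 2 ^ (k0 + J) * u / 2" by (simp add: power_add)
    also have "\<dots> \<le> 2 ^ k * u / 2"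
      using k u by (intro divide_right_mono mult_right_mono power_increasing) auto
    finally show ?thesis by (simp add: g_def hz)
  qed
  have "(\<Sum>k. g k) = (\<Sum>k\<in>{k0..<k0 + J}. g k)"
    by (rule suminf_finite) (simp, rule g0)
  also have "\<dots> \<le> (\<Sum>k\<in>{k0..<k0 + J}. h t)"
    by (intro sum_mono) (auto simp: g_def indicator_def intro: antimonoD[OF h])
  also have "\<dots> = ennreal (real J) * h t" by (simp add: ennreal_of_nat_eq_real_of_nat)
  also have "\<dots> \<le> ennreal (tail_const m * (1 - ln t)) * h t"
    by (intro mult_right_mono ennreal_leI J_le) auto
  finally have g_le: "(\<Sum>k. g k) \<le> ennreal (tail_const m * (1 - ln t)) * h t" .
  have "h (2 ^ k * u / 2) = h (2 ^ k * u / 2) * indicator {0<..<t} (2 ^ k * u / 2) + g k" for k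
    using u by (auto simp: g_def indicator_def)
  then have "(\<Sum>k. h (2 ^ k * u / 2)) = dyadic_sum t h u + (\<Sum>k. g k)"
    unfolding dyadic_sum_def by (subst suminf_add) auto
  then show ?thesis using g_le by (simp add: add_left_mono)
qed

definition log_bound_const :: "real \<Rightarrow> ennreal \<Rightarrow> real \<Rightarrow> real \<Rightarrow> real \<Rightarrow> real" where
  "log_bound_const p r m K a = rpow_const r 2 * (rpow_const r K * hardy_const p r
     + lconst p r * rpow_const r (K * tail_const m + a) * (rpow_const r (2 powr (1 / p)) * 2))"

text \<open>\<open>G\<close> will be the rearrangement of \<open>f\<close> minus its mean. The
  hypothesis on \<open>G\<close> quantifies over \<open>A\<close> because the gap between mean and
  median is bounded by a weak-type constant of \<open>h\<close>, which is extracted from the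
  right-hand functional only inside the proof.\<close>

lemma
  assumes p: "1 < p" and r: "0 < r" and K: "0 < K" and a: "0 \<le> a"
  shows log_bound_const_pos: "0 < log_bound_const p r m K a"
    and lorentz_log_bound: "antimono h \<Longrightarrow> (\<And>v. m \<le> v \<Longrightarrow> h v = 0) \<Longrightarrow> 0 < m \<Longrightarrow> 0 < t \<Longrightarrow> t < 1 \<Longrightarrow>
      (\<And>A u. 0 \<le> A \<Longrightarrow> (\<And>v. 0 < v \<Longrightarrow> v \<le> t \<Longrightarrow> h v \<le> ennreal (A * v powr (- 1 / p))) \<Longrightarrow>
        0 < u \<Longrightarrow> G u \<le> ennreal K * (\<Sum>k. h (2 ^ k * u / 2)) + ennreal (a * A * t powr (- 1 / p))) \<Longrightarrow>
      lorentz_functional p r (t * (1 - ln t) powr (- p)) G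
        \<le> ennreal (log_bound_const p r m K a) * lorentz_functional p r t h"
proof -
  define E where "E = K * tail_const m + a"
  have E: "0 < E" using K tail_const_pos[of m] a by (auto simp: E_def intro: add_pos_nonneg)
  define c1 where "c1 = rpow_const r 2"
  define c2 where "c2 = rpow_const r K * hardy_const p r"
  define c3 where "c3 = lconst p r * rpow_const r E * (rpow_const r (2 powr (1 / p)) * 2)"
  define c where "c = c1 * (c2 + c3)"
  have c1: "0 < c1" by (simp add: c1_def rpow_const_pos)
  have c2: "0 < c2" unfolding c2_def using p r K
    by (intro mult_pos_pos rpow_const_pos lorentz_dyadic_sum(2)[where h = "\<lambda>_. 0"]) auto
  have lconst: "0 < lconst p r" using p enn2real_pos[OF r] by (auto simp: lconst_def)
  have c3: "0 < c3" unfolding c3_def using E lconst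
    by (intro mult_pos_pos rpow_const_pos) auto
  have c_eq: "log_bound_const p r m K a = c"
    by (simp add: log_bound_const_def c_def c1_def c2_def c3_def E_def)
  have c: "0 < c" unfolding c_def using c1 c2 c3 by (intro mult_pos_pos add_pos_pos)
  then show "0 < log_bound_const p r m K a" by (simp only: c_eq)
  assume h: "antimono h" and hz: "\<And>v. m \<le> v \<Longrightarrow> h v = 0" and m: "0 < m" and t: "0 < t" "t < 1"
    and G: "\<And>A u. 0 \<le> A \<Longrightarrow> (\<And>v. 0 < v \<Longrightarrow> v \<le> t \<Longrightarrow> h v \<le> ennreal (A * v powr (- 1 / p))) \<Longrightarrow>
      0 < u \<Longrightarrow> G u \<le> ennreal K * (\<Sum>k. h (2 ^ k * u / 2)) + ennreal (a * A * t powr (- 1 / p))"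
  define L where "L = lorentz_functional p r t h"
  define T where "T = t * (1 - ln t) powr (- p)"
  have lnt: "1 \<le> 1 - ln t" using t by simp
  have T: "0 \<le> T" using t by (simp add: T_def)
  have [measurable]: "h \<in> borel_measurable borel" by (rule antimono_ennreal_measurable[OF h])
  show "lorentz_functional p r (t * (1 - ln t) powr (- p)) G
      \<le> ennreal (log_bound_const p r m K a) * lorentz_functional p r t h"
    unfolding T_def[symmetric] L_def[symmetric] c_eq
  proof (cases "L = \<infinity>")
    case True
    then show "lorentz_functional p r T G \<le> ennreal c * L" using c by (simp add: ennreal_mult_top)
  next
    case False
    \<comment> \<open>The weak-type constant of \<open>h\<close> on (0, t] delivered by
      \<open>rpow_le_lorentz\<close>; 2^(1/p) undoes the evaluation of the weight at v/2. Finiteness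
      of \<open>L\<close> makes it a real number.\<close>
    define A where "A = 2 powr (1 / p) * enn2real (rroot r (2 * L))"
    have fin: "rroot r (2 * L) < \<infinity>"
      using False by (intro rroot_finite) (auto simp: ennreal_mult_less_top less_top)
    then have root: "rroot r (2 * L) = ennreal (enn2real (rroot r (2 * L)))" by simp
    have A0: "0 \<le> A" by (simp add: A_def)
    have rA: "ennreal (rpow_const r A) = ennreal (rpow_const r (2 powr (1 / p)) * 2) * L"
    proof -
      have "ennreal (rpow_const r A) = rpow r (ennreal A)" using A0 by (rule rpow_ennreal[symmetric])
      also have "ennreal A = ennreal (2 powr (1 / p)) * rroot r (2 * L)"
        by (subst root) (simp add: A_def ennreal_mult)
      also have "rpow r \<dots> = ennreal (rpow_const r (2 powr (1 / p))) * (2 * L)"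
        using r by (simp add: rpow_mult rpow_rroot rpow_ennreal)
      also have "\<dots> = ennreal (rpow_const r (2 powr (1 / p)) * 2) * L"
        using rpow_const_pos[of "2 powr (1 / p)" r] by (simp add: ennreal_mult mult.assoc)
      finally show ?thesis .
    qed
    have hA: "h v \<le> ennreal (A * v powr (- 1 / p))" if v: "0 < v" "v \<le> t" for v
    proof -
      have "ennreal ((v / 2) powr (1 / p)) * h v = rroot r (rpow r (ennreal ((v / 2) powr (1 / p)) * h v))"
        using r by (simp add: rroot_rpow)
      also have "\<dots> \<le> rroot r (2 * L)"
        unfolding L_def using p r h v by (intro rroot_mono rpow_le_lorentz) auto
      finally have "ennreal ((v / 2) powr (1 / p)) * h v \<le> ennreal (enn2real (rroot r (2 * L)))"
        using root by simp
      then have "ennreal ((v / 2) powr (- 1 / p)) * (ennreal ((v / 2) powr (1 / p)) * h v)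
          \<le> ennreal ((v / 2) powr (- 1 / p)) * ennreal (enn2real (rroot r (2 * L)))"
        by (rule mult_left_mono) simp
      moreover have "ennreal ((v / 2) powr (- 1 / p)) * (ennreal ((v / 2) powr (1 / p)) * h v) = h v"
      proof -
        have "(v / 2) powr (- 1 / p) * (v / 2) powr (1 / p) = 1"
          using v by (simp add: powr_add[symmetric])
        then have "ennreal ((v / 2) powr (- 1 / p)) * ennreal ((v / 2) powr (1 / p)) = 1"
          by (metis ennreal_1 ennreal_mult powr_ge_zero)
        then show ?thesis by (simp add: mult.assoc[symmetric])
      qed
      moreover have "(v / 2) powr (- 1 / p) * enn2real (rroot r (2 * L)) = A * v powr (- 1 / p)"
        using v by (simp add: A_def powr_divide powr_minus field_simps)
      then have "ennreal ((v / 2) powr (- 1 / p)) * ennreal (enn2real (rroot r (2 * L))) = ennreal (A * v powr (- 1 / p))"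
        by (metis ennreal_mult enn2real_nonneg powr_ge_zero)
      ultimately show ?thesis by simp
    qed
    \<comment> \<open>Both contributions that do not depend on u, the scales above t and the gap
      between mean and median, are of this size; the gap only wastes the factor 1 - ln t \<ge>
      1.\<close>
    define b where "b = E * (1 - ln t) * (A * t powr (- 1 / p))"
    have b0: "0 \<le> b" using E lnt A0 by (simp add: b_def)
    have G_le: "G u \<le> ennreal K * dyadic_sum t h u + ennreal b" if u: "0 < u" for u
    proof -
      have "G u \<le> ennreal K * (\<Sum>k. h (2 ^ k * u / 2)) + ennreal (a * A * t powr (- 1 / p))"
        using A0 hA u by (rule G)
      also have "\<dots> \<le> ennreal K * (dyadic_sum t h u + ennreal (tail_const m * (1 - ln t)) * ennreal (A * t powr (- 1 / p)))
          + ennreal (a * (1 - ln t) * (A * t powr (- 1 / p)))"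
      proof (intro add_mono mult_left_mono ennreal_leI)
        have "(\<Sum>k. h (2 ^ k * u / 2)) \<le> dyadic_sum t h u + ennreal (tail_const m * (1 - ln t)) * h t"
          using hz by (intro suminf_le_dyadic_sum[OF h _ m t u]) auto
        also have "\<dots> \<le> dyadic_sum t h u + ennreal (tail_const m * (1 - ln t)) * ennreal (A * t powr (- 1 / p))"
          using t by (intro add_left_mono mult_left_mono hA) auto
        finally show "(\<Sum>k. h (2 ^ k * u / 2)) \<le> dyadic_sum t h u + ennreal (tail_const m * (1 - ln t)) * ennreal (A * t powr (- 1 / p))" .
        have "a * 1 \<le> a * (1 - ln t)" by (rule mult_left_mono[OF lnt a])
        then have "a * 1 * (A * t powr (- 1 / p)) \<le> a * (1 - ln t) * (A * t powr (- 1 / p))"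
          using A0 by (intro mult_right_mono) auto
        then show "a * A * t powr (- 1 / p) \<le> a * (1 - ln t) * (A * t powr (- 1 / p))" by (simp add: mult.assoc)
      qed simp
      also have "\<dots> = ennreal K * dyadic_sum t h u +
          (ennreal (K * (tail_const m * (1 - ln t) * (A * t powr (- 1 / p)))) + ennreal (a * (1 - ln t) * (A * t powr (- 1 / p))))"
        using K lnt A0 tail_const_pos[of m] by (simp add: distrib_left ennreal_mult add.assoc)
      also have "ennreal (K * (tail_const m * (1 - ln t) * (A * t powr (- 1 / p)))) + ennreal (a * (1 - ln t) * (A * t powr (- 1 / p)))
          = ennreal b"
      proof -
        have "0 \<le> K * (tail_const m * (1 - ln t) * (A * t powr (- 1 / p)))" "0 \<le> a * (1 - ln t) * (A * t powr (- 1 / p))"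
          using K lnt A0 tail_const_pos[of m] a by auto
        then show ?thesis
          by (subst ennreal_plus[symmetric]) (auto simp: b_def E_def algebra_simps)
      qed
      finally show ?thesis .
    qed
    have "lorentz_functional p r T G \<le> lorentz_functional p r T (\<lambda>u. ennreal K * dyadic_sum t h u + ennreal b)"
      using G_le by (intro lorentz_mono[OF r]) auto
    also have "\<dots> \<le> ennreal c1 * (lorentz_functional p r T (\<lambda>u. ennreal K * dyadic_sum t h u) + lorentz_functional p r T (\<lambda>u. ennreal b))"
      unfolding c1_def by (rule lorentz_add[OF r]) measurable
    also have "\<dots> \<le> ennreal c1 * (ennreal c2 * L + ennreal c3 * L)"
    proof (intro mult_left_mono add_mono)
      have "lorentz_functional p r T (\<lambda>u. ennreal K * dyadic_sum t h u) \<le> ennreal (rpow_const r K) * lorentz_functional p r T (dyadic_sum t h)"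
        using K by (intro lorentz_cmult[OF r]) auto
      also have "\<dots> \<le> ennreal (rpow_const r K) * (ennreal (hardy_const p r) * L)"
        unfolding L_def using p r by (intro mult_left_mono lorentz_dyadic_sum) auto
      also have "\<dots> = ennreal c2 * L"
        unfolding c2_def using rpow_const_pos[OF K, of r]
        by (subst ennreal_mult') (auto simp: mult.assoc)
      finally show "lorentz_functional p r T (\<lambda>u. ennreal K * dyadic_sum t h u) \<le> ennreal c2 * L" .
      have "lorentz_functional p r T (\<lambda>u. ennreal b) \<le> lorentz_functional p r T (\<lambda>u. ennreal (b * u powr (- 0)))"
        by (intro lorentz_mono[OF r]) auto
      also have "\<dots> \<le> ennreal (lconst (1 / (1 / p - 0)) r * rpow_const r (b * T powr (1 / p - 0)))"
        using p b0 T r by (intro lorentz_powr_le) auto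
      \<comment> \<open>The logarithm in \<open>b\<close> cancels against the p-th root of (1 - ln
        t)^(-p) in \<open>T\<close>; a smaller exponent would leave a positive power of 1 - ln
        t.\<close>
      also have "b * T powr (1 / p - 0) = E * A"
      proof -
        have "T powr (1 / p) = t powr (1 / p) * (1 - ln t) powr (- 1)"
          using t lnt p by (simp add: T_def powr_mult powr_powr)
        then have "b * T powr (1 / p - 0)
            = E * A * ((1 - ln t) * (1 - ln t) powr (- 1)) * (t powr (- 1 / p) * t powr (1 / p))"
          by (simp only: b_def diff_zero mult_ac)
        also have "(1 - ln t) * (1 - ln t) powr (- 1) = 1"
          using lnt by (simp add: powr_minus)
        also have "t powr (- 1 / p) * t powr (1 / p) = 1"
          using t by (simp add: powr_add[symmetric])
        finally show ?thesis by simp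
      qed
      also have "ennreal (lconst (1 / (1 / p - 0)) r * rpow_const r (E * A)) = ennreal (lconst p r * rpow_const r E) * ennreal (rpow_const r A)"
      proof -
        have "rpow_const r (E * A) = rpow_const r E * rpow_const r A"
          using E A0 by (simp add: rpow_const_def powr_mult)
        moreover have "0 \<le> lconst p r * rpow_const r E"
          using lconst rpow_const_pos[OF E, of r] by simp
        ultimately show ?thesis
          using ennreal_mult'[of "lconst p r * rpow_const r E" "rpow_const r A"] by (simp add: mult.assoc)
      qed
      also have "\<dots> = ennreal c3 * L"
      proof -
        have "0 \<le> lconst p r * rpow_const r E"
          using lconst rpow_const_pos[OF E, of r] by simp
        then show ?thesis unfolding rA c3_def
          by (simp only: ennreal_mult'[of "lconst p r * rpow_const r E" "rpow_const r (2 powr (1 / p)) * 2"] mult.assoc[of _ _ L])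
      qed
      finally show "lorentz_functional p r T (\<lambda>u. ennreal b) \<le> ennreal c3 * L" .
    qed simp
    also have "\<dots> = ennreal c * L"
      using c1 c2 c3 by (simp add: c_def ennreal_mult distrib_right mult.assoc)
    finally show "lorentz_functional p r T G \<le> ennreal c * L" .
  qed
qed

section \<open>Local oscillation, mean oscillation and their maximal functions\<close>

lemma local_osc_antimono:
  assumes "s \<le> s'"
  shows "local_osc s' M Q f \<le> local_osc s M Q f"
  unfolding local_osc_def
proof (rule INF_mono)
  fix c :: real
  have "ennreal s * emeasure M Q \<le> ennreal s' * emeasure M Q"
    using assms by (intro mult_right_mono ennreal_leI) auto
  then have "Inf {ennreal \<alpha> |\<alpha>. 0 \<le> \<alpha> \<and> emeasure M {y \<in> Q. \<alpha> < \<bar>f y - c\<bar>} < ennreal s' * emeasure M Q}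
      \<le> Inf {ennreal \<alpha> |\<alpha>. 0 \<le> \<alpha> \<and> emeasure M {y \<in> Q. \<alpha> < \<bar>f y - c\<bar>} < ennreal s * emeasure M Q}"
    by (intro Inf_superset_mono) (blast intro: less_le_trans)
  then show "\<exists>d\<in>UNIV. Inf {ennreal \<alpha> |\<alpha>. 0 \<le> \<alpha> \<and> emeasure M {y \<in> Q. \<alpha> < \<bar>f y - d\<bar>} < ennreal s' * emeasure M Q}
      \<le> Inf {ennreal \<alpha> |\<alpha>. 0 \<le> \<alpha> \<and> emeasure M {y \<in> Q. \<alpha> < \<bar>f y - c\<bar>} < ennreal s * emeasure M Q}"
    by blast
qed

text \<open>Chebyshev's inequality around the average. The level set must be strictly smaller than s
  times the measure, so the level is taken e above the Chebyshev threshold, and e then tends to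
  zero.\<close>

lemma local_osc_le_mean_osc:
  assumes s: "0 < s" and Q: "emeasure M Q = ennreal m" "0 < m"
    and meas: "\<And>c \<alpha>. {y \<in> Q. \<alpha> < \<bar>f y - c\<bar>} \<in> sets M"
  shows "local_osc s M Q f \<le> ennreal (1 / s) * mean_osc M Q f"
proof (cases "mean_osc M Q f")
  case top
  then show ?thesis using s by (simp add: ennreal_mult_top)
next
  case (real b)
  define a where "a = average M Q f"
  have int: "(\<integral>\<^sup>+x\<in>Q. ennreal \<bar>f x - a\<bar> \<partial>M) = ennreal (b * m)"
  proof -
    have "(\<integral>\<^sup>+x\<in>Q. ennreal \<bar>f x - a\<bar> \<partial>M) = (\<integral>\<^sup>+x\<in>Q. ennreal \<bar>f x - a\<bar> \<partial>M) / ennreal m * ennreal m"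
      using Q by (simp add: ennreal_divide_times)
    also have "\<dots> = ennreal b * ennreal m"
      using real Q by (simp add: mean_osc_def a_def)
    finally show ?thesis using real Q by (simp add: ennreal_mult)
  qed
  have "local_osc s M Q f \<le> ennreal (b / s) + ennreal e" if e: "0 < e" for e
  proof -
    define \<alpha> where "\<alpha> = b / s + e"
    have \<alpha>: "0 < \<alpha>" "b < s * \<alpha>" using e s real by (auto simp: \<alpha>_def field_simps intro: add_nonneg_pos)
    define E where "E = {y \<in> Q. \<alpha> < \<bar>f y - a\<bar>}"
    have E: "E \<in> sets M" unfolding E_def by (rule meas)
    have "ennreal \<alpha> * emeasure M E = (\<integral>\<^sup>+x. ennreal \<alpha> * indicator E x \<partial>M)"
      using E by (simp add: nn_integral_cmult_indicator)
    also have "\<dots> \<le> (\<integral>\<^sup>+x\<in>Q. ennreal \<bar>f x - a\<bar> \<partial>M)"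
      by (intro nn_integral_mono) (auto simp: E_def indicator_def intro!: ennreal_leI)
    also have "\<dots> = ennreal (b * m)" by (rule int)
    also have "\<dots> < ennreal (\<alpha> * (s * m))"
      using \<alpha> Q s by (intro ennreal_lessI) (auto simp: mult.commute)
    also have "\<dots> = ennreal \<alpha> * (ennreal s * emeasure M Q)"
      using \<alpha> Q s by (simp add: ennreal_mult)
    finally have "ennreal \<alpha> * emeasure M E < ennreal \<alpha> * (ennreal s * emeasure M Q)" .
    then have "emeasure M E < ennreal s * emeasure M Q"
      by (meson leD leI mult_left_mono zero_le)
    then have "Inf {ennreal \<beta> |\<beta>. 0 \<le> \<beta> \<and> emeasure M {y \<in> Q. \<bar>f y - a\<bar> > \<beta>} < ennreal s * emeasure M Q} \<le> ennreal \<alpha>"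
      using \<alpha> by (intro Inf_lower) (auto simp: E_def)
    then have "local_osc s M Q f \<le> ennreal \<alpha>"
      unfolding local_osc_def by (intro INF_lower2[of a]) auto
    then show ?thesis using e s real by (simp add: \<alpha>_def)
  qed
  then have "local_osc s M Q f \<le> ennreal (b / s)" by (rule ennreal_le_epsilon)
  also have "\<dots> = ennreal (1 / s) * ennreal b" using real s by (simp add: ennreal_mult[symmetric])
  finally show ?thesis using real by simp
qed

text \<open>The supremum at x runs over open cubes containing x, so a superlevel set is the union of
  the cubes on which \<phi> is large. Measurability of both maximal functions follows.\<close>

lemma maximal_level_open:
  fixes \<phi> :: "(real ^ 'n) set \<Rightarrow> ennreal"
  shows "open {x \<in> Q0. (SUP Q \<in> {Q. is_cube Q \<and> x \<in> Q \<and> Q \<subseteq> Q0}. \<phi> Q) > a}"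
proof -
  have "{x \<in> Q0. (SUP Q \<in> {Q. is_cube Q \<and> x \<in> Q \<and> Q \<subseteq> Q0}. \<phi> Q) > a}
      = \<Union>{Q. is_cube Q \<and> Q \<subseteq> Q0 \<and> \<phi> Q > a}"
    unfolding less_SUP_iff by blast
  moreover have "open (\<Union>{Q. is_cube Q \<and> Q \<subseteq> Q0 \<and> \<phi> Q > a})"
    by (rule open_Union) (auto simp: is_cube_def)
  ultimately show ?thesis by simp
qed

section \<open>The inequality for doubling measures\<close>

context doubling_space
begin

text \<open>Doubling carries measure zero from a cube to all its concentric enlargements by powers
  of two, one of which contains the cube known to have positive measure.\<close>

lemma cube_pos:
  assumes Q0: "0 < measure M (cube c0 l0)" and l: "0 < l"
  shows "0 < measure M (cube c l)"
proof (rule ccontr)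
  assume "\<not> 0 < measure M (cube c l)"
  then have z: "measure M (cube c l) = 0" using measure_nonneg[of M "cube c l"] by linarith
  have zero: "measure M (cube c (2 ^ n * l)) = 0" for n
  proof (induction n)
    case (Suc n)
    have "measure M (cube c (2 * (2 ^ n * l))) \<le> C * measure M (cube c (2 ^ n * l))"
      using l by (intro measure_doubling) auto
    then show ?case using Suc measure_nonneg[of M "cube c (2 * (2 ^ n * l))"] by (simp add: mult.assoc)
  qed (simp add: z)
  define d where "d = Max (range (\<lambda>i. \<bar>c0 $ i - c $ i\<bar>))"
  have d: "\<bar>c0 $ i - c $ i\<bar> \<le> d" for i unfolding d_def by (intro Max_ge) auto
  obtain n where "(2 * d + l0) / l < 2 ^ n" using real_arch_pow[of 2 "(2 * d + l0) / l"] by auto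
  then have n: "2 * d + l0 < 2 ^ n * l" using l by (simp add: field_simps)
  have "cube c0 l0 \<subseteq> cube c (2 ^ n * l)"
  proof (rule cube_mono_center)
    fix i show "\<bar>c0 $ i - c $ i\<bar> \<le> (2 ^ n * l - l0) / 2"
      using mult_left_mono[OF d[of i], of 2] n by simp
  qed
  then have "measure M (cube c0 l0) \<le> measure M (cube c (2 ^ n * l))"
    by (intro measure_mono_fmeasurable) auto
  then show False using zero[of n] Q0 by linarith
qed

text \<open>Isolates what the two maximal operators share: domination of the local oscillation at
  level 1/8 on every subcube containing the point.\<close>

lemma sharp_inequality_if_local_osc_le:
  assumes Q0: "is_cube Q0" and p: "1 < p" and r: "0 < r" and B: "1 \<le> B"
    and level: "\<And>f a. f \<in> borel_measurable (restrict_space M Q0) \<Longrightarrow> 0 \<le> a \<Longrightarrow> {x \<in> Q0. S f x > ennreal a} \<in> sets M"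
    and osc: "\<And>f x R. 0 < measure M Q0 \<Longrightarrow> f \<in> borel_measurable (restrict_space M Q0) \<Longrightarrow> x \<in> Q0 \<Longrightarrow> is_cube R \<Longrightarrow>
        x \<in> R \<Longrightarrow> R \<subseteq> Q0 \<Longrightarrow> local_osc (1 / 8) M R f \<le> ennreal B * S f x"
  shows "sharp_inequality M Q0 p r p S"
proof -
  obtain c0 l0 where cl: "0 < l0" "Q0 = cube c0 l0" using Q0 by (auto simp: is_cube_def)
  have Q0M: "Q0 \<in> sets M" "Q0 \<in> fmeasurable M" by (auto simp: cl)
  show ?thesis
  proof (cases "measure M Q0 = 0")
    \<comment> \<open>On a null cube all rearrangements vanish, so both sides are zero.\<close>
    case True
    have Q0z: "emeasure M Q0 = 0" using True Q0M by (simp add: emeasure_eq_measure2)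
    have z: "rearrangement M Q0 F u = 0" for F u
      using Q0M Q0z by (intro rearrangement_zero) auto
    have "lorentz_functional p r T (\<lambda>u. 0) = 0" for T
    proof -
      have "(SUP u\<in>{0<..<T}. (0 :: ennreal)) \<le> 0" by (rule SUP_least) simp
      then show ?thesis by (simp add: lorentz_functional_def)
    qed
    then have "lorentz_functional p r T (rearrangement M Q0 F) = 0" for T F
      using z by (metis (no_types, lifting) ext)
    then show ?thesis unfolding sharp_inequality_def by (intro exI[of _ 1]) auto
  next
    case False
    then have pos: "0 < measure M Q0" using measure_nonneg[of M Q0] by linarith
    obtain N where "C\<^sup>2 < 2 ^ N" using real_arch_pow[of 2 "C\<^sup>2"] by auto
    then have N: "C\<^sup>2 \<le> 2 ^ N" by simp
    have s_setup: "sharp_setup \<mu> C Q0 c0 l0 f (S f) B N" if f: "f \<in> borel_measurable (restrict_space M Q0)" for f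
      by unfold_locales (use cl pos f N level[OF f] B osc[OF pos f] in auto)
    \<comment> \<open>The constant must be fixed before \<open>f\<close>; \<open>K\<close> and
      \<open>a\<close> restate the locale constants in a form in which \<open>f\<close> does not
      occur.\<close>
    define K where "K = (2 * real N + 4) * B"
    define a where "a = 8 * K * (1 + measure M Q0 powr (- 1 / p)) / (1 - 2 powr (1 / p - 1))\<^sup>2"
    have K: "0 < K" using B by (auto simp: K_def intro!: mult_pos_pos)
    have a: "0 \<le> a" using K by (simp add: a_def)
    define c where "c = log_bound_const p r (measure M Q0) K a"
    show ?thesis
      unfolding sharp_inequality_def
    proof (intro exI[of _ c] conjI ballI)
      show "0 < c" unfolding c_def by (rule log_bound_const_pos[OF p r K a])
      fix f t assume f: "f \<in> lorentz_space M Q0 p r" and t: "t \<in> {0<..<1::real}"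
      interpret s: sharp_setup \<mu> C Q0 c0 l0 f "S f" B N
        using f by (intro s_setup) (simp add: lorentz_space_def)
      have sK: "s.K = K" by (simp add: s.K_def K_def)
      have sa: "s.avg_const p = a" by (simp add: s.avg_const_def a_def sK)
      show "lorentz_functional p r (t * (1 - ln t) powr - p)
          (rearrangement M Q0 (\<lambda>x. ennreal \<bar>f x - average M Q0 f\<bar>))
          \<le> ennreal c * lorentz_functional p r t (rearrangement M Q0 (S f))"
        unfolding s.h_def[symmetric] c_def
      proof (rule lorentz_log_bound[OF p r K a _ _ pos])
        show "antimono s.h" by (intro antimonoI s.h_antimono)
        show "s.h v = 0" if "measure M Q0 \<le> v" for v using that by (rule s.h_zero)
        show "0 < t" "t < 1" using t by auto
        fix A u :: real
        assume A: "0 \<le> A" "\<And>v. 0 < v \<Longrightarrow> v \<le> t \<Longrightarrow> s.h v \<le> ennreal (A * v powr (- 1 / p))" and u: "0 < u"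
        have "\<bar>average M Q0 f - s.median\<bar> \<le> a * A * t powr (- 1 / p)"
          unfolding sa[symmetric] using t A by (intro s.average_median p) auto
        then have "rearrangement M Q0 (\<lambda>x. ennreal \<bar>f x - average M Q0 f\<bar>) u
            \<le> s.g s.median u + ennreal (a * A * t powr (- 1 / p))"
          using a A by (intro s.rearrangement_average_le) auto
        also have "\<dots> \<le> ennreal K * (\<Sum>k. s.h (2 ^ k * u / 2)) + ennreal (a * A * t powr (- 1 / p))"
          using s.g_le_suminf[OF u] unfolding sK by (rule add_right_mono)
        finally show "rearrangement M Q0 (\<lambda>x. ennreal \<bar>f x - average M Q0 f\<bar>) u
            \<le> ennreal K * (\<Sum>k. s.h (2 ^ k * u / 2)) + ennreal (a * A * t powr (- 1 / p))" .
      qed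
    qed
  qed
qed

lemma sharp_inequality_sharp_maximal:
  assumes Q0: "is_cube Q0" and p: "1 < p" and r: "0 < r"
  shows "sharp_inequality M Q0 p r p (sharp_maximal M Q0)"
proof (rule sharp_inequality_if_local_osc_le[OF Q0 p r, where B = 8])
  fix f :: "real ^ 'n \<Rightarrow> real" and a :: real
  show "{x \<in> Q0. ennreal a < sharp_maximal M Q0 f x} \<in> sets M"
    unfolding sharp_maximal_def by (intro in_sets_M borel_open maximal_level_open)
next
  fix f :: "real ^ 'n \<Rightarrow> real" and x R
  assume pos: "0 < measure M Q0" and f: "f \<in> borel_measurable (restrict_space M Q0)"
    and R: "is_cube R" "x \<in> R" "R \<subseteq> Q0"
  obtain q l where q: "0 < l" "R = cube q l" using R by (auto simp: is_cube_def)
  obtain c0 l0 where c0: "Q0 = cube c0 l0" using Q0 by (auto simp: is_cube_def)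
  have "local_osc (1 / 8) M R f \<le> ennreal (1 / (1 / 8)) * mean_osc M R f"
  proof (rule local_osc_le_mean_osc)
    show "emeasure M R = ennreal (measure M R)" unfolding q by (rule emeasure_cube_eq)
    show "0 < measure M R" unfolding q using pos[unfolded c0] q(1) by (rule cube_pos)
    show "{y \<in> R. \<alpha> < \<bar>f y - c\<bar>} \<in> sets M" for c \<alpha>
      by (rule level_set[OF f _ _ R(3)]) (simp_all add: q c0)
  qed simp
  also have "\<dots> \<le> ennreal 8 * sharp_maximal M Q0 f x"
    unfolding sharp_maximal_def using R by (intro mult_mono SUP_upper) auto
  finally show "local_osc (1 / 8) M R f \<le> ennreal 8 * sharp_maximal M Q0 f x" .
qed simp

lemma sharp_inequality_local_sharp_maximal:
  assumes Q0: "is_cube Q0" and p: "1 < p" and r: "0 < r" and s: "s \<le> 1 / 8"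
  shows "sharp_inequality M Q0 p r p (local_sharp_maximal s M Q0)"
proof (rule sharp_inequality_if_local_osc_le[OF Q0 p r, where B = 1])
  fix f :: "real ^ 'n \<Rightarrow> real" and a :: real
  show "{x \<in> Q0. ennreal a < local_sharp_maximal s M Q0 f x} \<in> sets M"
    unfolding local_sharp_maximal_def by (intro in_sets_M borel_open maximal_level_open)
next
  fix f :: "real ^ 'n \<Rightarrow> real" and x R
  assume R: "is_cube R" "x \<in> R" "R \<subseteq> Q0"
  have "local_osc (1 / 8) M R f \<le> local_osc s M R f" by (rule local_osc_antimono[OF s])
  also have "\<dots> \<le> local_sharp_maximal s M Q0 f x"
    unfolding local_sharp_maximal_def using R by (intro SUP_upper) auto
  finally show "local_osc (1 / 8) M R f \<le> ennreal 1 * local_sharp_maximal s M Q0 f x" by simp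
qed simp

end

lemma doubling_spaceI:
  assumes "radon_measure \<mu>" "doubling_measure \<mu>"
  obtains C where "doubling_space \<mu> C"
proof -
  obtain C where C: "0 < C" "\<And>c l. 0 < l \<Longrightarrow> emeasure \<mu> (cube c (2 * l)) \<le> ennreal C * emeasure \<mu> (cube c l)"
    using assms(2) by (auto simp: doubling_measure_def)
  have "doubling_space \<mu> (max 1 C)"
  proof
    fix l :: real and c assume "0 < l"
    then have "emeasure \<mu> (cube c (2 * l)) \<le> ennreal C * emeasure \<mu> (cube c l)" by (rule C(2))
    also have "\<dots> \<le> ennreal (max 1 C) * emeasure \<mu> (cube c l)"
      by (intro mult_right_mono ennreal_leI) auto
    finally show "emeasure \<mu> (cube c (2 * l)) \<le> ennreal (max 1 C) * emeasure \<mu> (cube c l)" .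
  qed (use assms(1) in \<open>auto simp: radon_measure_def\<close>)
  then show ?thesis by (rule that)
qed

text \<open>For t in (0, 1) the base 1 - ln t is at least 1, so a larger exponent only shortens the
  range on the left.\<close>

lemma sharp_inequality_mono:
  assumes r: "0 < r" and le: "\<gamma> \<le> \<gamma>'" and ineq: "sharp_inequality M Q0 p r \<gamma> S"
  shows "sharp_inequality M Q0 p r \<gamma>' S"
proof -
  obtain C where C: "0 < C" "\<And>f t. f \<in> lorentz_space M Q0 p r \<Longrightarrow> t \<in> {0<..<1} \<Longrightarrow>
      lorentz_functional p r (t * (1 - ln t) powr (- \<gamma>)) (rearrangement M Q0 (\<lambda>x. ennreal \<bar>f x - average M Q0 f\<bar>))
      \<le> ennreal C * lorentz_functional p r t (rearrangement M Q0 (S f))"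
    using ineq unfolding sharp_inequality_def by blast
  show ?thesis
    unfolding sharp_inequality_def
  proof (intro exI[of _ C] conjI C(1) ballI)
    fix f t assume f: "f \<in> lorentz_space M Q0 p r" and t: "t \<in> {0<..<1::real}"
    have "lorentz_functional p r (t * (1 - ln t) powr (- \<gamma>')) (rearrangement M Q0 (\<lambda>x. ennreal \<bar>f x - average M Q0 f\<bar>))
        \<le> lorentz_functional p r (t * (1 - ln t) powr (- \<gamma>)) (rearrangement M Q0 (\<lambda>x. ennreal \<bar>f x - average M Q0 f\<bar>))"
      using t le by (intro lorentz_mono[OF r] mult_left_mono powr_mono) auto
    also have "\<dots> \<le> ennreal C * lorentz_functional p r t (rearrangement M Q0 (S f))" by (rule C(2)[OF f t])
    finally show "lorentz_functional p r (t * (1 - ln t) powr (- \<gamma>')) (rearrangement M Q0 (\<lambda>x. ennreal \<bar>f x - average M Q0 f\<bar>))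
        \<le> ennreal C * lorentz_functional p r t (rearrangement M Q0 (S f))" .
  qed
qed

subsection \<open>The logarithm\<close>

lemma emeasure_lborel_box_cart:
  fixes a b :: "real ^ 'n"
  assumes "\<And>i. a $ i \<le> b $ i"
  shows "emeasure lborel (box a b) = ennreal (\<Prod>i\<in>UNIV. b $ i - a $ i)"
proof -
  have ne: "cbox a b \<noteq> {}" using assms by (auto simp: interval_ne_empty_cart)
  have "emeasure lborel (box a b) = emeasure lborel (cbox a b)"
    using assms by (simp add: emeasure_lborel_box_eq emeasure_lborel_cbox_eq)
  also have "\<dots> = ennreal (measure lborel (cbox a b))"
    by (rule emeasure_eq_ennreal_measure) (simp add: emeasure_lborel_cbox_eq)
  also have "measure lborel (cbox a b) = (\<Prod>i\<in>UNIV. b $ i - a $ i)"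
    using ne by (rule content_cbox_cart)
  finally show ?thesis .
qed

lemma emeasure_lborel_slab:
  fixes c :: "real ^ 'n"
  assumes l: "0 \<le> l" and \<tau>: "0 \<le> \<tau>" "\<tau> \<le> 1"
  shows "emeasure lborel {x \<in> cube c l. x $ j < c $ j - l / 2 + \<tau> * l} = ennreal (\<tau> * l ^ CARD('n))"
proof -
  define b where "b = (\<chi> i. if i = j then c $ i - l / 2 + \<tau> * l else c $ i + l / 2)"
  have \<tau>l: "\<tau> * l \<le> l" "0 \<le> \<tau> * l" using l \<tau> by (auto simp: mult_left_le_one_le)
  have "{x \<in> cube c l. x $ j < c $ j - l / 2 + \<tau> * l} = box (c - vec (l / 2)) b"
  proof (intro set_eqI iffI)
    fix x assume x: "x \<in> {x \<in> cube c l. x $ j < c $ j - l / 2 + \<tau> * l}"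
    have "c $ i - l / 2 < x $ i \<and> x $ i < c $ i + l / 2" for i
    proof -
      have "\<bar>x $ i - c $ i\<bar> < l / 2" using x by (auto simp: mem_cube)
      then show ?thesis unfolding abs_less_iff by linarith
    qed
    then show "x \<in> box (c - vec (l / 2)) b"
      unfolding mem_box_cart using x by (auto simp: b_def)
  next
    fix x assume x: "x \<in> box (c - vec (l / 2)) b"
    have 1: "c $ i - l / 2 < x $ i \<and> x $ i < b $ i" for i using x by (auto simp: mem_box_cart)
    have "\<bar>x $ i - c $ i\<bar> < l / 2" for i
    proof -
      have "b $ i \<le> c $ i + l / 2" using \<tau>l by (simp add: b_def)
      then show ?thesis using 1[of i] unfolding abs_less_iff by linarith
    qed
    moreover have "x $ j < c $ j - l / 2 + \<tau> * l" using 1[of j] by (simp add: b_def)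
    ultimately show "x \<in> {x \<in> cube c l. x $ j < c $ j - l / 2 + \<tau> * l}" by (simp add: mem_cube)
  qed
  moreover have "(\<Prod>i\<in>UNIV. b $ i - (c - vec (l / 2)) $ i) = \<tau> * l ^ CARD('n)"
  proof -
    have "(\<Prod>i\<in>UNIV. b $ i - (c - vec (l / 2)) $ i) = (\<Prod>i\<in>UNIV. if i = j then \<tau> * l else l)"
      by (intro prod.cong) (auto simp: b_def)
    also have "\<dots> = (\<tau> * l) * (\<Prod>i\<in>UNIV - {j}. l)"
      by (subst prod.remove[of UNIV j]) auto
    also have "\<dots> = \<tau> * (l * l ^ (CARD('n) - 1))" by (simp add: card_Diff_singleton)
    also have "l * l ^ (CARD('n) - 1) = l ^ CARD('n)"
      by (metis One_nat_def Suc_pred power_Suc zero_less_card_finite)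
    finally show ?thesis .
  qed
  moreover have "(c - vec (l / 2)) $ i \<le> b $ i" for i using l \<tau>l by (auto simp: b_def)
  ultimately show ?thesis using emeasure_lborel_box_cart[of "c - vec (l / 2)" b] by simp
qed

lemma emeasure_lborel_cube:
  fixes c :: "real ^ 'n"
  assumes "0 \<le> l"
  shows "emeasure lborel (cube c l) = ennreal (l ^ CARD('n))"
proof -
  have "x $ undefined < c $ undefined - l / 2 + 1 * l" if "x \<in> cube c l" for x
  proof -
    have "\<bar>x $ undefined - c $ undefined\<bar> < l / 2" using that by (simp add: mem_cube)
    then show ?thesis unfolding abs_less_iff by linarith
  qed
  then have "{x \<in> cube c l. x $ undefined < c $ undefined - l / 2 + 1 * l} = cube c l"
    by blast
  then show ?thesis using emeasure_lborel_slab[OF assms, of 1 c undefined] by simp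
qed

lemma radon_lborel: "radon_measure lborel"
  unfolding radon_measure_def
  by (intro conjI allI impI emeasure_bounded_finite compact_imp_bounded) auto

lemma doubling_lborel: "doubling_measure (lborel :: (real ^ 'n) measure)"
  unfolding doubling_measure_def
proof (intro exI[of _ "2 ^ CARD('n)"] conjI allI impI)
  fix c :: "real ^ 'n" and l :: real assume "0 < l"
  then show "emeasure lborel (cube c (2 * l)) \<le> ennreal (2 ^ CARD('n)) * emeasure lborel (cube c l)"
    using emeasure_lborel_cube[of "2 * l" c] emeasure_lborel_cube[of l c]
    by (simp add: ennreal_mult[symmetric] power_mult_distrib)
qed simp

text \<open>The number of k with 2^k < z is log2(z) rounded up. Thus the logarithm is dominated by a
  sum of indicators of slabs, and its integral by a geometric series.\<close>

lemma ln_le_dyadic_count: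
  assumes z: "1 \<le> z"
  shows "ennreal (ln z) \<le> (\<Sum>k. ennreal (ln 2) * (if (2 :: real) ^ k < z then 1 else 0))"
proof -
  define n where "n = nat \<lceil>log 2 z\<rceil>"
  have log0: "0 \<le> log 2 z" using z by simp
  have n: "log 2 z \<le> real n" using log0 by (simp add: n_def)
  have less: "(2 :: real) ^ k < z" if "k < n" for k
  proof -
    have "real k < log 2 z" using that log0 by (simp add: n_def) linarith
    then have "2 powr real k < z" using z by (simp add: less_log_iff)
    then show ?thesis by (simp add: powr_realpow)
  qed
  have "ln z = ln 2 * log 2 z" by (simp add: log_def)
  also have "\<dots> \<le> ln 2 * real n" using n by (intro mult_left_mono) auto
  finally have "ennreal (ln z) \<le> ennreal (ln 2 * real n)" by (rule ennreal_leI)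
  also have "\<dots> = (\<Sum>k<n. ennreal (ln 2))" by (simp add: ennreal_mult ennreal_of_nat_eq_real_of_nat mult.commute)
  also have "\<dots> = (\<Sum>k<n. ennreal (ln 2) * (if (2 :: real) ^ k < z then 1 else 0))"
    by (intro sum.cong) (use less in auto)
  also have "\<dots> \<le> (\<Sum>k. ennreal (ln 2) * (if (2 :: real) ^ k < z then 1 else 0))"
    by (intro sum_le_suminf) auto
  finally show ?thesis .
qed

text \<open>
  Depending on one coordinate only, the extremal function has the distribution function of
  \<open>log (1/x)\<close> on an interval, so no computation in dimension \<open>d\<close> is needed.
\<close>

locale log_example =
  fixes Q0 :: "(real ^ 'n) set" and c0 :: "real ^ 'n" and l0 :: real and j :: 'n
  assumes l0: "0 < l0" and Q0: "Q0 = cube c0 l0"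
begin

definition face :: real where "face = c0 $ j - l0 / 2"

definition F :: "real ^ 'n \<Rightarrow> real" where "F x = - ln ((x $ j - face) / l0)"

definition m :: real where "m = l0 ^ CARD('n)"

lemma m_pos: "0 < m"
  using l0 by (simp add: m_def)

lemma Q0_leb: "Q0 \<in> sets lebesgue" "emeasure lebesgue Q0 = ennreal m" "measure lebesgue Q0 = m"
proof -
  show "Q0 \<in> sets lebesgue" by (simp add: Q0)
  show e: "emeasure lebesgue Q0 = ennreal m" using emeasure_lborel_cube[of l0 c0] l0 by (simp add: Q0 m_def)
  show "measure lebesgue Q0 = m" unfolding measure_def e using m_pos by simp
qed

lemma coord: "x \<in> Q0 \<Longrightarrow> 0 < x $ j - face" "x \<in> Q0 \<Longrightarrow> x $ j - face < l0"
proof -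
  assume "x \<in> Q0"
  then have "\<bar>x $ j - c0 $ j\<bar> < l0 / 2" by (simp add: Q0 mem_cube)
  then show "0 < x $ j - face" "x $ j - face < l0" unfolding face_def abs_less_iff by linarith+
qed

lemma F_nonneg: "x \<in> Q0 \<Longrightarrow> 0 \<le> F x"
  using coord[of x] l0 by (simp add: F_def)

lemma F_borel [measurable]: "F \<in> borel_measurable borel"
proof -
  have [measurable]: "(\<lambda>x :: real ^ 'n. x $ j) \<in> borel_measurable borel"
    by (intro borel_measurable_continuous_onI continuous_intros)
  show ?thesis unfolding F_def[abs_def] by measurable
qed

lemma F_restrict: "Q \<in> sets lebesgue \<Longrightarrow> F \<in> borel_measurable (restrict_space lebesgue Q)"
  by (intro measurable_restrict_space1 measurable_completion) simp

lemma F_level: "{x \<in> Q. P (F x)} \<in> sets borel" if "Q \<in> sets borel" "{y. P y} \<in> sets borel" for P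
proof -
  have "F -` {y. P y} \<inter> space borel \<in> sets borel" using F_borel that(2) by (rule measurable_sets)
  then have "Q \<inter> F -` {y. P y} \<in> sets borel" using that(1) by auto
  moreover have "Q \<inter> F -` {y. P y} = {x \<in> Q. P (F x)}" by auto
  ultimately show ?thesis by simp
qed

lemma F_level_measure:
  assumes "0 \<le> a"
  shows "emeasure lebesgue {x \<in> Q0. F x > a} = ennreal (m * exp (- a))"
proof -
  have "{x \<in> Q0. F x > a} = {x \<in> cube c0 l0. x $ j < c0 $ j - l0 / 2 + exp (- a) * l0}"
  proof (intro set_eqI)
    fix x
    have "F x > a \<longleftrightarrow> x $ j - face < exp (- a) * l0" if x: "x \<in> Q0"
    proof -
      have "F x > a \<longleftrightarrow> ln ((x $ j - face) / l0) < - a" by (auto simp: F_def)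
      also have "\<dots> \<longleftrightarrow> (x $ j - face) / l0 < exp (- a)"
        using coord[OF x] l0 by (metis divide_pos_pos exp_less_cancel_iff exp_ln)
      also have "\<dots> \<longleftrightarrow> x $ j - face < exp (- a) * l0" using l0 by (simp add: pos_divide_less_eq)
      finally show ?thesis .
    qed
    then show "x \<in> {x \<in> Q0. F x > a} \<longleftrightarrow> x \<in> {x \<in> cube c0 l0. x $ j < c0 $ j - l0 / 2 + exp (- a) * l0}"
      by (auto simp: Q0 face_def)
  qed
  moreover have "{x \<in> Q0. F x > a} \<in> sets borel"
    by (rule F_level) (auto simp: Q0)
  ultimately show ?thesis
    using emeasure_lborel_slab[of l0 "exp (- a)" c0 j] l0 assms by (simp add: m_def mult.commute)
qed

text \<open>Subtracting the value of F at the far face of R leaves ln(B/y), whose dyadic level sets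
  take at most the fraction 2^(-k) of R. The mean deviation from that value is therefore at most 2
  ln 2, wherever R lies in \<open>Q0\<close>.\<close>

lemma mean_osc_le:
  assumes R: "is_cube R" "R \<subseteq> Q0"
  shows "mean_osc lebesgue R F \<le> ennreal 4"
proof -
  obtain c l where cl: "0 < l" "R = cube c l" using R by (auto simp: is_cube_def)
  define e where "e = l ^ CARD('n)"
  have e: "0 < e" using cl by (simp add: e_def)
  have Rl: "R \<in> sets lebesgue" "emeasure lebesgue R = ennreal e"
    using emeasure_lborel_cube[of l c] cl by (auto simp: e_def)
  \<comment> \<open>The distance from \<open>face\<close> to the opposite side of R, that is, the
    supremum of y over R.\<close>
  define B where "B = c $ j + l / 2 - face"
  have coordR: "0 < x $ j - face" "x $ j - face < B" if "x \<in> R" for x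
  proof -
    have "\<bar>x $ j - c $ j\<bar> < l / 2" using that by (simp add: cl mem_cube)
    then show "x $ j - face < B" unfolding B_def abs_less_iff by linarith
    show "0 < x $ j - face" using that R(2) coord by auto
  qed
  have "c \<in> R" using cl by (simp add: mem_cube)
  then have B: "0 < B" using coordR[of c] by linarith
  \<comment> \<open>R lies on the positive side of \<open>face\<close>. If its side exceeded
    \<open>B\<close>, the point \<open>x\<close> below would lie in R on the wrong side of
    \<open>face\<close>; the minimum keeps \<open>x\<close> inside the open cube.\<close>
  have lower: "l \<le> B"
  proof (rule ccontr)
    assume "\<not> l \<le> B"
    define x where "x = (\<chi> i. if i = j then c $ i - l / 2 + min (l / 2) ((l - B) / 2) else c $ i)"
    have "0 < min (l / 2) ((l - B) / 2)" using cl \<open>\<not> l \<le> B\<close> by simp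
    note pos = this min.cobounded1[of "l / 2" "(l - B) / 2"] min.cobounded2[of "l / 2" "(l - B) / 2"]
    have "\<bar>x $ i - c $ i\<bar> < l / 2" for i
      unfolding x_def abs_less_iff using pos cl by auto
    then have "x \<in> R" by (simp add: cl mem_cube)
    then have "0 < x $ j - face" by (rule coordR)
    moreover have "x $ j - face \<le> B - l + (l - B) / 2" using pos by (simp add: x_def B_def)
    ultimately have "0 < (B - l) / 2" by argo
    then show False using \<open>\<not> l \<le> B\<close> by simp
  qed
  define C where "C = - ln (B / l0)"
  define L where "L = (\<lambda>k. {x \<in> R. x $ j < c $ j - l / 2 + (1 / 2) ^ k * l})"
  have Lb: "L k \<in> sets borel" for k
  proof -
    have [measurable]: "(\<lambda>x :: real ^ 'n. x $ j) \<in> borel_measurable borel"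
      by (intro borel_measurable_continuous_onI continuous_intros)
    have "L k = R \<inter> {x \<in> space borel. x $ j < c $ j - l / 2 + (1 / 2) ^ k * l}" by (auto simp: L_def)
    moreover have "{x \<in> space borel. x $ j < c $ j - l / 2 + (1 / 2) ^ k * l} \<in> sets borel" by measurable
    ultimately show ?thesis by (simp add: cl)
  qed
  have Lm: "emeasure lebesgue (L k) = ennreal ((1 / 2) ^ k * e)" for k
  proof -
    have "emeasure lebesgue (L k) = emeasure lborel (L k)" using Lb by simp
    also have "\<dots> = ennreal ((1 / 2) ^ k * e)"
      unfolding L_def cl e_def using cl by (intro emeasure_lborel_slab) (auto simp: power_le_one)
    finally show ?thesis .
  qed
  have pw: "ennreal \<bar>F x - C\<bar> * indicator R x \<le> (\<Sum>k. ennreal (ln 2) * indicator (L k) x)" for x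
  proof (cases "x \<in> R")
    case True
    define y where "y = x $ j - face"
    have y: "0 < y" "y < B" using coordR[OF True] by (auto simp: y_def)
    have "F x - C = ln (B / y)" using y B l0 by (simp add: F_def C_def y_def[symmetric] ln_div)
    moreover have "1 \<le> B / y" using y by simp
    ultimately have "ennreal \<bar>F x - C\<bar> \<le> (\<Sum>k. ennreal (ln 2) * (if (2 :: real) ^ k < B / y then 1 else 0))"
      using ln_le_dyadic_count[of "B / y"] by simp
    also have "\<dots> \<le> (\<Sum>k. ennreal (ln 2) * indicator (L k) x)"
    proof (intro suminf_le mult_left_mono)
      fix k
      show "(if (2 :: real) ^ k < B / y then 1 else 0 :: ennreal) \<le> indicator (L k) x"
      proof (cases "(2 :: real) ^ k < B / y")
        case less: True
        then have "y < (1 / 2) ^ k * B" using y by (simp add: field_simps power_divide)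
        \<comment> \<open>A gap B - l between \<open>face\<close> and R only helps: it is scaled by
          2^(-k) on the left but counted in full on the right, so y lies in the lowest fraction
          2^(-k) of R itself.\<close>
        also have "(1 / 2) ^ k * B = (1 / 2) ^ k * l + (1 / 2) ^ k * (B - l)" by (simp add: algebra_simps)
        also have "(1 / 2) ^ k * (B - l) \<le> 1 * (B - l)"
          using lower by (intro mult_right_mono) (auto simp: power_le_one)
        finally have "y < (1 / 2) ^ k * l + (B - l)" by simp
        then have "x $ j < c $ j - l / 2 + (1 / 2) ^ k * l" unfolding y_def B_def by argo
        then show ?thesis using True by (simp add: L_def)
      qed simp
    qed auto
    finally show ?thesis using True by simp
  qed simp
  have "(\<integral>\<^sup>+x\<in>R. ennreal \<bar>F x - C\<bar> \<partial>lebesgue) \<le> (\<integral>\<^sup>+x. (\<Sum>k. ennreal (ln 2) * indicator (L k) x) \<partial>lebesgue)"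
    by (intro nn_integral_mono pw)
  also have "\<dots> = (\<Sum>k. ennreal (ln 2) * emeasure lebesgue (L k))"
  proof -
    have [measurable]: "L k \<in> sets lebesgue" for k using Lb by simp
    have "(\<integral>\<^sup>+x. (\<Sum>k. ennreal (ln 2) * indicator (L k) x) \<partial>lebesgue)
        = (\<Sum>k. \<integral>\<^sup>+x. ennreal (ln 2) * indicator (L k) x \<partial>lebesgue)"
      by (rule nn_integral_suminf) measurable
    then show ?thesis by (simp only: nn_integral_cmult_indicator[OF \<open>\<And>k. L k \<in> sets lebesgue\<close>])
  qed
  also have "\<dots> = (\<Sum>k. ennreal (ln 2 * e * (1 / 2) ^ k))"
    unfolding Lm using e by (simp add: ennreal_mult[symmetric] mult_ac)
  also have "\<dots> = ennreal (ln 2 * e * (1 / (1 - 1 / 2)))"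
    using e by (intro suminf_ennreal_eq sums_mult geometric_sums) auto
  also have "ln 2 * e * (1 / (1 - 1 / 2)) = e * (2 * ln 2)" by simp
  finally have J: "(\<integral>\<^sup>+x\<in>R. ennreal \<bar>F x - C\<bar> \<partial>lebesgue) \<le> ennreal (e * (2 * ln 2))" .
  define A where "A = average lebesgue R F"
  \<comment> \<open>Passing from the reference value to the mean at most doubles the deviation, to 4
    ln 2, which is rounded up to 4.\<close>
  have AC: "\<bar>A - C\<bar> \<le> 2 * ln 2"
    unfolding A_def using J e Rl by (intro average_diff_le F_restrict) auto
  have "(\<integral>\<^sup>+x\<in>R. ennreal \<bar>F x - A\<bar> \<partial>lebesgue)
      \<le> (\<integral>\<^sup>+x. ennreal \<bar>F x - C\<bar> * indicator R x + ennreal (2 * ln 2) * indicator R x \<partial>lebesgue)"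
  proof (rule nn_integral_mono)
    fix x
    have "ennreal \<bar>F x - A\<bar> \<le> ennreal (\<bar>F x - C\<bar> + 2 * ln 2)" using AC by (intro ennreal_leI) linarith
    also have "\<dots> = ennreal \<bar>F x - C\<bar> + ennreal (2 * ln 2)" by (rule ennreal_plus) auto
    finally show "ennreal \<bar>F x - A\<bar> * indicator R x \<le> ennreal \<bar>F x - C\<bar> * indicator R x + ennreal (2 * ln 2) * indicator R x"
      by (cases "x \<in> R") auto
  qed
  also have "\<dots> = (\<integral>\<^sup>+x\<in>R. ennreal \<bar>F x - C\<bar> \<partial>lebesgue) + ennreal (2 * ln 2) * emeasure lebesgue R"
  proof -
    have "(\<lambda>x. ennreal \<bar>F x - C\<bar>) \<in> borel_measurable lebesgue" by (intro measurable_completion) simp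
    then show ?thesis using Rl by (simp add: nn_integral_add nn_integral_cmult_indicator)
  qed
  also have "\<dots> \<le> ennreal (e * (2 * ln 2)) + ennreal (2 * ln 2) * ennreal e"
    unfolding Rl(2) by (rule add_right_mono[OF J])
  also have "\<dots> = ennreal (4 * ln 2 * e)"
    using e by (subst ennreal_mult[symmetric]) (auto simp: ennreal_plus[symmetric] simp del: ennreal_plus)
  also have "\<dots> \<le> ennreal (4 * e)"
    using e ln_le_minus_one[of 2] by (intro ennreal_leI mult_right_mono) auto
  finally have "mean_osc lebesgue R F \<le> ennreal (4 * e) / ennreal e"
    unfolding mean_osc_def Rl(2) A_def by (rule divide_right_mono_ennreal)
  also have "\<dots> = ennreal 4" using e by (simp add: divide_ennreal)
  finally show ?thesis .
qed

lemma sharp_maximal_le: "sharp_maximal lebesgue Q0 F x \<le> ennreal 4"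
  unfolding sharp_maximal_def by (rule SUP_least) (rule mean_osc_le, auto)

lemma local_sharp_maximal_le:
  assumes s: "0 < s"
  shows "local_sharp_maximal s lebesgue Q0 F x \<le> ennreal (4 / s)"
  unfolding local_sharp_maximal_def
proof (rule SUP_least)
  fix R assume "R \<in> {Q. is_cube Q \<and> x \<in> Q \<and> Q \<subseteq> Q0}"
  then have R: "is_cube R" "R \<subseteq> Q0" by auto
  obtain c l where cl: "0 < l" "R = cube c l" using R by (auto simp: is_cube_def)
  have "local_osc s lebesgue R F \<le> ennreal (1 / s) * mean_osc lebesgue R F"
  proof (rule local_osc_le_mean_osc[OF s])
    show "emeasure lebesgue R = ennreal (l ^ CARD('n))"
      using emeasure_lborel_cube[of l c] cl by simp
    show "{y \<in> R. \<alpha> < \<bar>F y - c\<bar>} \<in> sets lebesgue" for c \<alpha>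
      by (rule sets_completionI_sets, unfold sets_lborel, rule F_level) (simp add: cl, measurable)
  qed (use cl in simp)
  also have "\<dots> \<le> ennreal (1 / s) * ennreal 4" by (intro mult_left_mono mean_osc_le R) simp
  also have "\<dots> = ennreal (4 / s)" using s by (subst ennreal_mult[symmetric]) auto
  finally show "local_osc s lebesgue R F \<le> ennreal (4 / s)" .
qed

text \<open>The rearrangement is at most the positive part of ln(m/u), hence at most a multiple of
  u^(-d) for any d > 0; d = 1/(2p) stays below the critical exponent 1/p.\<close>

lemma F_in_lorentz:
  assumes p: "1 < p" and r: "0 < r"
  shows "F \<in> lorentz_space lebesgue Q0 p r"
proof -
  define d where "d = 1 / (2 * p)"
  have d: "0 < d" "d < 1 / p" using p by (auto simp: d_def field_simps)
  define b where "b = m powr d / d"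
  have b: "0 \<le> b" using d by (simp add: b_def)
  have "rearrangement lebesgue Q0 (\<lambda>x. ennreal \<bar>F x\<bar>) u \<le> ennreal (b * u powr (- d))" if u: "0 < u" for u
  proof -
    define a where "a = max 0 (ln (m / u))"
    have "0 \<le> a" by (simp add: a_def)
    then have "{x \<in> Q0. ennreal \<bar>F x\<bar> > ennreal a} = {x \<in> Q0. F x > a}"
      by (intro Collect_cong conj_cong refl) (simp add: F_nonneg ennreal_less_iff)
    then have "emeasure lebesgue {x \<in> Q0. ennreal \<bar>F x\<bar> > ennreal a} = ennreal (m * exp (- a))"
      using F_level_measure[OF \<open>0 \<le> a\<close>] by (simp only:)
    also have "\<dots> \<le> ennreal u"
    proof (rule ennreal_leI)
      have "m * exp (- a) \<le> m * exp (- ln (m / u))" using m_pos by (intro mult_left_mono) (auto simp: a_def)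
      also have "\<dots> = u" using m_pos u by (simp add: exp_minus)
      finally show "m * exp (- a) \<le> u" .
    qed
    finally have "rearrangement lebesgue Q0 (\<lambda>x. ennreal \<bar>F x\<bar>) u \<le> ennreal a"
      by (rule rearrangement_le[OF \<open>0 \<le> a\<close>])
    also have "ennreal a \<le> ennreal ((m / u) powr d / d)"
    proof (rule ennreal_leI)
      show "a \<le> (m / u) powr d / d"
    proof (cases "1 \<le> m / u")
      case True
      then show ?thesis using ln_powr_bound[OF True d(1)] d by (simp add: a_def)
    next
      case False
      then have "ln (m / u) \<le> 0" using m_pos u by simp
      then show ?thesis using d by (simp add: a_def)
    qed
    qed
    also have "(m / u) powr d / d = b * u powr (- d)"
      using m_pos u by (simp add: b_def powr_divide powr_minus field_simps)
    finally show ?thesis by simp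
  qed
  then have "lorentz_functional p r 1 (rearrangement lebesgue Q0 (\<lambda>x. ennreal \<bar>F x\<bar>))
      \<le> lorentz_functional p r 1 (\<lambda>u. ennreal (b * u powr (- d)))"
    by (intro lorentz_mono[OF r]) auto
  also have "\<dots> < \<infinity>"
    using lorentz_powr_le[of p r b 1 d] p r b d by (auto intro: le_less_trans)
  finally have "rroot r (lorentz_functional p r 1 (rearrangement lebesgue Q0 (\<lambda>x. ennreal \<bar>F x\<bar>))) < \<infinity>"
    by (rule rroot_finite)
  then show ?thesis
    using F_restrict Q0_leb by (simp add: lorentz_space_def lorentz_quasinorm_def Let_def rroot_def)
qed

lemma average_nonneg: "0 \<le> average lebesgue Q0 F"
  unfolding average_def set_lebesgue_integral_def
  using F_nonneg by (intro divide_nonneg_nonneg integral_nonneg_AE AE_I2) (auto simp: indicator_def)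

text \<open>Keeping only the upper side, F > a + A implies that F deviates from its average A by
  more than a. Non-negativity of A makes a + A an admissible level of
  \<open>F_level_measure\<close>. For large u the left side is \<open>ennreal\<close> of a negative
  number, that is 0.\<close>

lemma rearrangement_lower:
  assumes u: "0 < u"
  shows "ennreal (ln (m / u) - average lebesgue Q0 F) \<le> rearrangement lebesgue Q0 (\<lambda>x. ennreal \<bar>F x - average lebesgue Q0 F\<bar>) u"
  unfolding rearrangement_def
proof (rule Inf_greatest, clarify)
  fix a :: real
  define A where "A = average lebesgue Q0 F"
  assume a: "0 \<le> a" and le: "emeasure lebesgue {x \<in> Q0. ennreal a < ennreal \<bar>F x - average lebesgue Q0 F\<bar>} \<le> ennreal u"
  have A: "0 \<le> A" using average_nonneg by (simp add: A_def)
  have eq: "{x \<in> Q0. ennreal a < ennreal \<bar>F x - A\<bar>} = {x \<in> Q0. a < \<bar>F x - A\<bar>}"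
    using a by (auto simp: ennreal_less_iff)
  have "ennreal (m * exp (- (a + A))) = emeasure lebesgue {x \<in> Q0. F x > a + A}"
    using a A by (intro F_level_measure[symmetric]) auto
  also have "\<dots> \<le> emeasure lebesgue {x \<in> Q0. a < \<bar>F x - A\<bar>}"
  proof (rule emeasure_mono)
    have "{x \<in> Q0. a < \<bar>F x - A\<bar>} \<in> sets borel" by (rule F_level) (simp add: Q0, measurable)
    then show "{x \<in> Q0. a < \<bar>F x - A\<bar>} \<in> sets lebesgue" by simp
  qed auto
  also have "\<dots> \<le> ennreal u" using le unfolding A_def[symmetric] eq .
  finally have "m * exp (- (a + A)) \<le> u" using u by (simp add: ennreal_le_iff)
  then have "m * exp (- (a + A)) * exp (a + A) \<le> u * exp (a + A)" by (rule mult_right_mono) simp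
  moreover have "m * exp (- (a + A)) * exp (a + A) = m" by (simp add: mult.assoc exp_add[symmetric])
  ultimately have "m \<le> u * exp (a + A)" by linarith
  then have "m / u \<le> exp (a + A)" using u by (simp add: pos_divide_le_eq mult.commute)
  then have "ln (m / u) \<le> ln (exp (a + A))" using m_pos u by (subst ln_le_cancel_iff) auto
  then have "ln (m / u) \<le> a + A" by simp
  then show "ennreal (ln (m / u) - average lebesgue Q0 F) \<le> ennreal a"
    by (intro ennreal_leI) (simp add: A_def)
qed

section \<open>Failure of the inequality below the exponent p\<close>

lemma rpow_const_unbounded:
  assumes "0 < r"
  obtains y where "0 < y" "D < rpow_const r y"
proof (cases "r = \<infinity>")
  case True
  then show ?thesis using that[of "max 1 (D + 1)"] by (simp add: rpow_const_def)
next
  case False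
  define s where "s = enn2real r"
  have s: "0 < s" unfolding s_def by (rule enn2real_pos[OF assms False])
  define y where "y = (max 1 (D + 1)) powr (1 / s)"
  have "rpow_const r y = max 1 (D + 1)"
    using s False by (simp add: rpow_const_def y_def s_def[symmetric] powr_powr)
  then show ?thesis using that[of y] by (auto simp: y_def)
qed

text \<open>With \<open>S F\<close> bounded, the right side is at most of order t^(r/p), or t^(1/p)
  for the supremum. The left side, tested near its upper limit T, is at least of order T^(r/p) times
  the r-th power of ln(1/T). In terms of x = 1 - ln t the ratio of the r-th roots grows like x^(1 -
  \<gamma>/p), which is unbounded for \<gamma> < p.\<close>

lemma not_sharp_inequality:
  assumes p: "1 < p" and r: "0 < r" and \<gamma>: "\<gamma> < p" and b: "0 < b" and S: "\<And>x. S F x \<le> ennreal b"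
  shows "\<not> sharp_inequality lebesgue Q0 p r \<gamma> S"
proof
  assume "sharp_inequality lebesgue Q0 p r \<gamma> S"
  then obtain C where C: "0 < C" and ineq: "\<And>t. t \<in> {0<..<1} \<Longrightarrow>
      lorentz_functional p r (t * (1 - ln t) powr (- \<gamma>)) (rearrangement lebesgue Q0 (\<lambda>x. ennreal \<bar>F x - average lebesgue Q0 F\<bar>))
      \<le> ennreal C * lorentz_functional p r t (rearrangement lebesgue Q0 (S F))"
    using F_in_lorentz[OF p r] unfolding sharp_inequality_def by blast
  define A where "A = average lebesgue Q0 F"
  define g where "g = rearrangement lebesgue Q0 (\<lambda>x. ennreal \<bar>F x - A\<bar>)"
  \<comment> \<open>All constants of the final comparison: 2 from \<open>rpow_le_lorentz\<close>,
    \<open>C\<close> from the assumed inequality, the rest from the functional of the constant b.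
    The contradiction arises once the ratio exceeds a \<open>y\<close> with
    \<open>D < rpow_const r y\<close>.\<close>
  define D where "D = 2 * C * lconst p r * rpow_const r b"
  have lc: "0 < lconst p r" using p enn2real_pos[OF r] by (auto simp: lconst_def)
  have D: "0 \<le> D" using C lc rpow_const_pos[OF b, of r] by (simp add: D_def)
  obtain y where y: "0 < y" "D < rpow_const r y" using rpow_const_unbounded[OF r] by blast
  define \<theta> where "\<theta> = \<gamma> / p"
  have \<theta>: "\<theta> < 1" using \<gamma> p by (simp add: \<theta>_def)
  \<comment> \<open>Here x is 1 - ln t and the bracket is ln(m/T) - A written in x; the factor
    (1/2)^(1/p) comes from the weight at T/2.\<close>
  have "filterlim (\<lambda>x. (1 / 2) powr (1 / p) * (x powr (- \<theta>) * (ln m + x - 1 + \<gamma> * ln x - A))) at_top at_top"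
  proof -
    have "filterlim (\<lambda>x :: real. q * (x powr (- \<theta>) * (x + B + \<gamma> * ln x))) at_top at_top" if "0 < q" for q B
      using that \<theta> by real_asymp
    from this[of "(1 / 2) powr (1 / p)" "ln m - 1 - A"] show ?thesis
      by (simp add: algebra_simps)
  qed
  then have "\<forall>\<^sub>F x in at_top. y \<le> (1 / 2) powr (1 / p) * (x powr (- \<theta>) * (ln m + x - 1 + \<gamma> * ln x - A))"
    by (simp add: filterlim_at_top)
  then have "\<forall>\<^sub>F x in at_top. 1 < x \<and> y \<le> (1 / 2) powr (1 / p) * (x powr (- \<theta>) * (ln m + x - 1 + \<gamma> * ln x - A))"
    using eventually_gt_at_top[of 1] by eventually_elim auto
  then obtain x where x: "1 < x" "y \<le> (1 / 2) powr (1 / p) * (x powr (- \<theta>) * (ln m + x - 1 + \<gamma> * ln x - A))"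
    using eventually_happens by (metis (mono_tags, lifting) trivial_limit_at_top_linorder)
  define t where "t = exp (1 - x)"
  have t: "0 < t" "t < 1" "1 - ln t = x" using x by (auto simp: t_def)
  define T where "T = t * x powr (- \<gamma>)"
  have T: "0 < T" using t x by (simp add: T_def)
  have lnT: "ln (m / T) = ln m + x - 1 + \<gamma> * ln x"
    using m_pos t x by (simp add: T_def ln_div ln_mult ln_powr t_def)
  have g_anti: "antimono g" unfolding g_def by (intro antimonoI rearrangement_antimono)
  have "ennreal (rpow_const r (y * t powr (1 / p))) = rpow r (ennreal (y * t powr (1 / p)))"
    using y by (intro rpow_ennreal[symmetric]) auto
  also have "\<dots> \<le> rpow r (ennreal ((T / 2) powr (1 / p)) * g T)"
  proof (rule rpow_mono[OF r])
    have "y * t powr (1 / p) \<le> (1 / 2) powr (1 / p) * (x powr (- \<theta>) * (ln (m / T) - A)) * t powr (1 / p)"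
      using x unfolding lnT by (intro mult_right_mono) auto
    also have "\<dots> = (T / 2) powr (1 / p) * (ln (m / T) - A)"
      using t x by (simp add: T_def powr_mult powr_divide powr_powr \<theta>_def)
    finally have le: "y * t powr (1 / p) \<le> (T / 2) powr (1 / p) * (ln (m / T) - A)" .
    have "ennreal (y * t powr (1 / p)) \<le> ennreal ((T / 2) powr (1 / p) * (ln (m / T) - A))"
      by (rule ennreal_leI[OF le])
    also have "\<dots> = ennreal ((T / 2) powr (1 / p)) * ennreal (ln (m / T) - A)"
      by (rule ennreal_mult') simp
    also have "\<dots> \<le> ennreal ((T / 2) powr (1 / p)) * g T"
      unfolding g_def A_def by (intro mult_left_mono rearrangement_lower T) simp
    finally show "ennreal (y * t powr (1 / p)) \<le> ennreal ((T / 2) powr (1 / p)) * g T" .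
  qed
  also have "\<dots> \<le> 2 * lorentz_functional p r T g"
    using p by (intro rpow_le_lorentz[OF _ r g_anti T]) auto
  also have "\<dots> \<le> 2 * (ennreal C * lorentz_functional p r t (rearrangement lebesgue Q0 (S F)))"
    using ineq[of t] t unfolding T_def g_def A_def by (intro mult_left_mono) auto
  also have "\<dots> \<le> 2 * (ennreal C * ennreal (lconst p r * rpow_const r (b * t powr (1 / p))))"
  proof (intro mult_left_mono)
    have lev: "{x \<in> Q0. S F x > ennreal b} = {}" using S linorder_not_less by blast
    have "rearrangement lebesgue Q0 (S F) u \<le> ennreal b" for u
      by (rule rearrangement_le[OF less_imp_le[OF b]]) (simp only: lev emeasure_empty zero_le)
    then have "lorentz_functional p r t (rearrangement lebesgue Q0 (S F)) \<le> lorentz_functional p r t (\<lambda>u. ennreal (b * u powr (- 0)))"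
      by (intro lorentz_mono[OF r]) auto
    also have "\<dots> \<le> ennreal (lconst (1 / (1 / p - 0)) r * rpow_const r (b * t powr (1 / p - 0)))"
      using p b t r by (intro lorentz_powr_le) auto
    finally show "lorentz_functional p r t (rearrangement lebesgue Q0 (S F)) \<le> ennreal (lconst p r * rpow_const r (b * t powr (1 / p)))"
      by simp
  qed auto
  also have "\<dots> = ennreal (2 * (C * (lconst p r * rpow_const r (b * t powr (1 / p)))))"
    using C lc by (simp add: ennreal_mult')
  finally have "ennreal (rpow_const r (y * t powr (1 / p))) \<le> ennreal (2 * (C * (lconst p r * rpow_const r (b * t powr (1 / p)))))" .
  moreover have "rpow_const r (z * t powr (1 / p)) = rpow_const r z * rpow_const r (t powr (1 / p))" if "0 \<le> z" for z
    using that by (simp add: rpow_const_def powr_mult)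
  ultimately have "ennreal (rpow_const r y * rpow_const r (t powr (1 / p))) \<le> ennreal (D * rpow_const r (t powr (1 / p)))"
    using y b by (simp add: D_def mult_ac)
  moreover have tp: "0 < rpow_const r (t powr (1 / p))" using t by (intro rpow_const_pos) auto
  ultimately have "rpow_const r y * rpow_const r (t powr (1 / p)) \<le> D * rpow_const r (t powr (1 / p))"
    using D by (subst (asm) ennreal_le_iff) auto
  then show False using y(2) tp by simp
qed

end

theorem theorem2p8:
  shows
   "(\<forall>(\<mu> :: (real ^ 'n) measure) Q0 p r.
       radon_measure \<mu> \<and> doubling_measure \<mu> \<and> is_cube Q0 \<and> 1 < p \<and> 0 < r \<longrightarrow>
         sharp_inequality (completion \<mu>) Q0 p r p (sharp_maximal (completion \<mu>) Q0)) \<and>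
    (\<forall>(Q0 :: (real ^ 'n) set) p r \<gamma>.
       is_cube Q0 \<and> 1 < p \<and> 0 < r \<longrightarrow>
         (sharp_inequality lebesgue Q0 p r \<gamma> (sharp_maximal lebesgue Q0) \<longleftrightarrow> p \<le> \<gamma>)) \<and>
    (\<exists>s0. 0 < s0 \<and> s0 < 1 \<and>
       (\<forall>s. 0 < s \<and> s \<le> s0 \<longrightarrow>
         (\<forall>(\<mu> :: (real ^ 'n) measure) Q0 p r.
            radon_measure \<mu> \<and> doubling_measure \<mu> \<and> is_cube Q0 \<and> 1 < p \<and> 0 < r \<longrightarrow>
              sharp_inequality (completion \<mu>) Q0 p r p (local_sharp_maximal s (completion \<mu>) Q0)) \<and>
         (\<forall>(Q0 :: (real ^ 'n) set) p r \<gamma>.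
            is_cube Q0 \<and> 1 < p \<and> 0 < r \<longrightarrow>
              (sharp_inequality lebesgue Q0 p r \<gamma> (local_sharp_maximal s lebesgue Q0) \<longleftrightarrow> p \<le> \<gamma>))))"
proof -
  have pos1: "sharp_inequality (completion \<mu>) Q0 p r p (sharp_maximal (completion \<mu>) Q0)"
    and pos2: "s \<le> 1 / 8 \<Longrightarrow> sharp_inequality (completion \<mu>) Q0 p r p (local_sharp_maximal s (completion \<mu>) Q0)"
    if \<mu>: "radon_measure \<mu>" "doubling_measure \<mu>" and Q0: "is_cube Q0" "1 < p" "0 < r"
    for \<mu> :: "(real ^ 'n) measure" and Q0 p r s
  proof -
    obtain C where "doubling_space \<mu> C" using \<mu> by (rule doubling_spaceI)
    then interpret doubling_space \<mu> C .
    show "sharp_inequality (completion \<mu>) Q0 p r p (sharp_maximal (completion \<mu>) Q0)"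
      using Q0 by (intro sharp_inequality_sharp_maximal)
    show "s \<le> 1 / 8 \<Longrightarrow> sharp_inequality (completion \<mu>) Q0 p r p (local_sharp_maximal s (completion \<mu>) Q0)"
      using Q0 by (intro sharp_inequality_local_sharp_maximal)
  qed
  \<comment> \<open>The coordinate \<open>undefined\<close> is an arbitrary element of the index
    type; every coordinate serves equally for the logarithm.\<close>
  have iff: "sharp_inequality lebesgue Q0 p r \<gamma> S \<longleftrightarrow> p \<le> \<gamma>"
    if pos: "sharp_inequality lebesgue Q0 p r p S" and Q0: "is_cube Q0" and p: "1 < p" and r: "0 < r"
      and b: "0 < b" and S: "\<And>c l x. 0 < l \<Longrightarrow> Q0 = cube c l \<Longrightarrow> S (log_example.F c l undefined) x \<le> ennreal b"
    for Q0 :: "(real ^ 'n) set" and p r \<gamma> S b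
  proof
    assume ineq: "sharp_inequality lebesgue Q0 p r \<gamma> S"
    obtain c l where cl: "0 < l" "Q0 = cube c l" using Q0 by (auto simp: is_cube_def)
    interpret log_example Q0 c l undefined by unfold_locales (use cl in auto)
    show "p \<le> \<gamma>" using not_sharp_inequality[OF p r _ b, of \<gamma> S] S[OF cl] ineq by (meson not_le)
  next
    assume "p \<le> \<gamma>"
    then show "sharp_inequality lebesgue Q0 p r \<gamma> S" using pos by (rule sharp_inequality_mono[OF r])
  qed
  \<comment> \<open>\<open>lebesgue\<close> is the completion of \<open>lborel\<close>, so the
    positive direction is the general case applied to a doubling Radon measure.\<close>
  have iff1: "sharp_inequality lebesgue Q0 p r \<gamma> (sharp_maximal lebesgue Q0) \<longleftrightarrow> p \<le> \<gamma>"
    if "is_cube Q0" "1 < p" "0 < r" for Q0 :: "(real ^ 'n) set" and p r \<gamma>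
  proof (rule iff[where b = 4])
    show "sharp_inequality lebesgue Q0 p r p (sharp_maximal lebesgue Q0)"
      using that by (intro pos1 radon_lborel doubling_lborel)
    fix c l x assume "0 < l" "Q0 = cube c l"
    then interpret log_example Q0 c l undefined by unfold_locales
    show "sharp_maximal lebesgue Q0 F x \<le> ennreal 4" by (rule sharp_maximal_le)
  qed (use that in auto)
  have iff2: "sharp_inequality lebesgue Q0 p r \<gamma> (local_sharp_maximal s lebesgue Q0) \<longleftrightarrow> p \<le> \<gamma>"
    if "is_cube Q0" "1 < p" "0 < r" "0 < s" "s \<le> 1 / 8" for Q0 :: "(real ^ 'n) set" and p r \<gamma> s
  proof (rule iff[where b = "4 / s"])
    show "sharp_inequality lebesgue Q0 p r p (local_sharp_maximal s lebesgue Q0)"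
      using that by (intro pos2 radon_lborel doubling_lborel)
    fix c l x assume "0 < l" "Q0 = cube c l"
    then interpret log_example Q0 c l undefined by unfold_locales
    show "local_sharp_maximal s lebesgue Q0 F x \<le> ennreal (4 / s)"
      using that by (intro local_sharp_maximal_le)
  qed (use that in auto)
  \<comment> \<open>The threshold 1/8 comes from \<open>near\<close>; it serves all dimensions and
    all doubling constants.\<close>
  show ?thesis
    using pos1 pos2 iff1 iff2 by (intro conjI allI impI exI[of _ "1 / 8"]) auto
qed

end
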